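(* Let $\kappa\in L^1(\mathbb{R}^N\setminus\Omega)\cap L^\infty(\mathbb{R}^N\setminus\Omega)$ be non-negative and $d\mu=\kappa\,dx$. Then for every $z\in L^2((0,T);L^2(\mathbb{R}^N\setminus\Omega,\mu))$ there exists a unique weak solution $u\in L^2((0,T);W^{s,2}_{\Omega,\kappa})\cap H^1((0,T);(W^{s,2}_{\Omega,\kappa})^\star)$ of the fractional parabolic Robin problem $$\begin{cases}\partial_t u+(-\Delta)^s u=0 & \text{in } Q,\\ \mathcal{N}_s u+\kappa u=\kappa z & \text{in }\Sigma,\\ u(0,\cdot)=0 & \text{in }\Omega.\end{cases}$$
   Context: $N\ge 1$, $0<s<1$, $T>0$; $\Omega\subset\mathbb{R}^N$ is a bounded domain with Lipschitz continuous boundary; $Q:=(0,T)\times\Omega$, $\Sigma:=(0,T)\times(\mathbb{R}^N\setminus\Omega)$. $C_{N,s}:=\frac{s2^{2s}\Gamma(\frac{2s+N}{2})}{\pi^{N/2}\Gamma(1-s)}$; $(-\Delta)^s u(x)=C_{N,s}\,\mathrm{P.V.}\int_{\mathbb{R}^N}\frac{u(x)-u(y)}{|x-y|^{N+2s}}dy$; the nonlocal normal derivative is $\mathcal{N}_s u(x):=C_{N,s}\int_\Omega\frac{u(x)-u(y)}{|x-y|^{N+2s}}dy$ for $x\in\mathbb{R}^N\setminus\overline\Omega$. Put $\mathbb{R}^{2N}\setminus(\mathbb{R}^N\setminus\Omega)^2:=(\Omega\times\Omega)\cup(\Omega\times(\mathbb{R}^N\setminus\Omega))\cup((\mathbb{R}^N\setminus\Omega)\times\Omega)$.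 $W^{s,2}_{\Omega,\kappa}$ is the Hilbert space of measurable $u:\mathbb{R}^N\to\mathbb{R}$ with finite norm $$\|u\|_{W^{s,2}_{\Omega,\kappa}}:=\left(\|u\|^2_{L^2(\Omega)}+\|u\|^2_{L^2(\mathbb{R}^N\setminus\Omega,\mu)}+\int\int_{\mathbb{R}^{2N}\setminus(\mathbb{R}^N\setminus\Omega)^2}\frac{|u(x)-u(y)|^2}{|x-y|^{N+2s}}dxdy\right)^{1/2},$$ and $(W^{s,2}_{\Omega,\kappa})^\star$ is its dual. The time derivative $\partial_t u$ is that of $u$ regarded as the element $v\mapsto\int_\Omega u(t,\cdot)v\,dx$ of the dual. Weak solution: $u\in L^2((0,T);W^{s,2}_{\Omega,\kappa})\cap H^1((0,T);(W^{s,2}_{\Omega,\kappa})^\star)$ with $u(0,\cdot)=0$ in $\Omega$ and $$\langle\partial_t u,v\rangle+\frac{C_{N,s}}{2}\int\int_{\mathbb{R}^{2N}\setminus(\mathbb{R}^N\setminus\Omega)^2}\frac{(u(x)-u(y))(v(x)-v(y))}{|x-y|^{N+2s}}dxdy+\int_{\mathbb{R}^N\setminus\Omega}\kappa uv\,dx=\int_{\mathbb{R}^N\setminus\Omega}\kappa zv\,dx$$ for every $v\in W^{s,2}_{\Omega,\kappa}$ and almost every $t\in(0,T)$. *)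

theory Defs
  imports "HOL-Analysis.Analysis"
begin

text \<open>Near each boundary point, after a rotation taking \<open>e\<close> to the last coordinate direction,
  the set is the strict epigraph of a Lipschitz function of the remaining coordinates, that is,
  of the orthogonal projection onto the hyperplane \<open>{y. y \<bullet> e = 0}\<close>.\<close>

definition lipschitz_boundary :: "'a::euclidean_space set \<Rightarrow> bool" where
  "lipschitz_boundary \<Omega> \<longleftrightarrow>
     (\<forall>p\<in>frontier \<Omega>. \<exists>e r L \<gamma>. norm e = 1 \<and> 0 < r \<and>
        L-lipschitz_on {y. y \<bullet> e = 0} (\<gamma> :: 'a \<Rightarrow> real) \<and>
        \<Omega> \<inter> ball p r = {x \<in> ball p r. \<gamma> (x - (x \<bullet> e) *\<^sub>R e) < x \<bullet> e})"

text \<open>The spaces of functions below depend on terms (a domain, a weight, an exponent), so they are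
  given by a carrier \<open>X\<close> of real functions and a norm \<open>nrm\<close> on it, with pointwise vector
  operations. Elements are representatives: functions at norm distance 0 are identified.\<close>

definition bochner_measurable ::
  "'t measure \<Rightarrow> ('i \<Rightarrow> real) set \<Rightarrow> (('i \<Rightarrow> real) \<Rightarrow> real) \<Rightarrow> ('t \<Rightarrow> 'i \<Rightarrow> real) \<Rightarrow> bool" where
  "bochner_measurable M X nrm f \<longleftrightarrow>
     (\<exists>S. (\<forall>n::nat. simple_function M (S n) \<and> S n ` space M \<subseteq> X) \<and>
          (AE t in M. f t \<in> X \<and> (\<lambda>n. nrm (\<lambda>i. S n t i - f t i)) \<longlonglongrightarrow> 0))"

definition bochner_L2 ::
  "'t measure \<Rightarrow> ('i \<Rightarrow> real) set \<Rightarrow> (('i \<Rightarrow> real) \<Rightarrow> real) \<Rightarrow> ('t \<Rightarrow> 'i \<Rightarrow> real) set" where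
  "bochner_L2 M X nrm =
     {f. bochner_measurable M X nrm f \<and> integrable M (\<lambda>t. (nrm (f t))\<^sup>2)}"

definition continuous_into ::
  "real set \<Rightarrow> ('i \<Rightarrow> real) set \<Rightarrow> (('i \<Rightarrow> real) \<Rightarrow> real) \<Rightarrow> (real \<Rightarrow> 'i \<Rightarrow> real) \<Rightarrow> bool" where
  "continuous_into I X nrm f \<longleftrightarrow>
     (\<forall>t\<in>I. f t \<in> X \<and> ((\<lambda>r. nrm (\<lambda>i. f r i - f t i)) \<longlongrightarrow> 0) (at t within I))"

definition L2_space :: "'a measure \<Rightarrow> ('a \<Rightarrow> real) set" where
  "L2_space M = {f \<in> borel_measurable M. integrable M (\<lambda>x. (f x)\<^sup>2)}"

definition L2_norm :: "'a measure \<Rightarrow> ('a \<Rightarrow> real) \<Rightarrow> real" where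
  "L2_norm M f = sqrt (LINT x|M. (f x)\<^sup>2)"

text \<open>Elements of the dual of \<open>X\<close> are functions on all of the ambient type; only their
  values on \<open>X\<close> matter.\<close>

definition dual_space :: "('i \<Rightarrow> real) set \<Rightarrow> (('i \<Rightarrow> real) \<Rightarrow> real) \<Rightarrow> (('i \<Rightarrow> real) \<Rightarrow> real) set" where
  "dual_space X nrm =
     {F. (\<forall>v\<in>X. \<forall>w\<in>X. \<forall>a b. F (\<lambda>i. a * v i + b * w i) = a * F v + b * F w) \<and>
         (\<exists>C. \<forall>v\<in>X. \<bar>F v\<bar> \<le> C * nrm v)}"

definition dual_norm :: "('i \<Rightarrow> real) set \<Rightarrow> (('i \<Rightarrow> real) \<Rightarrow> real) \<Rightarrow> (('i \<Rightarrow> real) \<Rightarrow> real) \<Rightarrow> real" where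
  "dual_norm X nrm F = (SUP v\<in>{v \<in> X. nrm v \<le> 1}. \<bar>F v\<bar>)"

definition test_function :: "real \<Rightarrow> (real \<Rightarrow> real) \<Rightarrow> bool" where
  "test_function T \<phi> \<longleftrightarrow>
     (\<forall>k. (deriv ^^ k) \<phi> differentiable_on UNIV) \<and> closure {t. \<phi> t \<noteq> 0} \<subseteq> {0<..<T}"

text \<open>The distributional derivative on \<open>(0,T)\<close> of a function with values in the dual of \<open>X\<close>:
  \<open>\<integral> \<phi>' f = - \<integral> \<phi> g\<close> as functionals on \<open>X\<close>. Evaluation at a point of \<open>X\<close>
  commutes with the integrals.\<close>

definition has_weak_time_derivative ::
  "real \<Rightarrow> ('i \<Rightarrow> real) set \<Rightarrow> (real \<Rightarrow> ('i \<Rightarrow> real) \<Rightarrow> real) \<Rightarrow> (real \<Rightarrow> ('i \<Rightarrow> real) \<Rightarrow> real) \<Rightarrow> bool" where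
  "has_weak_time_derivative T X f g \<longleftrightarrow>
     (\<forall>\<phi>. test_function T \<phi> \<longrightarrow>
        (\<forall>v\<in>X. (LINT t|lebesgue_on {0<..<T}. deriv \<phi> t * f t v) =
              - (LINT t|lebesgue_on {0<..<T}. \<phi> t * g t v)))"

definition frac_const :: "'a::euclidean_space itself \<Rightarrow> real \<Rightarrow> real" where
  "frac_const _ s = s * 2 powr (2 * s) * Gamma ((2 * s + real DIM('a)) / 2) /
                    (pi powr (real DIM('a) / 2) * Gamma (1 - s))"

definition robin_measure :: "'a::euclidean_space set \<Rightarrow> ('a \<Rightarrow> real) \<Rightarrow> 'a measure" where
  "robin_measure \<Omega> \<kappa> = density (lebesgue_on (- \<Omega>)) (\<lambda>x. ennreal (\<kappa> x))"

definition cross_region :: "'a set \<Rightarrow> ('a \<times> 'a) set" where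
  "cross_region \<Omega> = (\<Omega> \<times> \<Omega>) \<union> (\<Omega> \<times> (- \<Omega>)) \<union> ((- \<Omega>) \<times> \<Omega>)"

definition gagliardo_integrand ::
  "real \<Rightarrow> ('a::euclidean_space \<Rightarrow> real) \<Rightarrow> ('a \<Rightarrow> real) \<Rightarrow> 'a \<times> 'a \<Rightarrow> real" where
  "gagliardo_integrand s u v =
     (\<lambda>(x, y). (u x - u y) * (v x - v y) / norm (x - y) powr (real DIM('a) + 2 * s))"

definition gagliardo_form ::
  "'a::euclidean_space set \<Rightarrow> real \<Rightarrow> ('a \<Rightarrow> real) \<Rightarrow> ('a \<Rightarrow> real) \<Rightarrow> real" where
  "gagliardo_form \<Omega> s u v =
     (LINT p:cross_region \<Omega>|lebesgue \<Otimes>\<^sub>M lebesgue. gagliardo_integrand s u v p)"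

definition robin_space ::
  "'a::euclidean_space set \<Rightarrow> real \<Rightarrow> ('a \<Rightarrow> real) \<Rightarrow> ('a \<Rightarrow> real) set" where
  "robin_space \<Omega> s \<kappa> =
     {u \<in> borel_measurable lebesgue.
        integrable (lebesgue_on \<Omega>) (\<lambda>x. (u x)\<^sup>2) \<and>
        integrable (robin_measure \<Omega> \<kappa>) (\<lambda>x. (u x)\<^sup>2) \<and>
        set_integrable (lebesgue \<Otimes>\<^sub>M lebesgue) (cross_region \<Omega>) (gagliardo_integrand s u u)}"

definition robin_norm ::
  "'a::euclidean_space set \<Rightarrow> real \<Rightarrow> ('a \<Rightarrow> real) \<Rightarrow> ('a \<Rightarrow> real) \<Rightarrow> real" where
  "robin_norm \<Omega> s \<kappa> u =
     sqrt ((L2_norm (lebesgue_on \<Omega>) u)\<^sup>2 + (L2_norm (robin_measure \<Omega> \<kappa>) u)\<^sup>2 +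
           gagliardo_form \<Omega> s u u)"

abbreviation robin_dual ::
  "'a::euclidean_space set \<Rightarrow> real \<Rightarrow> ('a \<Rightarrow> real) \<Rightarrow> (('a \<Rightarrow> real) \<Rightarrow> real) set" where
  "robin_dual \<Omega> s \<kappa> \<equiv> dual_space (robin_space \<Omega> s \<kappa>) (robin_norm \<Omega> s \<kappa>)"

abbreviation robin_dual_norm ::
  "'a::euclidean_space set \<Rightarrow> real \<Rightarrow> ('a \<Rightarrow> real) \<Rightarrow> (('a \<Rightarrow> real) \<Rightarrow> real) \<Rightarrow> real" where
  "robin_dual_norm \<Omega> s \<kappa> \<equiv> dual_norm (robin_space \<Omega> s \<kappa>) (robin_norm \<Omega> s \<kappa>)"

definition to_dual :: "'a::euclidean_space set \<Rightarrow> ('a \<Rightarrow> real) \<Rightarrow> ('a \<Rightarrow> real) \<Rightarrow> real" where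
  "to_dual \<Omega> u = (\<lambda>v. LINT x|lebesgue_on \<Omega>. u x * v x)"

text \<open>An element of \<open>L\<^sup>2(0,T;W) \<inter> H\<^sup>1(0,T;W*)\<close> has a representative in
  \<open>C([0,T];L\<^sup>2(\<Omega>))\<close>; its value at time 0 is the initial value.\<close>

definition vanishes_initially ::
  "'a::euclidean_space set \<Rightarrow> real \<Rightarrow> (real \<Rightarrow> 'a \<Rightarrow> real) \<Rightarrow> bool" where
  "vanishes_initially \<Omega> T u \<longleftrightarrow>
     (\<exists>U. continuous_into {0..T} (L2_space (lebesgue_on \<Omega>)) (L2_norm (lebesgue_on \<Omega>)) U \<and>
          (AE t in lebesgue_on {0<..<T}. AE x in lebesgue_on \<Omega>. U t x = u t x) \<and>
          (AE x in lebesgue_on \<Omega>. U 0 x = 0))"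

text \<open>\<open>u'\<close> is the time derivative, which is unique up to a null set of times.\<close>

definition weak_solution ::
  "'a::euclidean_space set \<Rightarrow> real \<Rightarrow> real \<Rightarrow> ('a \<Rightarrow> real) \<Rightarrow> (real \<Rightarrow> 'a \<Rightarrow> real) \<Rightarrow>
   (real \<Rightarrow> 'a \<Rightarrow> real) \<Rightarrow> bool" where
  "weak_solution \<Omega> s T \<kappa> z u \<longleftrightarrow>
     u \<in> bochner_L2 (lebesgue_on {0<..<T}) (robin_space \<Omega> s \<kappa>) (robin_norm \<Omega> s \<kappa>) \<and>
     (\<lambda>t. to_dual \<Omega> (u t)) \<in>
        bochner_L2 (lebesgue_on {0<..<T}) (robin_dual \<Omega> s \<kappa>) (robin_dual_norm \<Omega> s \<kappa>) \<and>
     (\<exists>u'. u' \<in> bochner_L2 (lebesgue_on {0<..<T}) (robin_dual \<Omega> s \<kappa>) (robin_dual_norm \<Omega> s \<kappa>) \<and>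
        has_weak_time_derivative T (robin_space \<Omega> s \<kappa>) (\<lambda>t. to_dual \<Omega> (u t)) u' \<and>
        (\<forall>v\<in>robin_space \<Omega> s \<kappa>. AE t in lebesgue_on {0<..<T}.
           u' t v + frac_const TYPE('a) s / 2 * gagliardo_form \<Omega> s (u t) v
             + (LINT x|lebesgue_on (- \<Omega>). \<kappa> x * u t x * v x)
           = (LINT x|lebesgue_on (- \<Omega>). \<kappa> x * z t x * v x))) \<and>
     vanishes_initially \<Omega> T u"

end

theory Submission
  imports Defs
begin

text \<open>
  The unknown \<open>u(t)\<close> lives in \<open>V = W\<^sup>s\<^sup>,\<^sup>2\<close>, but the time derivative sees only its restriction to \<open>\<Omega>\<close>. With
  \<open>b u v\<close> the integral of \<open>u v\<close> over \<open>\<Omega>\<close>, \<open>k u v\<close> the integral of \<open>\<kappa> u v\<close> over the complement, \<open>e\<close> the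
  Gagliardo form and \<open>a = c e + k\<close> with \<open>c > 0\<close>, the weak equation reads
  \<open>(b (u t) v)' + a (u t) v = k (z t) v\<close> for all \<open>v \<in> V\<close>. The form \<open>b\<close> is degenerate on \<open>V\<close>, all forms are
  symmetric and nonnegative, \<open>a + b\<close> is equivalent to the squared norm of \<open>V\<close>, and \<open>k \<le> a\<close>. Everything
  up to the last section uses only these facts, in the locale \<open>degenerate_parabolic\<close>.

  Existence. If the datum is \<open>z t = exp (l t) \<zeta>\<close> on the whole line with \<open>l \<ge> 1\<close>, then \<open>u t = exp (l t) w\<close>
  solves the equation as soon as \<open>w\<close> solves \<open>l b w v + a w v = k \<zeta> v\<close>, which is the Riesz representation
  theorem for a form equivalent to the inner product (\<open>stationary_problem\<close>). Finite sums of such data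
  are dense: after \<open>r = exp t\<close> they are polynomials without constant term, and Weierstrass' theorem
  applies. It even produces sums that are small for \<open>t \<le> 0\<close> (\<open>exp_sums_dense\<close>), that is,
  approximations on the half line \<open>t < T\<close> of the datum extended by 0. These responses vanish at
  \<open>t = -\<infinity>\<close>, so the energy inequality
  \<open>(b u u)' \<le> k z z - a u u\<close> (\<open>energy_inequality\<close>) makes them small at \<open>t = 0\<close> and makes the responses of
  an approximating sequence a Cauchy sequence both in \<open>L\<^sup>2(0,T;V)\<close> and uniformly in \<open>L\<^sup>2(\<Omega>)\<close>. The first
  limit is the solution, the second its continuous representative with initial value 0
  (\<open>limit_in_V\<close>, \<open>limit_in_H\<close>, \<open>limit_solves\<close>).

  Uniqueness. For the difference \<open>d\<close> of two solutions, with continuous representative \<open>U\<close>, testing with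
  smooth approximations of the indicator of \<open>(0,\<tau>)\<close> gives the integrated equation
  \<open>b (U \<tau>) v = - \<integral>\<^sub>0\<^sup>\<tau> a (d t) v dt\<close> for every \<open>\<tau>\<close> and every \<open>v\<close> (\<open>difference_equation\<close>). Put \<open>v = d \<tau>\<close> and
  integrate over \<open>\<tau>\<close>: the right side becomes \<open>- a Q Q / 2 \<le> 0\<close> with \<open>Q = \<integral>\<^sub>0\<^sup>T d\<close>. Hence \<open>b d d = 0\<close>, then the
  integrated equation forces \<open>a (d t) v = 0\<close>, and \<open>a d d = 0\<close> follows. Exponential sums approximating
  \<open>d\<close> replace it in the second argument, so that \<open>Q\<close> is an explicit exponential sum and no
  vector-valued integral occurs. Unlike the usual argument this one does not differentiate \<open>b U U\<close>.

  The concrete spaces. The Gagliardo form is the \<open>L\<^sup>2\<close> inner product of weighted difference quotients on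
  the cross region. Completeness of \<open>V\<close> and the fact that norm 0 means 0 almost everywhere rest on the
  same observation: almost every point outside \<open>\<Omega>\<close> is joined to good points of \<open>\<Omega>\<close> by good pairs
  (\<open>AE_from_domain\<close>).
\<close>

section \<open>Semi-inner product spaces of real functions\<close>

text \<open>A carrier of real functions with a seminorm, matching the representation of spaces by representatives:
  different elements may have distance 0. Both the Hilbert spaces and their duals are instances.\<close>

locale seminormed_space =
  fixes X :: "('i \<Rightarrow> real) set" and nrm :: "('i \<Rightarrow> real) \<Rightarrow> real"
  assumes zero_mem: "(\<lambda>i. 0) \<in> X"
    and lin_mem: "v \<in> X \<Longrightarrow> w \<in> X \<Longrightarrow> (\<lambda>i. a * v i + b * w i) \<in> X"
    and nrm_nonneg: "v \<in> X \<Longrightarrow> 0 \<le> nrm v"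
    and nrm_lin: "v \<in> X \<Longrightarrow> w \<in> X \<Longrightarrow> nrm (\<lambda>i. a * v i + b * w i) \<le> \<bar>a\<bar> * nrm v + \<bar>b\<bar> * nrm w"
begin

lemma add_mem: "v \<in> X \<Longrightarrow> w \<in> X \<Longrightarrow> (\<lambda>i. v i + w i) \<in> X"
  using lin_mem[of v w 1 1] by simp

lemma diff_mem: "v \<in> X \<Longrightarrow> w \<in> X \<Longrightarrow> (\<lambda>i. v i - w i) \<in> X"
  using lin_mem[of v w 1 "-1"] by simp

lemma scale_mem: "v \<in> X \<Longrightarrow> (\<lambda>i. c * v i) \<in> X"
  using lin_mem[of v v c 0] by simp

lemma sum_mem:
  assumes "\<And>j. j \<in> J \<Longrightarrow> f j \<in> X"
  shows "(\<lambda>i. \<Sum>j\<in>J. f j i) \<in> X"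
  using assms by (induction J rule: infinite_finite_induct) (auto simp: zero_mem add_mem)

lemma nrm_zero: "nrm (\<lambda>i. 0) = 0"
  using nrm_lin[OF zero_mem zero_mem, of 0 0] nrm_nonneg[OF zero_mem] by simp

lemma nrm_add: "v \<in> X \<Longrightarrow> w \<in> X \<Longrightarrow> nrm (\<lambda>i. v i + w i) \<le> nrm v + nrm w"
  using nrm_lin[of v w 1 1] by simp

lemma nrm_diff: "v \<in> X \<Longrightarrow> w \<in> X \<Longrightarrow> nrm (\<lambda>i. v i - w i) \<le> nrm v + nrm w"
  using nrm_lin[of v w 1 "-1"] by simp

lemma nrm_scale_le: "v \<in> X \<Longrightarrow> nrm (\<lambda>i. c * v i) \<le> \<bar>c\<bar> * nrm v"
  using nrm_lin[of v v c 0] by simp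

lemma nrm_diff_commute:
  assumes "v \<in> X" "w \<in> X" shows "nrm (\<lambda>i. v i - w i) = nrm (\<lambda>i. w i - v i)"
  using nrm_scale_le[OF diff_mem[OF assms], of "-1"] nrm_scale_le[OF diff_mem[OF assms(2,1)], of "-1"]
  by simp

lemma nrm_diff_triangle:
  assumes "u \<in> X" "v \<in> X" "w \<in> X"
  shows "nrm (\<lambda>i. u i - w i) \<le> nrm (\<lambda>i. u i - v i) + nrm (\<lambda>i. v i - w i)"
  using nrm_add[OF diff_mem[OF assms(1,2)] diff_mem[OF assms(2,3)]] by simp

lemma nrm_le_diff: "u \<in> X \<Longrightarrow> v \<in> X \<Longrightarrow> nrm u \<le> nrm v + nrm (\<lambda>i. u i - v i)"
  using nrm_add[of v "\<lambda>i. u i - v i"] by (simp add: diff_mem)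

lemma nrm_reverse_triangle:
  assumes "u \<in> X" "v \<in> X"
  shows "\<bar>nrm u - nrm v\<bar> \<le> nrm (\<lambda>i. u i - v i)"
  using nrm_le_diff[OF assms] nrm_le_diff[OF assms(2,1)] nrm_diff_commute[OF assms] by linarith

lemma nrm_sum:
  assumes "\<And>j. j \<in> J \<Longrightarrow> f j \<in> X"
  shows "nrm (\<lambda>i. \<Sum>j\<in>J. f j i) \<le> (\<Sum>j\<in>J. nrm (f j))"
  using assms
proof (induction J rule: infinite_finite_induct)
  case (insert x F)
  then show ?case using nrm_add[of "f x" "\<lambda>i. \<Sum>j\<in>F. f j i"] sum_mem[of F f] by (simp add: sum_mem) 
qed (auto simp: nrm_zero)

lemma nrm_tendsto:
  assumes "\<And>n. u n \<in> X" "l \<in> X" "(\<lambda>n. nrm (\<lambda>i. u n i - l i)) \<longlonglongrightarrow> 0"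
  shows "(\<lambda>n. nrm (u n)) \<longlonglongrightarrow> nrm l"
proof -
  have "(\<lambda>n. nrm (u n) - nrm l) \<longlonglongrightarrow> 0"
    by (rule Lim_null_comparison[OF _ assms(3)]) (use nrm_reverse_triangle assms in auto)
  then show ?thesis by (simp add: LIM_zero_iff)
qed

end

text \<open>Completeness in the form of the summability test. It is the form that is easiest to
  verify for spaces of measurable functions, where absolutely summable series converge pointwise.\<close>

definition abs_complete :: "('i \<Rightarrow> real) set \<Rightarrow> (('i \<Rightarrow> real) \<Rightarrow> real) \<Rightarrow> bool" where
  "abs_complete X nrm \<longleftrightarrow>
     (\<forall>d. (\<forall>n::nat. d n \<in> X) \<and> summable (\<lambda>n. nrm (d n)) \<longrightarrow>
        (\<exists>u\<in>X. (\<lambda>n. nrm (\<lambda>i. u i - (\<Sum>j<n. d j i))) \<longlonglongrightarrow> 0))"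

lemma (in seminormed_space) summable_steps_converge:
  assumes compl: "abs_complete X nrm" and u: "\<And>n. u n \<in> X"
    and s: "summable (\<lambda>n. nrm (\<lambda>i. u (Suc n) i - u n i))"
  shows "\<exists>l\<in>X. (\<lambda>n. nrm (\<lambda>i. u n i - l i)) \<longlonglongrightarrow> 0"
proof -
  define d where "d n = (case n of 0 \<Rightarrow> u 0 | Suc m \<Rightarrow> (\<lambda>i. u (Suc m) i - u m i))" for n
  have dX: "d n \<in> X" for n by (cases n) (auto simp: d_def u diff_mem)
  have "summable (\<lambda>n. nrm (d n))"
    by (subst summable_Suc_iff[symmetric]) (simp add: d_def s)
  then obtain l where l: "l \<in> X" "(\<lambda>n. nrm (\<lambda>i. l i - (\<Sum>j<n. d j i))) \<longlonglongrightarrow> 0"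
    using compl dX unfolding abs_complete_def by blast
  have sm: "(\<Sum>j<Suc n. d j i) = u n i" for n i
    by (induction n) (auto simp: d_def)
  have "(\<lambda>n. nrm (\<lambda>i. l i - (\<Sum>j<Suc n. d j i))) \<longlonglongrightarrow> 0"
    using l(2) by (rule LIMSEQ_Suc)
  then show ?thesis using l(1) u nrm_diff_commute by (intro bexI[of _ l]) (simp_all del: sum.lessThan_Suc add: sm)
qed

locale semi_inner_space =
  fixes X :: "('i \<Rightarrow> real) set" and ip :: "('i \<Rightarrow> real) \<Rightarrow> ('i \<Rightarrow> real) \<Rightarrow> real"
  assumes zero_mem': "(\<lambda>i. 0) \<in> X"
    and lin_mem': "v \<in> X \<Longrightarrow> w \<in> X \<Longrightarrow> (\<lambda>i. a * v i + b * w i) \<in> X"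
    and ip_lin: "v \<in> X \<Longrightarrow> w \<in> X \<Longrightarrow> y \<in> X \<Longrightarrow>
                  ip (\<lambda>i. a * v i + b * w i) y = a * ip v y + b * ip w y"
    and ip_sym: "v \<in> X \<Longrightarrow> w \<in> X \<Longrightarrow> ip v w = ip w v"
    and ip_nonneg: "v \<in> X \<Longrightarrow> 0 \<le> ip v v"
begin

abbreviation nrm :: "('i \<Rightarrow> real) \<Rightarrow> real" where "nrm v \<equiv> sqrt (ip v v)"

lemma ip_lin_right: "v \<in> X \<Longrightarrow> w \<in> X \<Longrightarrow> y \<in> X \<Longrightarrow>
    ip y (\<lambda>i. a * v i + b * w i) = a * ip y v + b * ip y w"
  by (simp add: ip_sym[of y] lin_mem' ip_lin)

lemma nrm_sq: "v \<in> X \<Longrightarrow> (nrm v)\<^sup>2 = ip v v"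
  by (simp add: ip_nonneg)

lemma ip_lin_square:
  assumes "v \<in> X" "w \<in> X"
  shows "ip (\<lambda>i. a * v i + b * w i) (\<lambda>i. a * v i + b * w i) = a\<^sup>2 * ip v v + 2 * a * b * ip v w + b\<^sup>2 * ip w w"
  using assms by (simp add: ip_lin ip_lin_right lin_mem' ip_sym[of w v] power2_eq_square algebra_simps)

lemma cauchy_schwarz:
  assumes "v \<in> X" "w \<in> X"
  shows "\<bar>ip v w\<bar> \<le> nrm v * nrm w"
proof -
  have *: "0 \<le> a\<^sup>2 * ip v v + 2 * a * b * ip v w + b\<^sup>2 * ip w w" for a b
    using ip_nonneg[OF lin_mem'[OF assms, of a b]] ip_lin_square[OF assms, of a b] by simp
  have "(ip v w)\<^sup>2 \<le> ip v v * ip w w"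
  proof (cases "ip w w = 0")
    case True
    have "ip v w = 0"
    proof (rule ccontr)
      assume n: "ip v w \<noteq> 0"
      have "0 \<le> ip v v + 2 * b * ip v w" for b using *[of 1 b] True by simp
      from this[of "- (ip v v + 1) / (2 * ip v w)"] n show False by (simp add: field_simps)
    qed
    then show ?thesis using True by simp
  next
    case False
    then have p: "ip w w > 0" using ip_nonneg[OF assms(2)] by simp
    have "0 \<le> ip w w * (ip v v * ip w w - (ip v w)\<^sup>2)"
      using *[of "ip w w" "- ip v w"] by (simp add: power2_eq_square algebra_simps)
    then show ?thesis using p by (simp add: zero_le_mult_iff)
  qed
  then have "sqrt ((ip v w)\<^sup>2) \<le> sqrt (ip v v * ip w w)" by (rule real_sqrt_le_mono)
  then show ?thesis by (simp add: real_sqrt_mult)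
qed

sublocale seminormed_space X nrm
proof
  fix v w :: "'i \<Rightarrow> real" and a b :: real assume vw: "v \<in> X" "w \<in> X"
  have cs: "a * b * ip v w \<le> \<bar>a\<bar> * \<bar>b\<bar> * (nrm v * nrm w)"
  proof -
    have "a * b * ip v w \<le> \<bar>a * b\<bar> * \<bar>ip v w\<bar>" by (simp add: abs_mult[symmetric])
    also have "\<dots> \<le> \<bar>a * b\<bar> * (nrm v * nrm w)" by (intro mult_left_mono cauchy_schwarz vw) auto
    finally show ?thesis by (simp add: abs_mult)
  qed
  show "nrm (\<lambda>i. a * v i + b * w i) \<le> \<bar>a\<bar> * nrm v + \<bar>b\<bar> * nrm w"
  proof (rule real_le_lsqrt)
    show "ip (\<lambda>i. a * v i + b * w i) (\<lambda>i. a * v i + b * w i) \<le> (\<bar>a\<bar> * nrm v + \<bar>b\<bar> * nrm w)\<^sup>2"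
      unfolding ip_lin_square[OF vw] power2_sum power_mult_distrib nrm_sq[OF vw(1)] nrm_sq[OF vw(2)]
      using cs by (simp add: algebra_simps)
  qed (auto simp: ip_nonneg vw)
qed (auto simp: zero_mem' lin_mem' ip_nonneg)

lemma ip_zero_left: "y \<in> X \<Longrightarrow> ip (\<lambda>i. 0) y = 0"
  using ip_lin[OF zero_mem zero_mem, of y 0 0] by simp

lemma ip_diff_left: "v \<in> X \<Longrightarrow> w \<in> X \<Longrightarrow> y \<in> X \<Longrightarrow> ip (\<lambda>i. v i - w i) y = ip v y - ip w y"
  using ip_lin[of v w y 1 "-1"] by simp

lemma ip_scale_left: "v \<in> X \<Longrightarrow> y \<in> X \<Longrightarrow> ip (\<lambda>i. c * v i) y = c * ip v y"
  using ip_lin[of v v y c 0] by simp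

lemma ip_Lipschitz: "v \<in> X \<Longrightarrow> w \<in> X \<Longrightarrow> y \<in> X \<Longrightarrow> \<bar>ip v y - ip w y\<bar> \<le> nrm y * nrm (\<lambda>i. v i - w i)"
  using cauchy_schwarz[of "\<lambda>i. v i - w i" y] by (simp add: ip_diff_left diff_mem mult.commute)

end

lemma semi_inner_space_combine:
  assumes "semi_inner_space X f" "semi_inner_space X g" "0 \<le> (c::real)" "0 \<le> d"
  shows "semi_inner_space X (\<lambda>u v. c * f u v + d * g u v)"
proof -
  interpret f: semi_inner_space X f by fact
  interpret g: semi_inner_space X g by fact
  show ?thesis
    by standard (auto simp: f.zero_mem f.lin_mem f.ip_lin g.ip_lin f.ip_nonneg g.ip_nonneg assms algebra_simps
        f.ip_sym[of v w for v w] g.ip_sym[of v w for v w])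
qed

lemma semi_inner_space_subset:
  assumes "semi_inner_space X f" "semi_inner_space Y g" "Y \<subseteq> X"
  shows "semi_inner_space Y f"
proof -
  interpret f: semi_inner_space X f by fact
  interpret g: semi_inner_space Y g by fact
  show ?thesis
    by standard (use assms(3) in \<open>auto simp: subset_iff g.zero_mem g.lin_mem f.ip_lin f.ip_nonneg intro: f.ip_sym\<close>)
qed

text \<open>Riesz representation. A minimising sequence of \<open>v \<mapsto> ip v v - 2 * l v\<close> is a Cauchy
  sequence by the parallelogram identity, and the minimiser represents \<open>l\<close>.\<close>

lemma (in semi_inner_space) riesz_representation:
  assumes compl: "abs_complete X nrm"
    and lin: "\<And>v w a b. v \<in> X \<Longrightarrow> w \<in> X \<Longrightarrow> l (\<lambda>i. a * v i + b * w i) = a * l v + b * l w"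
    and bd: "\<And>v. v \<in> X \<Longrightarrow> \<bar>l v\<bar> \<le> C * nrm v"
  shows "\<exists>w\<in>X. \<forall>v\<in>X. ip w v = l v"
proof -
  define J where "J v = ip v v - 2 * l v" for v
  have Jlow: "- C\<^sup>2 \<le> J v" if "v \<in> X" for v
  proof -
    have "0 \<le> (nrm v - C)\<^sup>2" by simp
    then have "2 * (C * nrm v) \<le> ip v v + C\<^sup>2" by (simp only: power2_diff nrm_sq[OF that]) (simp add: mult.commute mult.left_commute)
    then show ?thesis using bd[OF that] by (simp add: J_def)
  qed
  define m where "m = Inf (J ` X)"
  have bb: "bdd_below (J ` X)" using Jlow by (auto intro!: bdd_belowI[of _ "- C\<^sup>2"])
  have mJ: "m \<le> J v" if "v \<in> X" for v unfolding m_def by (rule cInf_lower) (use that bb in auto)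
  have "\<exists>v\<in>X. J v < m + (1/4)^n" for n
  proof -
    have "Inf (J ` X) < m + (1/4)^n" by (simp add: m_def)
    then show ?thesis using zero_mem by (subst (asm) cInf_less_iff) (auto simp: bb)
  qed
  then obtain u where u: "\<And>n. u n \<in> X" "\<And>n::nat. J (u n) < m + (1/4)^n" by metis
  \<comment> \<open>Parallelogram identity at the midpoint, where \<open>J\<close> is at least \<open>m\<close>.\<close>
  have par: "ip (\<lambda>i. v i - w i) (\<lambda>i. v i - w i) \<le> 2 * (J v - m) + 2 * (J w - m)"
    if vw: "v \<in> X" "w \<in> X" for v w
  proof -
    have "m \<le> J (\<lambda>i. 1/2 * v i + 1/2 * w i)" by (intro mJ lin_mem vw)
    also have "\<dots> = (1/4) * ip v v + (1/2) * ip v w + (1/4) * ip w w - l v - l w"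
      unfolding J_def ip_lin_square[OF vw] lin[OF vw] by (simp add: power2_eq_square)
    finally show ?thesis using ip_lin_square[OF vw, of 1 "-1"] by (simp add: J_def algebra_simps)
  qed
  have step: "nrm (\<lambda>i. u (Suc n) i - u n i) \<le> 2 * (1/2)^n" for n
  proof (rule real_le_lsqrt)
    have "ip (\<lambda>i. u (Suc n) i - u n i) (\<lambda>i. u (Suc n) i - u n i) \<le> 2 * (1/4)^Suc n + 2 * (1/4)^n"
      using par[OF u(1)[of "Suc n"] u(1)[of n]] less_imp_le[OF u(2)[of n]] less_imp_le[OF u(2)[of "Suc n"]] by argo
    also have "\<dots> \<le> 4 * (1/4)^n" by simp
    also have "\<dots> = (2 * (1/2)^n)\<^sup>2" by (simp add: power2_eq_square flip: power_mult_distrib)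
    finally show "ip (\<lambda>i. u (Suc n) i - u n i) (\<lambda>i. u (Suc n) i - u n i) \<le> (2 * (1/2)^n)\<^sup>2" .
  qed auto
  have "summable (\<lambda>n. nrm (\<lambda>i. u (Suc n) i - u n i))"
    by (rule summable_comparison_test'[where g="\<lambda>n. 2 * (1/2)^n" and N=0])
       (use step in \<open>auto simp: ip_nonneg diff_mem u intro!: summable_mult summable_geometric\<close>)
  from summable_steps_converge[OF compl u(1) this]
  obtain w where w: "w \<in> X" "(\<lambda>n. nrm (\<lambda>i. u n i - w i)) \<longlonglongrightarrow> 0" by blast
  have lu: "(\<lambda>n. l (u n)) \<longlonglongrightarrow> l w"
  proof -
    have "(\<lambda>n. l (u n) - l w) \<longlonglongrightarrow> 0"
    proof (rule Lim_null_comparison)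
      show "\<forall>\<^sub>F n in sequentially. norm (l (u n) - l w) \<le> C * nrm (\<lambda>i. u n i - w i)"
        using bd[OF diff_mem[OF u(1) w(1)]] lin[OF u(1) w(1), where a=1 and b="-1"] by (intro always_eventually) auto
      show "(\<lambda>n. C * nrm (\<lambda>i. u n i - w i)) \<longlonglongrightarrow> 0" using tendsto_mult_right_zero[OF w(2)] by simp
    qed
    then show ?thesis by (simp add: LIM_zero_iff)
  qed
  have "(\<lambda>n. (nrm (u n))\<^sup>2 - 2 * l (u n)) \<longlonglongrightarrow> (nrm w)\<^sup>2 - 2 * l w"
    by (intro tendsto_intros lu nrm_tendsto u w)
  then have Jw: "(\<lambda>n. J (u n)) \<longlonglongrightarrow> J w" by (simp add: J_def ip_nonneg u w)
  have "J w \<le> m"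
  proof (rule LIMSEQ_le[OF Jw])
    show "(\<lambda>n. m + (1/4)^n) \<longlonglongrightarrow> m" by (auto intro!: tendsto_eq_intros LIMSEQ_power_zero)
    show "\<exists>N. \<forall>n\<ge>N. J (u n) \<le> m + (1/4)^n" using u(2) less_imp_le by blast
  qed
  have "ip w v = l v" if v: "v \<in> X" for v
  proof -
    have q: "0 \<le> 2 * r * (ip w v - l v) + r\<^sup>2 * ip v v" for r
    proof -
      have "J w \<le> J (\<lambda>i. 1 * w i + r * v i)" using \<open>J w \<le> m\<close> mJ[OF lin_mem[OF w(1) v, of 1 r]] by linarith
      then show ?thesis unfolding J_def ip_lin_square[OF w(1) v] lin[OF w(1) v] by (simp add: algebra_simps)
    qed
    define D where "D = ip w v - l v"
    define B where "B = ip v v + 1"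
    have B: "B > 0" "ip v v \<le> B" using ip_nonneg[OF v] by (auto simp: B_def)
    have "0 \<le> 2 * (- D / B) * D + (- D / B)\<^sup>2 * ip v v" using q D_def by blast
    also have "\<dots> \<le> 2 * (- D / B) * D + (- D / B)\<^sup>2 * B" using B by (intro add_left_mono mult_left_mono) auto
    also have "\<dots> = - (D\<^sup>2 / B)" using B by (simp add: field_simps power2_eq_square)
    finally have "D\<^sup>2 \<le> 0" using B by (simp add: field_simps)
    then show ?thesis by (simp add: D_def)
  qed
  then show ?thesis using w(1) by blast
qed

section \<open>Square integrable functions with values in a seminormed space\<close>

lemma (in complete_measure) borel_measurable_AE_LIMSEQ:
  fixes f :: "'a \<Rightarrow> real"
  assumes S: "\<And>n. S n \<in> borel_measurable M" and lim: "AE x in M. (\<lambda>n. S n x) \<longlonglongrightarrow> f x"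
  shows "f \<in> borel_measurable M"
proof -
  obtain N where N: "{x\<in>space M. \<not> (\<lambda>n. S n x) \<longlonglongrightarrow> f x} \<subseteq> N" "N \<in> null_sets M"
    using lim unfolding eventually_ae_filter by blast
  have [measurable]: "N \<in> sets M" using N(2) by auto
  note S[measurable]
  define g where "g x = (if x \<in> N then 0 else f x)" for x
  have g: "g \<in> borel_measurable M"
    by (rule borel_measurable_LIMSEQ_metric[where f="\<lambda>n x. if x \<in> N then 0 else S n x"])
       (use N in \<open>auto simp: g_def\<close>)
  show ?thesis
  proof (rule measurableI)
    fix A :: "real set" assume A: "A \<in> sets borel"
    have "f -` A \<inter> space M = (g -` A \<inter> space M - N) \<union> (f -` A \<inter> space M \<inter> N)" by (auto simp: g_def)
    moreover have "f -` A \<inter> space M \<inter> N \<in> sets M"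
      using complete2[OF _ N(2), of "f -` A \<inter> space M \<inter> N"] by auto
    moreover have "g -` A \<inter> space M \<in> sets M" using g A by (rule measurable_sets)
    ultimately show "f -` A \<inter> space M \<in> sets M"
      using \<open>N \<in> sets M\<close> by (metis sets.Un sets.Diff)
  qed simp
qed

text \<open>Measurability of norms of strongly measurable functions is obtained from almost everywhere
  limits, for which completeness of the measure is essential.\<close>

lemma complete_measure_lebesgue_on:
  assumes "S \<in> sets lebesgue"
  shows "complete_measure (lebesgue_on S)"
proof
  fix A B :: "'a set" assume "B \<subseteq> A" "A \<in> null_sets (lebesgue_on S)"
  then have "A \<in> null_sets lebesgue" "A \<subseteq> S"
    using assms by (auto simp: null_sets_restrict_space)
  then have "B \<in> null_sets lebesgue" using \<open>B \<subseteq> A\<close>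
    using completion.complete2 by blast
  then show "B \<in> sets (lebesgue_on S)"
    using \<open>A \<subseteq> S\<close> \<open>B \<subseteq> A\<close> assms by (auto simp: sets_restrict_space_iff)
qed

context seminormed_space
begin

lemma bochner_measurable_approximants:
  assumes "bochner_measurable M X nrm f"
  shows "\<exists>S. (\<forall>n::nat. simple_function M (S n)) \<and> (\<forall>n. \<forall>t\<in>space M. S n t \<in> X) \<and>
    (AE t in M. f t \<in> X \<and> (\<lambda>n. nrm (\<lambda>i. S n t i - f t i)) \<longlonglongrightarrow> 0)"
  using assms unfolding bochner_measurable_def image_subset_iff by blast

lemma bochner_measurable_AE_mem:
  assumes "bochner_measurable M X nrm f" shows "AE t in M. f t \<in> X"
proof -
  from bochner_measurable_approximants[OF assms]
  obtain S where "AE t in M. f t \<in> X \<and> (\<lambda>n::nat. nrm (\<lambda>i. S n t i - f t i)) \<longlonglongrightarrow> 0" by blast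
  then show ?thesis by eventually_elim blast
qed

lemma Lipschitz_comp_measurable:
  assumes M: "complete_measure M" and f: "bochner_measurable M X nrm f"
    and h: "\<And>x y. x \<in> X \<Longrightarrow> y \<in> X \<Longrightarrow> \<bar>h x - h y\<bar> \<le> C * nrm (\<lambda>i. x i - y i)"
  shows "(\<lambda>t. h (f t) :: real) \<in> borel_measurable M"
proof -
  obtain S where S: "\<And>n::nat. simple_function M (S n)" "\<And>n t. t \<in> space M \<Longrightarrow> S n t \<in> X"
    "AE t in M. f t \<in> X \<and> (\<lambda>n. nrm (\<lambda>i. S n t i - f t i)) \<longlonglongrightarrow> 0"
    using bochner_measurable_approximants[OF f] by blast
  interpret complete_measure M by fact
  show ?thesis
  proof (rule borel_measurable_AE_LIMSEQ[where S="\<lambda>n t. h (S n t)"])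
    show "(\<lambda>t. h (S n t)) \<in> borel_measurable M" for n
      by (rule borel_measurable_simple_function[OF simple_function_compose1[OF S(1)]])
    show "AE t in M. (\<lambda>n. h (S n t)) \<longlonglongrightarrow> h (f t)"
      using S(3)
    proof (rule AE_mp, intro AE_I2 impI)
      fix t assume t: "t \<in> space M" and *: "f t \<in> X \<and> (\<lambda>n. nrm (\<lambda>i. S n t i - f t i)) \<longlonglongrightarrow> 0"
      have "(\<lambda>n. h (S n t) - h (f t)) \<longlonglongrightarrow> 0"
      proof (rule Lim_null_comparison)
        show "\<forall>\<^sub>F n in sequentially. norm (h (S n t) - h (f t)) \<le> C * nrm (\<lambda>i. S n t i - f t i)"
          using h S(2) t * by auto
        show "(\<lambda>n. C * nrm (\<lambda>i. S n t i - f t i)) \<longlonglongrightarrow> 0"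
          using * tendsto_mult_right_zero by blast
      qed
      then show "(\<lambda>n. h (S n t)) \<longlonglongrightarrow> h (f t)" by (simp add: LIM_zero_iff)
    qed
  qed
qed

lemma nrm_comp_measurable:
  assumes "complete_measure M" "bochner_measurable M X nrm f"
  shows "(\<lambda>t. nrm (f t)) \<in> borel_measurable M"
  by (rule Lipschitz_comp_measurable[where C=1]) (use assms nrm_reverse_triangle in auto)

lemma bochner_measurable_lin:
  assumes "bochner_measurable M X nrm f" "bochner_measurable M X nrm g"
  shows "bochner_measurable M X nrm (\<lambda>t i. a * f t i + b * g t i)"
proof -
  obtain S where S: "\<And>n::nat. simple_function M (S n)" "\<And>n t. t \<in> space M \<Longrightarrow> S n t \<in> X"
    "AE t in M. f t \<in> X \<and> (\<lambda>n. nrm (\<lambda>i. S n t i - f t i)) \<longlonglongrightarrow> 0"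
    using bochner_measurable_approximants[OF assms(1)] by blast
  obtain R where R: "\<And>n::nat. simple_function M (R n)" "\<And>n t. t \<in> space M \<Longrightarrow> R n t \<in> X"
    "AE t in M. g t \<in> X \<and> (\<lambda>n. nrm (\<lambda>i. R n t i - g t i)) \<longlonglongrightarrow> 0"
    using bochner_measurable_approximants[OF assms(2)] by blast
  show ?thesis
    unfolding bochner_measurable_def
  proof (intro exI[of _ "\<lambda>n t i. a * S n t i + b * R n t i"] conjI allI)
    fix n
    show "simple_function M (\<lambda>t i. a * S n t i + b * R n t i)"
      using simple_function_compose2[OF S(1)[of n] R(1)[of n], where h="\<lambda>v w i. a * v i + b * w i"] by simp
    show "(\<lambda>t i. a * S n t i + b * R n t i) ` space M \<subseteq> X" using S(2) R(2) lin_mem by auto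
  next
    show "AE t in M. (\<lambda>i. a * f t i + b * g t i) \<in> X \<and>
       (\<lambda>n. nrm (\<lambda>i. (a * S n t i + b * R n t i) - (a * f t i + b * g t i))) \<longlonglongrightarrow> 0"
      using S(3) R(3) AE_space
    proof (eventually_elim, safe)
      fix t assume ts: "t \<in> space M" and t: "f t \<in> X" "(\<lambda>n. nrm (\<lambda>i. S n t i - f t i)) \<longlonglongrightarrow> 0" "g t \<in> X" "(\<lambda>n. nrm (\<lambda>i. R n t i - g t i)) \<longlonglongrightarrow> 0"
      show "(\<lambda>i. a * f t i + b * g t i) \<in> X" using t lin_mem by auto
      show "(\<lambda>n. nrm (\<lambda>i. (a * S n t i + b * R n t i) - (a * f t i + b * g t i))) \<longlonglongrightarrow> 0"
      proof (rule Lim_null_comparison)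
        show "\<forall>\<^sub>F n in sequentially. norm (nrm (\<lambda>i. (a * S n t i + b * R n t i) - (a * f t i + b * g t i)))
                \<le> \<bar>a\<bar> * nrm (\<lambda>i. S n t i - f t i) + \<bar>b\<bar> * nrm (\<lambda>i. R n t i - g t i)"
        proof (intro always_eventually allI)
          fix n
          have m: "(\<lambda>i. S n t i - f t i) \<in> X" "(\<lambda>i. R n t i - g t i) \<in> X"
            using diff_mem S(2) R(2) ts t by auto
          have e: "(\<lambda>i. (a * S n t i + b * R n t i) - (a * f t i + b * g t i)) =
                (\<lambda>i. a * (S n t i - f t i) + b * (R n t i - g t i))" by (simp add: algebra_simps)
          show "norm (nrm (\<lambda>i. (a * S n t i + b * R n t i) - (a * f t i + b * g t i)))
                \<le> \<bar>a\<bar> * nrm (\<lambda>i. S n t i - f t i) + \<bar>b\<bar> * nrm (\<lambda>i. R n t i - g t i)"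
            unfolding e using nrm_lin[OF m] nrm_nonneg[OF lin_mem[OF m]] by simp
        qed
        show "(\<lambda>n. \<bar>a\<bar> * nrm (\<lambda>i. S n t i - f t i) + \<bar>b\<bar> * nrm (\<lambda>i. R n t i - g t i)) \<longlonglongrightarrow> 0"
          using tendsto_add[OF tendsto_mult_right_zero[OF t(2)] tendsto_mult_right_zero[OF t(4)]] by simp
      qed
    qed
  qed
qed

lemma bochner_L2_iff:
  "f \<in> bochner_L2 M X nrm \<longleftrightarrow> bochner_measurable M X nrm f \<and> integrable M (\<lambda>t. (nrm (f t))\<^sup>2)"
  by (simp add: bochner_L2_def)

lemma bochner_L2_AE_mem: "f \<in> bochner_L2 M X nrm \<Longrightarrow> AE t in M. f t \<in> X"
  by (simp add: bochner_L2_iff bochner_measurable_AE_mem)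

lemma bochner_L2_lin:
  assumes M: "complete_measure M" and f: "f \<in> bochner_L2 M X nrm" and g: "g \<in> bochner_L2 M X nrm"
  shows "(\<lambda>t i. a * f t i + b * g t i) \<in> bochner_L2 M X nrm"
proof -
  have bm: "bochner_measurable M X nrm (\<lambda>t i. a * f t i + b * g t i)"
    using f g by (intro bochner_measurable_lin) (auto simp: bochner_L2_iff)
  have "integrable M (\<lambda>t. (nrm (\<lambda>i. a * f t i + b * g t i))\<^sup>2)"
  proof (rule Bochner_Integration.integrable_bound)
    show "integrable M (\<lambda>t. 2 * a\<^sup>2 * (nrm (f t))\<^sup>2 + 2 * b\<^sup>2 * (nrm (g t))\<^sup>2)"
      using f g by (auto simp: bochner_L2_iff)
    show "(\<lambda>t. (nrm (\<lambda>i. a * f t i + b * g t i))\<^sup>2) \<in> borel_measurable M"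
      using nrm_comp_measurable[OF M bm] by measurable
    show "AE t in M. norm ((nrm (\<lambda>i. a * f t i + b * g t i))\<^sup>2)
        \<le> norm (2 * a\<^sup>2 * (nrm (f t))\<^sup>2 + 2 * b\<^sup>2 * (nrm (g t))\<^sup>2)"
      using bochner_L2_AE_mem[OF f] bochner_L2_AE_mem[OF g]
    proof eventually_elim
      fix t assume m: "f t \<in> X" "g t \<in> X"
      have "(nrm (\<lambda>i. a * f t i + b * g t i))\<^sup>2 \<le> (\<bar>a\<bar> * nrm (f t) + \<bar>b\<bar> * nrm (g t))\<^sup>2"
        by (intro power_mono nrm_lin m nrm_nonneg lin_mem)
      also have "\<dots> \<le> 2 * (\<bar>a\<bar> * nrm (f t))\<^sup>2 + 2 * (\<bar>b\<bar> * nrm (g t))\<^sup>2"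
        using sum_squares_bound[of "\<bar>a\<bar> * nrm (f t)" "\<bar>b\<bar> * nrm (g t)"] by (simp add: power2_sum)
      finally show "norm ((nrm (\<lambda>i. a * f t i + b * g t i))\<^sup>2)
        \<le> norm (2 * a\<^sup>2 * (nrm (f t))\<^sup>2 + 2 * b\<^sup>2 * (nrm (g t))\<^sup>2)"
        by (simp add: power_mult_distrib)
    qed
  qed
  then show ?thesis using bm by (simp add: bochner_L2_iff)
qed

lemma bochner_L2_add:
  assumes "complete_measure M" "f \<in> bochner_L2 M X nrm" "g \<in> bochner_L2 M X nrm"
  shows "(\<lambda>t i. f t i + g t i) \<in> bochner_L2 M X nrm"
  using bochner_L2_lin[OF assms, of 1 1] by simp

lemma bochner_L2_diff:
  assumes "complete_measure M" "f \<in> bochner_L2 M X nrm" "g \<in> bochner_L2 M X nrm"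
  shows "(\<lambda>t i. f t i - g t i) \<in> bochner_L2 M X nrm"
  using bochner_L2_lin[OF assms, of 1 "-1"] by simp

text \<open>The approximating simple functions are cut off where they are much larger than \<open>f\<close>, so that
  dominated convergence applies.\<close>

lemma bochner_L2_simple_approximation:
  assumes M: "complete_measure M" and f: "f \<in> bochner_L2 M X nrm" and "0 < \<epsilon>"
  shows "\<exists>S. simple_function M S \<and> S ` space M \<subseteq> X \<and> S \<in> bochner_L2 M X nrm \<and>
             (LINT t|M. (nrm (\<lambda>i. f t i - S t i))\<^sup>2) < \<epsilon>"
proof -
  have bm: "bochner_measurable M X nrm f" and int: "integrable M (\<lambda>t. (nrm (f t))\<^sup>2)"
    using f by (auto simp: bochner_L2_iff)
  obtain S where S: "\<And>n::nat. simple_function M (S n)" "\<And>n t. t \<in> space M \<Longrightarrow> S n t \<in> X"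
    "AE t in M. f t \<in> X \<and> (\<lambda>n. nrm (\<lambda>i. S n t i - f t i)) \<longlonglongrightarrow> 0"
    using bochner_measurable_approximants[OF bm] by blast
  note [measurable] = nrm_comp_measurable[OF M bm]
  have [measurable]: "(\<lambda>t. nrm (S n t)) \<in> borel_measurable M" for n
    by (rule borel_measurable_simple_function[OF simple_function_compose1[OF S(1), where g=nrm]])
  define B where "B n = {t \<in> space M. nrm (S n t) \<le> 2 * nrm (f t)}" for n
  have [measurable]: "B n \<in> sets M" for n unfolding B_def by (intro borel_measurable_le borel_measurable_times borel_measurable_const) measurable
  define R where "R n t = (if t \<in> B n then S n t else (\<lambda>i. 0))" for n t
  have R: "simple_function M (R n)" for n
  proof -
    have "simple_function M (\<lambda>t. if t \<in> B n then S n t else (\<lambda>i. 0))"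
    proof (rule simple_function_If_set[OF S(1)])
      show "simple_function M (\<lambda>t. (\<lambda>i::'i. 0::real))" by (rule simple_function_const)
      show "B n \<inter> space M \<in> sets M" by simp
    qed
    then show ?thesis by (simp only: R_def[abs_def])
  qed
  have RX: "R n t \<in> X" if "t \<in> space M" for n t using S(2)[OF that] by (auto simp: R_def zero_mem)
  have Rbm: "bochner_measurable M X nrm (R n)" for n
    unfolding bochner_measurable_def
  proof (intro exI[of _ "\<lambda>_. R n"] conjI allI AE_I2)
    show "(\<lambda>t. R n t) ` space M \<subseteq> X" using RX by blast
    show "(\<lambda>k::nat. nrm (\<lambda>i. R n t i - R n t i)) \<longlonglongrightarrow> 0" for t by (simp add: nrm_zero)
  qed (rule R, rule RX)
  have Rle: "nrm (R n t) \<le> 2 * nrm (f t)" if "f t \<in> X" "t \<in> space M" for n t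
  proof (cases "t \<in> B n")
    case True
    then have "nrm (S n t) \<le> 2 * nrm (f t)" unfolding B_def by blast
    then show ?thesis using True by (simp only: R_def if_True)
  next
    case False
    then have "R n t = (\<lambda>i. 0)" by (simp add: R_def)
    then show ?thesis using nrm_nonneg[OF that(1)] by (simp only: nrm_zero)
  qed
  have RL2: "R n \<in> bochner_L2 M X nrm" for n
    unfolding bochner_L2_iff
  proof (intro conjI Rbm, rule Bochner_Integration.integrable_bound)
    show "integrable M (\<lambda>t. 4 * (nrm (f t))\<^sup>2)" using int by simp
    show "(\<lambda>t. (nrm (R n t))\<^sup>2) \<in> borel_measurable M"
      using nrm_comp_measurable[OF M Rbm] by measurable
    show "AE t in M. norm ((nrm (R n t))\<^sup>2) \<le> norm (4 * (nrm (f t))\<^sup>2)"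
      using bochner_measurable_AE_mem[OF bm] AE_space
    proof eventually_elim
      fix t assume t: "f t \<in> X" "t \<in> space M"
      have "(nrm (R n t))\<^sup>2 \<le> (2 * nrm (f t))\<^sup>2" by (intro power_mono Rle t nrm_nonneg RX)
      then show "norm ((nrm (R n t))\<^sup>2) \<le> norm (4 * (nrm (f t))\<^sup>2)" by (simp add: power_mult_distrib)
    qed
  qed
  have lim: "AE t in M. (\<lambda>n. (nrm (\<lambda>i. f t i - R n t i))\<^sup>2) \<longlonglongrightarrow> 0"
    using S(3) AE_space
  proof eventually_elim
    fix t assume t: "f t \<in> X \<and> (\<lambda>n. nrm (\<lambda>i. S n t i - f t i)) \<longlonglongrightarrow> 0" "t \<in> space M"
    have lS: "(\<lambda>n. nrm (S n t)) \<longlonglongrightarrow> nrm (f t)" using nrm_tendsto[of "\<lambda>n. S n t" "f t"] t S(2) by blast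
    have "(\<lambda>n. nrm (\<lambda>i. f t i - R n t i)) \<longlonglongrightarrow> 0"
    proof (cases "nrm (f t) = 0")
      case True
      have "nrm (\<lambda>i. f t i - R n t i) \<le> 0" for n
        using nrm_diff[of "f t" "R n t"] Rle[of t n] RX[of t n] t True by simp
      moreover have "0 \<le> nrm (\<lambda>i. f t i - R n t i)" for n
        by (intro nrm_nonneg diff_mem RX) (use t in auto)
      ultimately have "nrm (\<lambda>i. f t i - R n t i) = 0" for n by (intro order_antisym)
      then show ?thesis by simp
    next
      case False
      then have "nrm (f t) < 2 * nrm (f t)" using nrm_nonneg[of "f t"] t by simp
      from order_tendstoD(2)[OF lS this]
      have "\<forall>\<^sub>F n in sequentially. t \<in> B n" by eventually_elim (use t in \<open>auto simp: B_def\<close>)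
      then have ev: "\<forall>\<^sub>F n in sequentially. nrm (\<lambda>i. S n t i - f t i) = nrm (\<lambda>i. f t i - R n t i)"
        by eventually_elim (use t S(2) in \<open>auto simp: R_def intro: nrm_diff_commute\<close>)
      have "(\<lambda>n. nrm (\<lambda>i. S n t i - f t i)) \<longlonglongrightarrow> 0" using t by blast
      from this ev show ?thesis by (rule Lim_transform_eventually)
    qed
    then show "(\<lambda>n. (nrm (\<lambda>i. f t i - R n t i))\<^sup>2) \<longlonglongrightarrow> 0" using tendsto_power[of _ 0 _ 2] by force
  qed
  have "(\<lambda>n. LINT t|M. (nrm (\<lambda>i. f t i - R n t i))\<^sup>2) \<longlonglongrightarrow> (LINT t|M. 0)"
  proof (rule integral_dominated_convergence[where w="\<lambda>t. 9 * (nrm (f t))\<^sup>2"])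
    show "(\<lambda>t. (nrm (\<lambda>i. f t i - R n t i))\<^sup>2) \<in> borel_measurable M" for n
      using bochner_L2_diff[OF M f RL2[of n]] by (auto simp: bochner_L2_iff)
    show "AE t in M. norm ((nrm (\<lambda>i. f t i - R n t i))\<^sup>2) \<le> 9 * (nrm (f t))\<^sup>2" for n
      using bochner_measurable_AE_mem[OF bm] AE_space
    proof eventually_elim
      fix t assume t: "f t \<in> X" "t \<in> space M"
      have "nrm (\<lambda>i. f t i - R n t i) \<le> 3 * nrm (f t)"
        using nrm_diff[of "f t" "R n t"] Rle[of t n] RX[of t n] t by simp
      then have "(nrm (\<lambda>i. f t i - R n t i))\<^sup>2 \<le> (3 * nrm (f t))\<^sup>2"
        by (intro power_mono nrm_nonneg diff_mem RX t)
      then show "norm ((nrm (\<lambda>i. f t i - R n t i))\<^sup>2) \<le> 9 * (nrm (f t))\<^sup>2" by (simp add: power_mult_distrib)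
    qed
  qed (use int lim in auto)
  then have "(\<lambda>n. LINT t|M. (nrm (\<lambda>i. f t i - R n t i))\<^sup>2) \<longlonglongrightarrow> 0" by simp
  from order_tendstoD(2)[OF this \<open>0 < \<epsilon>\<close>]
  have "\<forall>\<^sub>F n in sequentially. (LINT t|M. (nrm (\<lambda>i. f t i - R n t i))\<^sup>2) < \<epsilon>" .
  then obtain n where "(LINT t|M. (nrm (\<lambda>i. f t i - R n t i))\<^sup>2) < \<epsilon>"
    by (auto simp: eventually_sequentially)
  then show ?thesis using R RX RL2 by (intro exI[of _ "R n"]) auto
qed

end

text \<open>In the applications \<open>\<Phi> x\<close> is the functional \<open>v \<mapsto> \<beta> x v\<close>. The map \<open>\<Phi>\<close> is then additive only when functionals
  are compared on the carrier, so the Lipschitz bound is a hypothesis of its own.\<close>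

lemma bochner_L2_map:
  assumes X: "seminormed_space X nX" and Y: "seminormed_space Y nY" and M: "complete_measure M"
    and f: "f \<in> bochner_L2 M X nX"
    and maps: "\<And>x. x \<in> X \<Longrightarrow> \<Phi> x \<in> Y"
    and bd: "\<And>x. x \<in> X \<Longrightarrow> nY (\<Phi> x) \<le> C * nX x"
    and lip: "\<And>x y. x \<in> X \<Longrightarrow> y \<in> X \<Longrightarrow> nY (\<lambda>j. \<Phi> x j - \<Phi> y j) \<le> C * nX (\<lambda>i. x i - y i)"
  shows "(\<lambda>t. \<Phi> (f t)) \<in> bochner_L2 M Y nY"
proof -
  interpret X: seminormed_space X nX by fact
  interpret Y: seminormed_space Y nY by fact
  have bmf: "bochner_measurable M X nX f" and int: "integrable M (\<lambda>t. (nX (f t))\<^sup>2)"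
    using f by (auto simp: X.bochner_L2_iff)
  obtain S where S: "\<And>n::nat. simple_function M (S n)" "\<And>n t. t \<in> space M \<Longrightarrow> S n t \<in> X"
    "AE t in M. f t \<in> X \<and> (\<lambda>n. nX (\<lambda>i. S n t i - f t i)) \<longlonglongrightarrow> 0"
    using X.bochner_measurable_approximants[OF bmf] by blast
  have bm: "bochner_measurable M Y nY (\<lambda>t. \<Phi> (f t))"
    unfolding bochner_measurable_def
  proof (intro exI[of _ "\<lambda>n t. \<Phi> (S n t)"] conjI allI)
    show "simple_function M (\<lambda>t. \<Phi> (S n t))" for n by (rule simple_function_compose1[OF S(1)])
    show "(\<lambda>t. \<Phi> (S n t)) ` space M \<subseteq> Y" for n using S(2) maps by auto
    show "AE t in M. \<Phi> (f t) \<in> Y \<and> (\<lambda>n. nY (\<lambda>i. \<Phi> (S n t) i - \<Phi> (f t) i)) \<longlonglongrightarrow> 0"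
      using S(3) AE_space
    proof eventually_elim
      fix t assume t: "f t \<in> X \<and> (\<lambda>n. nX (\<lambda>i. S n t i - f t i)) \<longlonglongrightarrow> 0" "t \<in> space M"
      have "(\<lambda>n. nY (\<lambda>i. \<Phi> (S n t) i - \<Phi> (f t) i)) \<longlonglongrightarrow> 0"
      proof (rule Lim_null_comparison)
        show "\<forall>\<^sub>F n in sequentially. norm (nY (\<lambda>i. \<Phi> (S n t) i - \<Phi> (f t) i)) \<le> C * nX (\<lambda>i. S n t i - f t i)"
          using lip S(2) t Y.nrm_nonneg[OF Y.diff_mem] maps by (intro always_eventually) auto
        show "(\<lambda>n. C * nX (\<lambda>i. S n t i - f t i)) \<longlonglongrightarrow> 0" using t tendsto_mult_right_zero by blast
      qed
      then show "\<Phi> (f t) \<in> Y \<and> (\<lambda>n. nY (\<lambda>i. \<Phi> (S n t) i - \<Phi> (f t) i)) \<longlonglongrightarrow> 0"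
        using maps t by blast
    qed
  qed
  have "integrable M (\<lambda>t. (nY (\<Phi> (f t)))\<^sup>2)"
  proof (rule Bochner_Integration.integrable_bound)
    show "integrable M (\<lambda>t. C\<^sup>2 * (nX (f t))\<^sup>2)" using int by simp
    show "(\<lambda>t. (nY (\<Phi> (f t)))\<^sup>2) \<in> borel_measurable M" using Y.nrm_comp_measurable[OF M bm] by measurable
    show "AE t in M. norm ((nY (\<Phi> (f t)))\<^sup>2) \<le> norm (C\<^sup>2 * (nX (f t))\<^sup>2)"
      using X.bochner_measurable_AE_mem[OF bmf]
    proof eventually_elim
      fix t assume t: "f t \<in> X"
      have "(nY (\<Phi> (f t)))\<^sup>2 \<le> (C * nX (f t))\<^sup>2" by (intro power_mono bd t Y.nrm_nonneg maps)
      then show "norm ((nY (\<Phi> (f t)))\<^sup>2) \<le> norm (C\<^sup>2 * (nX (f t))\<^sup>2)" by (simp add: power_mult_distrib)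
    qed
  qed
  then show ?thesis using bm by (simp add: bochner_L2_def)
qed

section \<open>Exponential sums and their density\<close>

abbreviation time_measure :: "real \<Rightarrow> real measure" where
  "time_measure T \<equiv> lebesgue_on {0<..<T}"

lemma finite_time_measure: "finite_measure (time_measure T)"
  using emeasure_bounded_finite[of "{0<..<T}"]
  by (intro finite_measureI) (simp add: emeasure_restrict_space less_top)

lemma complete_time_measure: "complete_measure (time_measure T)"
  by (rule complete_measure_lebesgue_on) simp

lemma continuous_integrable_time:
  assumes "continuous_on {0..T} (f :: real \<Rightarrow> real)"
  shows "integrable (time_measure T) f"
proof -
  have "integrable (lebesgue_on {0..T}) f" by (rule continuous_imp_integrable_real[OF assms])
  then have "set_integrable lebesgue {0..T} f"
    by (simp add: integrable_restrict_space set_integrable_def)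
  then have "set_integrable lebesgue {0<..<T} f" by (rule set_integrable_subset) auto
  then show ?thesis by (simp add: integrable_restrict_space set_integrable_def)
qed

lemma integrable_indicator_time:
  assumes "B \<in> lmeasurable"
  shows "integrable (time_measure T) (indicator B :: real \<Rightarrow> real)"
proof (rule finite_measure.integrable_const_bound[OF finite_time_measure, where B=1])
  show "(indicator B :: real \<Rightarrow> real) \<in> borel_measurable (time_measure T)"
    by (intro measurable_restrict_space1 borel_measurable_indicator fmeasurableD assms)
qed (simp add: indicator_def)

definition exp_sum :: "(real \<times> ('i \<Rightarrow> real)) list \<Rightarrow> real \<Rightarrow> 'i \<Rightarrow> real" where
  "exp_sum L t = (\<lambda>i. \<Sum>(l, x)\<leftarrow>L. exp (l * t) * x i)"

lemma exp_sum_Nil: "exp_sum [] t = (\<lambda>i. 0)"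
  by (simp add: exp_sum_def)

lemma exp_sum_Cons: "exp_sum ((l, x) # L) t = (\<lambda>i. exp (l * t) * x i + 1 * exp_sum L t i)"
  by (simp add: exp_sum_def)

lemma exp_sum_append: "exp_sum (L @ L') t = (\<lambda>i. exp_sum L t i + exp_sum L' t i)"
  by (simp add: exp_sum_def)

text \<open>Exponents are at least 1, so that the sums decay like \<open>exp t\<close> as \<open>t\<close> tends to \<open>-\<infinity>\<close>.\<close>

definition exp_list :: "('i \<Rightarrow> real) set \<Rightarrow> (real \<times> ('i \<Rightarrow> real)) list \<Rightarrow> bool" where
  "exp_list X L \<longleftrightarrow> (\<forall>(l, x)\<in>set L. 1 \<le> l \<and> x \<in> X)"

lemma exp_list_simps [simp]:
  "exp_list X []" "exp_list X ((l, x) # L) \<longleftrightarrow> 1 \<le> l \<and> x \<in> X \<and> exp_list X L"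
  "exp_list X (L @ L') \<longleftrightarrow> exp_list X L \<and> exp_list X L'"
  by (auto simp: exp_list_def)

lemma exp_list_induct [consumes 1, case_names Nil Cons]:
  assumes "exp_list X L" "P []"
    "\<And>l x L. 1 \<le> l \<Longrightarrow> x \<in> X \<Longrightarrow> exp_list X L \<Longrightarrow> P L \<Longrightarrow> P ((l, x) # L)"
  shows "P L"
  using assms(1) by (induction L) (auto intro: assms(2,3))

lemma exp_Lipschitz:
  fixes l t r T :: real assumes "0 \<le> l" "t \<le> T" "r \<le> T"
  shows "\<bar>exp (l * t) - exp (l * r)\<bar> \<le> l * exp (l * T) * \<bar>t - r\<bar>"
proof -
  have *: "\<bar>exp (l * t) - exp (l * r)\<bar> \<le> l * exp (l * T) * \<bar>t - r\<bar>" if "r \<le> t" "t \<le> T" for t r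
  proof -
    have "exp (l * r) = exp (l * t) * exp (- (l * (t - r)))" by (simp add: exp_add[symmetric] algebra_simps)
    moreover have "1 - l * (t - r) \<le> exp (- (l * (t - r)))" using exp_ge_add_one_self[of "- (l * (t - r))"] by simp
    ultimately have "exp (l * t) - exp (l * r) \<le> exp (l * t) * (l * (t - r))"
      using mult_left_mono[of "1 - l * (t - r)" "exp (- (l * (t - r)))" "exp (l * t)"] by (simp add: algebra_simps)
    also have "\<dots> \<le> exp (l * T) * (l * (t - r))"
      using that assms by (intro mult_right_mono) (auto simp: mult_left_mono)
    finally show ?thesis using that assms by (simp add: mult_left_mono mult_ac)
  qed
  show ?thesis using *[of r t] *[of t r] assms by (cases "r \<le> t") (auto simp: abs_minus_commute)
qed

context seminormed_space
begin

lemma exp_sum_mem: "exp_list X L \<Longrightarrow> exp_sum L t \<in> X"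
  by (induction rule: exp_list_induct) (auto simp only: exp_sum_Nil exp_sum_Cons zero_mem lin_mem)

lemma exp_sum_Lipschitz:
  assumes "exp_list X L"
  shows "\<exists>B\<ge>0. \<forall>t\<le>T. \<forall>r\<le>T. nrm (\<lambda>i. exp_sum L t i - exp_sum L r i) \<le> B * \<bar>t - r\<bar>"
  using assms
proof (induction rule: exp_list_induct)
  case Nil
  show ?case by (intro exI[of _ 0]) (simp add: exp_sum_Nil nrm_zero)
next
  case (Cons l x L)
  then obtain B where B: "B \<ge> 0" "\<And>t r. t \<le> T \<Longrightarrow> r \<le> T \<Longrightarrow> nrm (\<lambda>i. exp_sum L t i - exp_sum L r i) \<le> B * \<bar>t - r\<bar>"
    by blast
  have "nrm (\<lambda>i. exp_sum ((l, x) # L) t i - exp_sum ((l, x) # L) r i) \<le> (l * exp (l * T) * nrm x + B) * \<bar>t - r\<bar>"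
    if "t \<le> T" "r \<le> T" for t r
  proof -
    have e: "(\<lambda>i. exp_sum ((l, x) # L) t i - exp_sum ((l, x) # L) r i) =
        (\<lambda>i. (exp (l * t) - exp (l * r)) * x i + 1 * (exp_sum L t i - exp_sum L r i))"
      by (simp add: exp_sum_Cons algebra_simps)
    have "nrm (\<lambda>i. exp_sum ((l, x) # L) t i - exp_sum ((l, x) # L) r i) \<le> \<bar>exp (l * t) - exp (l * r)\<bar> * nrm x + \<bar>1\<bar> * nrm (\<lambda>i. exp_sum L t i - exp_sum L r i)"
      unfolding e using Cons by (intro nrm_lin diff_mem exp_sum_mem)
    also have "\<dots> \<le> (l * exp (l * T) * \<bar>t - r\<bar>) * nrm x + B * \<bar>t - r\<bar>"
      using Cons B(2)[OF that] exp_Lipschitz[OF _ that, of l] nrm_nonneg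
      by (intro add_mono mult_right_mono) auto
    finally show ?thesis by (simp add: algebra_simps)
  qed
  moreover have "l * exp (l * T) * nrm x + B \<ge> 0" using B Cons nrm_nonneg by simp
  ultimately show ?case by blast
qed

lemma exp_sum_decay:
  assumes "exp_list X L"
  shows "\<exists>B\<ge>0. \<forall>t\<le>0. nrm (exp_sum L t) \<le> B * exp t"
  using assms
proof (induction rule: exp_list_induct)
  case Nil
  show ?case by (intro exI[of _ 0]) (simp add: exp_sum_Nil nrm_zero)
next
  case (Cons l x L)
  then obtain B where B: "B \<ge> 0" "\<And>t. t \<le> 0 \<Longrightarrow> nrm (exp_sum L t) \<le> B * exp t"
    by blast
  have "nrm (exp_sum ((l, x) # L) t) \<le> (nrm x + B) * exp t" if "t \<le> 0" for t
  proof -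
    have "nrm (exp_sum ((l, x) # L) t) \<le> \<bar>exp (l * t)\<bar> * nrm x + \<bar>1\<bar> * nrm (exp_sum L t)"
      unfolding exp_sum_Cons using Cons by (intro nrm_lin exp_sum_mem)
    also have "\<dots> \<le> exp t * nrm x + B * exp t"
      using Cons B(2)[OF that] that nrm_nonneg[of x] mult_right_mono_neg[of 1 l t]
      by (intro add_mono mult_right_mono) auto
    finally show ?thesis by (simp add: algebra_simps)
  qed
  moreover have "nrm x + B \<ge> 0" using B Cons nrm_nonneg by simp
  ultimately show ?case by blast
qed

text \<open>Sample on the grid of multiples of \<open>1 / j\<close>; the Lipschitz bound controls the error uniformly.\<close>

lemma exp_sum_uniform_simple:
  assumes L: "exp_list X L" and "0 < T" "0 < \<epsilon>"
  shows "\<exists>S. simple_function (time_measure T) S \<and>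
            (\<forall>t\<in>{0<..<T}. S t \<in> X \<and> nrm (\<lambda>i. S t i - exp_sum L t i) \<le> \<epsilon>)"
proof -
  obtain B where B: "B \<ge> 0" "\<And>t r. t \<le> T \<Longrightarrow> r \<le> T \<Longrightarrow> nrm (\<lambda>i. exp_sum L t i - exp_sum L r i) \<le> B * \<bar>t - r\<bar>"
    using exp_sum_Lipschitz[OF L, of T] by blast
  obtain n :: nat where n: "B / \<epsilon> < real n" using reals_Archimedean2 by blast
  define j where "j = real (Suc n)"
  have j: "j > 0" "B / j \<le> \<epsilon>" using n \<open>0 < \<epsilon>\<close> 
  proof -
    show "j > 0" by (simp add: j_def)
    have "B < real n * \<epsilon>" using n \<open>0 < \<epsilon>\<close> by (simp add: pos_divide_less_eq)
    also have "\<dots> \<le> j * \<epsilon>" using \<open>0 < \<epsilon>\<close> by (simp add: j_def)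
    finally show "B / j \<le> \<epsilon>" by (simp add: j_def pos_divide_le_eq mult.commute)
  qed
  define \<theta> where "\<theta> t = of_int \<lfloor>t * j\<rfloor> / j" for t :: real
  have th: "\<theta> t \<le> t" "\<bar>\<theta> t - t\<bar> \<le> 1 / j" for t
  proof -
    have f: "of_int \<lfloor>t * j\<rfloor> \<le> t * j" "t * j - of_int \<lfloor>t * j\<rfloor> \<le> 1" by linarith+
    then show le: "\<theta> t \<le> t" using j by (simp add: \<theta>_def pos_divide_le_eq)
    have "t - \<theta> t = (t * j - of_int \<lfloor>t * j\<rfloor>) / j" using j by (simp add: \<theta>_def field_simps)
    also have "\<dots> \<le> 1 / j" using f j by (intro divide_right_mono) auto
    finally show "\<bar>\<theta> t - t\<bar> \<le> 1 / j" using le by simp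
  qed
  have "simple_function (time_measure T) \<theta>"
  proof (rule simple_function_borel_measurable)
    have "\<theta> \<in> borel_measurable borel" unfolding \<theta>_def[abs_def] by measurable
    then show "\<theta> \<in> borel_measurable (time_measure T)"
      by (intro measurable_restrict_space1) (simp add: measurable_completion)
    have "\<theta> ` space (time_measure T) \<subseteq> (\<lambda>k. of_int k / j) ` {0..\<lfloor>T * j\<rfloor>}"
    proof (rule image_subsetI)
      fix t assume "t \<in> space (time_measure T)"
      then have "0 \<le> t * j" "t * j \<le> T * j" using j by simp_all
      then have "\<lfloor>t * j\<rfloor> \<in> {0..\<lfloor>T * j\<rfloor>}" by (simp add: floor_mono)
      then show "\<theta> t \<in> (\<lambda>k. of_int k / j) ` {0..\<lfloor>T * j\<rfloor>}" unfolding \<theta>_def by (rule imageI)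
    qed
    then show "finite (\<theta> ` space (time_measure T))" by (rule finite_subset) simp
  qed
  then have S: "simple_function (time_measure T) (\<lambda>t. exp_sum L (\<theta> t))"
    by (rule simple_function_compose1)
  have "nrm (\<lambda>i. exp_sum L (\<theta> t) i - exp_sum L t i) \<le> \<epsilon>" if "t \<in> {0<..<T}" for t
  proof -
    have "nrm (\<lambda>i. exp_sum L (\<theta> t) i - exp_sum L t i) \<le> B * \<bar>\<theta> t - t\<bar>"
      using that th(1)[of t] by (intro B(2)) auto
    also have "\<dots> \<le> B * (1 / j)" using B th(2) by (intro mult_left_mono) auto
    finally show ?thesis using j by simp
  qed
  then show ?thesis
    by (intro exI[of _ "\<lambda>t. exp_sum L (\<theta> t)"] conjI ballI S exp_sum_mem[OF L])
qed

lemma bochner_measurable_exp_sum_limit: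
  assumes L: "\<And>n::nat. exp_list X (L n)" and "0 < T"
    and lim: "AE t in time_measure T. f t \<in> X \<and> (\<lambda>n. nrm (\<lambda>i. exp_sum (L n) t i - f t i)) \<longlonglongrightarrow> 0"
  shows "bochner_measurable (time_measure T) X nrm f"
proof -
  have "\<forall>n. \<exists>S. simple_function (time_measure T) S \<and>
            (\<forall>t\<in>{0<..<T}. S t \<in> X \<and> nrm (\<lambda>i. S t i - exp_sum (L n) t i) \<le> 1 / real (Suc n))"
    using exp_sum_uniform_simple[OF L \<open>0 < T\<close>] by simp
  then obtain S where S: "\<And>n. simple_function (time_measure T) (S n)"
    "\<And>n t. t \<in> {0<..<T} \<Longrightarrow> S n t \<in> X"
    "\<And>n t. t \<in> {0<..<T} \<Longrightarrow> nrm (\<lambda>i. S n t i - exp_sum (L n) t i) \<le> 1 / real (Suc n)"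
    by metis
  show ?thesis
    unfolding bochner_measurable_def
  proof (intro exI[of _ S] conjI allI)
    show "S n ` space (time_measure T) \<subseteq> X" for n using S(2) by (simp only: image_subset_iff) simp
    show "AE t in time_measure T. f t \<in> X \<and> (\<lambda>n. nrm (\<lambda>i. S n t i - f t i)) \<longlonglongrightarrow> 0"
      using lim AE_space
    proof eventually_elim
      fix t assume t: "f t \<in> X \<and> (\<lambda>n. nrm (\<lambda>i. exp_sum (L n) t i - f t i)) \<longlonglongrightarrow> 0"
        and "t \<in> space (time_measure T)"
      then have tT: "t \<in> {0<..<T}" by simp
      have "(\<lambda>n. nrm (\<lambda>i. S n t i - f t i)) \<longlonglongrightarrow> 0"
      proof (rule Lim_null_comparison)
        show "\<forall>\<^sub>F n in sequentially. norm (nrm (\<lambda>i. S n t i - f t i))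
            \<le> 1 / real (Suc n) + nrm (\<lambda>i. exp_sum (L n) t i - f t i)"
        proof (intro always_eventually allI)
          fix n
          have "nrm (\<lambda>i. S n t i - f t i) \<le> nrm (\<lambda>i. S n t i - exp_sum (L n) t i) + nrm (\<lambda>i. exp_sum (L n) t i - f t i)"
            by (rule nrm_diff_triangle[OF S(2)[OF tT] exp_sum_mem[OF L]]) (use t in blast)
          moreover have "0 \<le> nrm (\<lambda>i. S n t i - f t i)"
            by (rule nrm_nonneg[OF diff_mem[OF S(2)[OF tT]]]) (use t in blast)
          ultimately show "norm (nrm (\<lambda>i. S n t i - f t i))
            \<le> 1 / real (Suc n) + nrm (\<lambda>i. exp_sum (L n) t i - f t i)"
            using S(3)[OF tT, of n] by simp
        qed
        show "(\<lambda>n. 1 / real (Suc n) + nrm (\<lambda>i. exp_sum (L n) t i - f t i)) \<longlonglongrightarrow> 0"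
          using tendsto_add[OF LIMSEQ_Suc[OF lim_1_over_n] conjunct2[OF t]] by simp
      qed
      then show "f t \<in> X \<and> (\<lambda>n. nrm (\<lambda>i. S n t i - f t i)) \<longlonglongrightarrow> 0" using t by blast
    qed
  qed (rule S)
qed

lemma exp_sum_nrm_continuous:
  assumes L: "exp_list X L"
  shows "continuous_on {..T} (\<lambda>t. nrm (exp_sum L t))"
proof -
  obtain B where B: "B \<ge> 0" "\<And>t r. t \<le> T \<Longrightarrow> r \<le> T \<Longrightarrow> nrm (\<lambda>i. exp_sum L t i - exp_sum L r i) \<le> B * \<bar>t - r\<bar>"
    using exp_sum_Lipschitz[OF L, of T] by blast
  have "B-lipschitz_on {..T} (\<lambda>t. nrm (exp_sum L t))"
  proof (rule lipschitz_onI)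
    fix t r assume "t \<in> {..T}" "r \<in> {..T}"
    then show "dist (nrm (exp_sum L t)) (nrm (exp_sum L r)) \<le> B * dist t r"
      using B(2)[of t r] nrm_reverse_triangle[OF exp_sum_mem[OF L, of t] exp_sum_mem[OF L, of r]]
      by (simp add: dist_real_def)
  qed (use B in auto)
  then show ?thesis by (rule lipschitz_on_continuous_on)
qed

lemma exp_sum_bochner_L2:
  assumes L: "exp_list X L" and "0 < T"
  shows "exp_sum L \<in> bochner_L2 (time_measure T) X nrm"
  unfolding bochner_L2_iff
proof
  show "bochner_measurable (time_measure T) X nrm (exp_sum L)"
    by (rule bochner_measurable_exp_sum_limit[of "\<lambda>n. L"]) (simp_all add: assms exp_sum_mem nrm_zero)
  have "continuous_on {0..T} (\<lambda>t. (nrm (exp_sum L t))\<^sup>2)"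
    by (intro continuous_on_power continuous_on_subset[OF exp_sum_nrm_continuous[OF L, of T]]) auto
  then show "integrable (time_measure T) (\<lambda>t. (nrm (exp_sum L t))\<^sup>2)"
    by (rule continuous_integrable_time)
qed

end

text \<open>Urysohn's lemma between a closed subset and an open superset of nearly the same measure.\<close>

lemma indicator_continuous_approximation:
  fixes A :: "real set"
  assumes A: "A \<in> sets lebesgue" "A \<subseteq> {0<..<T}" and "0 < \<epsilon>"
  shows "\<exists>h. continuous_on UNIV h \<and> (\<forall>t. t \<notin> {0<..<T} \<longrightarrow> h t = 0) \<and> (\<forall>t. 0 \<le> h t \<and> h t \<le> 1) \<and>
             (LINT t|time_measure T. (indicator A t - h t)\<^sup>2) \<le> (\<epsilon>::real)"
proof -
  obtain U where U: "open U" "A \<subseteq> U" "U - A \<in> lmeasurable" "emeasure lebesgue (U - A) < ennreal (\<epsilon>/2)"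
    using sets_lebesgue_outer_open[OF A(1), of "\<epsilon>/2"] \<open>0 < \<epsilon>\<close> by auto
  obtain K where K: "closed K" "K \<subseteq> A" "A - K \<in> lmeasurable" "emeasure lebesgue (A - K) < ennreal (\<epsilon>/2)"
    using sets_lebesgue_inner_closed[OF A(1), of "\<epsilon>/2"] \<open>0 < \<epsilon>\<close> by auto
  define V where "V = U \<inter> {0<..<T}"
  have V: "open V" "A \<subseteq> V" using U A by (auto simp: V_def)
  obtain h :: "real \<Rightarrow> real" where h: "continuous_on UNIV h" "\<And>x. h x \<in> closed_segment 1 0"
     "\<And>x. x \<in> K \<Longrightarrow> h x = 1" "\<And>x. x \<in> - V \<Longrightarrow> h x = 0"
    by (rule Urysohn_local[of UNIV K "- V" 1 0]) (use K V in auto)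
  have h01: "0 \<le> h t" "h t \<le> 1" for t using h(2)[of t] by (auto simp: closed_segment_eq_real_ivl)
  have "(LINT t|time_measure T. (indicator A t - h t)\<^sup>2)
      \<le> (LINT t|time_measure T. indicator (U - A) t + indicator (A - K) t)"
  proof (rule integral_mono)
    have [measurable]: "A \<in> sets lebesgue" by fact
    have hm: "h \<in> borel_measurable (time_measure T)"
      by (rule continuous_imp_measurable_on_sets_lebesgue) (use h(1) in \<open>auto intro: continuous_on_subset\<close>)
    have Am: "(indicator A :: real \<Rightarrow> real) \<in> borel_measurable (time_measure T)"
      by (intro measurable_restrict_space1 borel_measurable_indicator A)
    show "integrable (time_measure T) (\<lambda>t. (indicator A t - h t)\<^sup>2)"
    proof (rule finite_measure.integrable_const_bound[OF finite_time_measure, where B=1])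
      show "AE t in time_measure T. norm ((indicator A t - h t)\<^sup>2) \<le> 1"
      proof (intro AE_I2)
        fix t
        have "\<bar>indicator A t - h t\<bar> \<le> 1" using h01[of t] by (auto simp: indicator_def)
        then show "norm ((indicator A t - h t)\<^sup>2) \<le> 1" by (simp add: abs_square_le_1)
      qed
    qed (use hm Am in measurable)
    show "integrable (time_measure T) (\<lambda>t. indicator (U - A) t + indicator (A - K) t :: real)"
      using U K by (intro Bochner_Integration.integrable_add integrable_indicator_time)
    fix t assume t: "t \<in> space (time_measure T)"
    have "\<bar>indicator A t - h t\<bar> \<le> 1" using h01[of t] by (auto simp: indicator_def)
    then have "(indicator A t - h t)\<^sup>2 \<le> 1" by (simp add: abs_square_le_1)
    moreover have "indicator A t - h t = 0" if "t \<notin> U - A" "t \<notin> A - K"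
    proof (cases "t \<in> A")
      case True
      then show ?thesis using that h(3)[of t] by auto
    next
      case False
      then show ?thesis using that h(4)[of t] by (auto simp: V_def)
    qed
    ultimately show "(indicator A t - h t)\<^sup>2 \<le> indicator (U - A) t + indicator (A - K) t"
      by (auto simp: indicator_def)
  qed
  also have "\<dots> \<le> \<epsilon>"
  proof -
    have m: "(LINT t|time_measure T. indicator B t) \<le> \<epsilon>/2 \<and> integrable (time_measure T) (indicator B :: real \<Rightarrow> real)"
      if B: "B \<in> lmeasurable" "emeasure lebesgue B < ennreal (\<epsilon>/2)" for B
    proof
      show "integrable (time_measure T) (indicator B :: real \<Rightarrow> real)"
        by (rule integrable_indicator_time[OF B(1)])
      have "(LINT t|time_measure T. indicator B t) = (LINT t|lebesgue. indicator {0<..<T} t *\<^sub>R indicator B t :: real)"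
        by (rule integral_restrict_space) simp
      also have "\<dots> = (LINT t|lebesgue. indicator ({0<..<T} \<inter> B) t)"
        by (simp only: indicator_inter_arith real_scaleR_def)
      also have "\<dots> = measure lebesgue ({0<..<T} \<inter> B)" by simp
      also have "\<dots> \<le> measure lebesgue B" using B by (intro measure_mono_fmeasurable) auto
      also have "\<dots> \<le> \<epsilon>/2"
        using B(2) emeasure_eq_measure2[OF B(1)] \<open>0 < \<epsilon>\<close> by (simp add: ennreal_less_iff)
      finally show "(LINT t|time_measure T. indicator B t) \<le> \<epsilon>/2" .
    qed
    have mU: "(LINT t|time_measure T. indicator (U - A) t) \<le> \<epsilon>/2" "integrable (time_measure T) (indicator (U - A) :: real \<Rightarrow> real)"
      using m[OF U(3,4)] by auto
    have mK: "(LINT t|time_measure T. indicator (A - K) t) \<le> \<epsilon>/2" "integrable (time_measure T) (indicator (A - K) :: real \<Rightarrow> real)"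
      using m[OF K(3,4)] by auto
    show ?thesis unfolding Bochner_Integration.integral_add[OF mU(2) mK(2)] using mU(1) mK(1) by linarith
  qed
  finally show ?thesis using h h01 by (intro exI[of _ h]) (auto simp: V_def)
qed

text \<open>A continuous function \<open>h\<close> that vanishes off \<open>(0,T)\<close> becomes, after the substitution \<open>r = exp t\<close> and
  division by \<open>r\<close>, a continuous function of \<open>r \<in> [0, exp T]\<close>. Multiplying a polynomial approximation by \<open>r\<close>
  again leaves only exponents at least 1, and the factor \<open>r\<close> is the decay as \<open>t\<close> tends to \<open>-\<infinity>\<close>.\<close>

lemma indicator_exp_approximation:
  fixes A :: "real set"
  assumes A: "A \<in> sets lebesgue" "A \<subseteq> {0<..<T}" and "0 < \<epsilon>" "0 < T"
  shows "\<exists>a n. (\<forall>t\<le>0. \<bar>\<Sum>k\<le>n. a k * exp (real (Suc k) * t)\<bar> \<le> \<epsilon> * exp t) \<and>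
             (LINT t|time_measure T. (indicator A t - (\<Sum>k\<le>n. a k * exp (real (Suc k) * t)))\<^sup>2) \<le> (\<epsilon>::real)"
proof -
  obtain h where h: "continuous_on UNIV h" "\<And>t. t \<notin> {0<..<T} \<Longrightarrow> h t = 0" "\<And>t. 0 \<le> h t \<and> h t \<le> 1"
    "(LINT t|time_measure T. (indicator A t - h t)\<^sup>2) \<le> \<epsilon>/4"
    using indicator_continuous_approximation[OF A, of "\<epsilon>/4"] \<open>0 < \<epsilon>\<close> by auto
  define R where "R = exp T"
  define \<delta> where "\<delta> = min 1 (min \<epsilon> (\<epsilon> / (4 * R\<^sup>2 * T)))"
  have d: "0 < \<delta>" "\<delta> \<le> \<epsilon>" "\<delta> \<le> 1" "\<delta> * (4 * R\<^sup>2 * T) \<le> \<epsilon>"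
  proof -
    show "0 < \<delta>" "\<delta> \<le> \<epsilon>" "\<delta> \<le> 1" using assms by (auto simp: \<delta>_def R_def)
    have "\<delta> * (4 * R\<^sup>2 * T) \<le> \<epsilon> / (4 * R\<^sup>2 * T) * (4 * R\<^sup>2 * T)"
      using assms by (intro mult_right_mono) (auto simp: \<delta>_def R_def)
    also have "\<dots> = \<epsilon>" using assms by (simp add: R_def)
    finally show "\<delta> * (4 * R\<^sup>2 * T) \<le> \<epsilon>" .
  qed
  have "continuous_on {0..R} (\<lambda>r. h (ln (max 1 r)) / max 1 r)"
    by (intro continuous_intros continuous_on_compose2[OF h(1)]) auto
  then obtain g where g: "real_polynomial_function g" "\<And>r. r \<in> {0..R} \<Longrightarrow> \<bar>h (ln (max 1 r)) / max 1 r - g r\<bar> < \<delta>"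
    using Stone_Weierstrass_real_polynomial_function[of "{0..R}", OF _ _ d(1)] by auto
  then obtain a n where an: "g = (\<lambda>x. \<Sum>i\<le>n. a i * x^i)"
    using real_polynomial_function_iff_sum by blast
  define Q where "Q t = (\<Sum>k\<le>n. a k * exp (real (Suc k) * t))" for t
  have Qg: "Q t = exp t * g (exp t)" for t
    by (simp add: Q_def an sum_distrib_left exp_of_nat_mult[symmetric] exp_add algebra_simps)
  have near: "\<bar>h t - Q t\<bar> \<le> \<delta> * exp t" if "t \<le> T" for t
  proof -
    have e: "exp t * (h (ln (max 1 (exp t))) / max 1 (exp t)) = h t"
      using h(2)[of t] h(2)[of 0] by (cases "t \<le> 0") (auto simp: max_def)
    have "\<bar>h (ln (max 1 (exp t))) / max 1 (exp t) - g (exp t)\<bar> \<le> \<delta>"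
      using that by (intro less_imp_le g(2)) (auto simp: R_def)
    then have "exp t * \<bar>h (ln (max 1 (exp t))) / max 1 (exp t) - g (exp t)\<bar> \<le> exp t * \<delta>"
      by (intro mult_left_mono) auto
    also have "exp t * \<bar>h (ln (max 1 (exp t))) / max 1 (exp t) - g (exp t)\<bar>
        = \<bar>exp t * (h (ln (max 1 (exp t))) / max 1 (exp t)) - exp t * g (exp t)\<bar>"
      by (simp only: abs_mult right_diff_distrib[symmetric] abs_exp_cancel)
    finally show ?thesis unfolding e Qg by (simp add: mult.commute)
  qed
  have small: "\<bar>Q t\<bar> \<le> \<epsilon> * exp t" if "t \<le> 0" for t
  proof -
    have "\<bar>Q t\<bar> \<le> \<delta> * exp t" using near[of t] h(2)[of t] that \<open>0 < T\<close> by auto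
    also have "\<dots> \<le> \<epsilon> * exp t" using d by (intro mult_right_mono) auto
    finally show ?thesis .
  qed
  have Qc: "continuous_on X Q" for X unfolding Q_def by (intro continuous_intros)
  have Qm: "Q \<in> borel_measurable (time_measure T)"
    by (rule continuous_imp_measurable_on_sets_lebesgue) (use Qc in auto)
  have hm: "h \<in> borel_measurable (time_measure T)"
    by (rule continuous_imp_measurable_on_sets_lebesgue) (use h(1) in \<open>auto intro: continuous_on_subset\<close>)
  have Am: "(indicator A :: real \<Rightarrow> real) \<in> borel_measurable (time_measure T)"
    by (intro measurable_restrict_space1 borel_measurable_indicator A)
  have hA: "integrable (time_measure T) (\<lambda>t. (indicator A t - h t)\<^sup>2)"
  proof (rule finite_measure.integrable_const_bound[OF finite_time_measure, where B=1])
    show "AE t in time_measure T. norm ((indicator A t - h t)\<^sup>2) \<le> 1"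
    proof (intro AE_I2)
      fix t
      have "\<bar>indicator A t - h t\<bar> \<le> 1" using h(3)[of t] by (auto simp: indicator_def)
      then show "norm ((indicator A t - h t)\<^sup>2) \<le> 1" by (simp add: abs_square_le_1)
    qed
  qed (use hm Am in measurable)
  have le: "(indicator A t - Q t)\<^sup>2 \<le> 2 * (indicator A t - h t)\<^sup>2 + 2 * (\<delta> * R)\<^sup>2" if "t \<in> {0<..<T}" for t
  proof -
    have "\<bar>h t - Q t\<bar> \<le> \<delta> * R"
      using near[of t] that d(1) by (intro order_trans[OF near] mult_left_mono) (auto simp: R_def)
    then have "(h t - Q t)\<^sup>2 \<le> (\<delta> * R)\<^sup>2" using abs_le_square_iff[of "h t - Q t" "\<delta> * R"] by simp
    moreover have "(x + y)\<^sup>2 \<le> 2 * x\<^sup>2 + 2 * y\<^sup>2" for x y :: real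
      using sum_squares_bound[of x y] by (simp add: power2_sum)
    from this[of "indicator A t - h t" "h t - Q t"] have "(indicator A t - Q t)\<^sup>2 \<le> 2 * (indicator A t - h t)\<^sup>2 + 2 * (h t - Q t)\<^sup>2"
      by simp
    ultimately show ?thesis by linarith
  qed
  have rhs: "integrable (time_measure T) (\<lambda>t. 2 * (indicator A t - h t)\<^sup>2 + 2 * (\<delta> * R)\<^sup>2)"
    using hA finite_measure.integrable_const[OF finite_time_measure] by (intro Bochner_Integration.integrable_add) auto
  have "(LINT t|time_measure T. (indicator A t - Q t)\<^sup>2) \<le> (LINT t|time_measure T. 2 * (indicator A t - h t)\<^sup>2 + 2 * (\<delta> * R)\<^sup>2)"
  proof (rule integral_mono[OF _ rhs])
    show "integrable (time_measure T) (\<lambda>t. (indicator A t - Q t)\<^sup>2)"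
    proof (rule Bochner_Integration.integrable_bound[OF rhs])
      show "AE t in time_measure T. norm ((indicator A t - Q t)\<^sup>2) \<le> norm (2 * (indicator A t - h t)\<^sup>2 + 2 * (\<delta> * R)\<^sup>2)"
        using le by (intro AE_I2) simp
    qed (use Qm Am in measurable)
  qed (use le in simp)
  also have "\<dots> = 2 * (LINT t|time_measure T. (indicator A t - h t)\<^sup>2) + 2 * (\<delta> * R)\<^sup>2 * T"
  proof -
    have "measure (time_measure T) (space (time_measure T)) = T"
      using \<open>0 < T\<close> by (simp add: measure_restrict_space)
    then show ?thesis
      using hA finite_measure.integrable_const[OF finite_time_measure]
      by (subst Bochner_Integration.integral_add) (auto simp: mult.commute)
  qed
  also have "\<dots> \<le> \<epsilon>/2 + \<epsilon>/2"
  proof -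
    have "\<delta>\<^sup>2 \<le> \<delta>" using d by (simp add: power2_eq_square mult_left_le)
    from mult_right_mono[OF this, of "2 * R\<^sup>2 * T"]
    have "2 * (\<delta> * R)\<^sup>2 * T \<le> (\<delta> * (4 * R\<^sup>2 * T)) / 2"
      using \<open>0 < T\<close> by (simp add: power_mult_distrib algebra_simps)
    then show ?thesis using d(4) h(4) by linarith
  qed
  finally show ?thesis using small unfolding Q_def by (intro exI[of _ a] exI[of _ n]) simp
qed

context seminormed_space
begin

text \<open>The bound for \<open>t \<le> 0\<close> says that the sum also approximates the extension of \<open>f\<close> by 0 to negative times;
  it will make the energy at time 0 small.\<close>

definition exp_approximable :: "real \<Rightarrow> (real \<Rightarrow> 'i \<Rightarrow> real) \<Rightarrow> bool" where
  "exp_approximable T f \<longleftrightarrow> (\<forall>\<epsilon>>0. \<exists>L. exp_list X L \<and> (\<forall>t\<le>0. nrm (exp_sum L t) \<le> \<epsilon> * exp t) \<and>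
     (LINT t|time_measure T. (nrm (\<lambda>i. f t i - exp_sum L t i))\<^sup>2) \<le> \<epsilon>)"

lemma bochner_L2_sq_add_le:
  assumes M: "complete_measure M" and f: "f \<in> bochner_L2 M X nrm" and g: "g \<in> bochner_L2 M X nrm"
  shows "(LINT t|M. (nrm (\<lambda>i. f t i + g t i))\<^sup>2)
       \<le> 2 * (LINT t|M. (nrm (f t))\<^sup>2) + 2 * (LINT t|M. (nrm (g t))\<^sup>2)"
proof -
  have fi: "integrable M (\<lambda>t. (nrm (f t))\<^sup>2)" and gi: "integrable M (\<lambda>t. (nrm (g t))\<^sup>2)"
    and fgi: "integrable M (\<lambda>t. (nrm (\<lambda>i. f t i + g t i))\<^sup>2)"
    using f g bochner_L2_add[OF M f g] by (simp_all add: bochner_L2_iff)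
  have "(LINT t|M. (nrm (\<lambda>i. f t i + g t i))\<^sup>2) \<le> (LINT t|M. 2 * (nrm (f t))\<^sup>2 + 2 * (nrm (g t))\<^sup>2)"
  proof (rule integral_mono_AE)
    show "AE t in M. (nrm (\<lambda>i. f t i + g t i))\<^sup>2 \<le> 2 * (nrm (f t))\<^sup>2 + 2 * (nrm (g t))\<^sup>2"
      using bochner_L2_AE_mem[OF f] bochner_L2_AE_mem[OF g]
    proof eventually_elim
      fix t assume m: "f t \<in> X" "g t \<in> X"
      have "(nrm (\<lambda>i. f t i + g t i))\<^sup>2 \<le> (nrm (f t) + nrm (g t))\<^sup>2"
        by (intro power_mono nrm_add m nrm_nonneg add_mem)
      also have "\<dots> \<le> 2 * (nrm (f t))\<^sup>2 + 2 * (nrm (g t))\<^sup>2"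
        using sum_squares_bound[of "nrm (f t)" "nrm (g t)"] by (simp add: power2_sum)
      finally show "(nrm (\<lambda>i. f t i + g t i))\<^sup>2 \<le> 2 * (nrm (f t))\<^sup>2 + 2 * (nrm (g t))\<^sup>2" .
    qed
  qed (use fi gi fgi in simp_all)
  then show ?thesis using fi gi by simp
qed

lemma exp_approximable_limit:
  assumes T: "0 < T" and f: "f \<in> bochner_L2 (time_measure T) X nrm"
    and g: "\<And>\<epsilon>. 0 < \<epsilon> \<Longrightarrow> \<exists>g. g \<in> bochner_L2 (time_measure T) X nrm \<and> exp_approximable T g \<and>
              (LINT t|time_measure T. (nrm (\<lambda>i. f t i - g t i))\<^sup>2) \<le> \<epsilon>"
  shows "exp_approximable T f"
  unfolding exp_approximable_def
proof (intro allI impI)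
  fix \<epsilon> :: real assume e: "0 < \<epsilon>"
  then have e4: "0 < \<epsilon>/4" by simp
  obtain g where g: "g \<in> bochner_L2 (time_measure T) X nrm" "exp_approximable T g"
      "(LINT t|time_measure T. (nrm (\<lambda>i. f t i - g t i))\<^sup>2) \<le> \<epsilon>/4"
    using g[OF e4] by blast
  obtain L where L: "exp_list X L" "\<And>t. t \<le> 0 \<Longrightarrow> nrm (exp_sum L t) \<le> \<epsilon>/4 * exp t"
     "(LINT t|time_measure T. (nrm (\<lambda>i. g t i - exp_sum L t i))\<^sup>2) \<le> \<epsilon>/4"
    using g(2)[unfolded exp_approximable_def, rule_format, OF e4] by blast
  have "nrm (exp_sum L t) \<le> \<epsilon> * exp t" if "t \<le> 0" for t
    using order_trans[OF L(2)[OF that] mult_right_mono[of "\<epsilon>/4" \<epsilon> "exp t"]] e by simp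
  moreover have "(LINT t|time_measure T. (nrm (\<lambda>i. f t i - exp_sum L t i))\<^sup>2) \<le> \<epsilon>"
    using bochner_L2_sq_add_le[OF complete_time_measure bochner_L2_diff[OF complete_time_measure f g(1)]
        bochner_L2_diff[OF complete_time_measure g(1) exp_sum_bochner_L2[OF L(1) T]]] g(3) L(3) by simp
  ultimately show "\<exists>L. exp_list X L \<and> (\<forall>t\<le>0. nrm (exp_sum L t) \<le> \<epsilon> * exp t) \<and>
     (LINT t|time_measure T. (nrm (\<lambda>i. f t i - exp_sum L t i))\<^sup>2) \<le> \<epsilon>" using L(1) by blast
qed

lemma exp_approximable_add:
  assumes T: "0 < T" and f: "f \<in> bochner_L2 (time_measure T) X nrm" "exp_approximable T f"
    and g: "g \<in> bochner_L2 (time_measure T) X nrm" "exp_approximable T g"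
  shows "exp_approximable T (\<lambda>t i. f t i + g t i)"
  unfolding exp_approximable_def
proof (intro allI impI)
  fix \<epsilon> :: real assume e: "0 < \<epsilon>"
  then have e4: "0 < \<epsilon>/4" by simp
  obtain L where L: "exp_list X L" "\<And>t. t \<le> 0 \<Longrightarrow> nrm (exp_sum L t) \<le> \<epsilon>/4 * exp t"
     "(LINT t|time_measure T. (nrm (\<lambda>i. f t i - exp_sum L t i))\<^sup>2) \<le> \<epsilon>/4"
    using f(2)[unfolded exp_approximable_def, rule_format, OF e4] by blast
  obtain K where K: "exp_list X K" "\<And>t. t \<le> 0 \<Longrightarrow> nrm (exp_sum K t) \<le> \<epsilon>/4 * exp t"
     "(LINT t|time_measure T. (nrm (\<lambda>i. g t i - exp_sum K t i))\<^sup>2) \<le> \<epsilon>/4"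
    using g(2)[unfolded exp_approximable_def, rule_format, OF e4] by blast
  have "nrm (exp_sum (L @ K) t) \<le> \<epsilon> * exp t" if "t \<le> 0" for t
  proof -
    have "nrm (exp_sum (L @ K) t) \<le> nrm (exp_sum L t) + nrm (exp_sum K t)"
      unfolding exp_sum_append by (intro nrm_add exp_sum_mem L K)
    also have "\<dots> \<le> \<epsilon>/4 * exp t + \<epsilon>/4 * exp t" using L(2) K(2) that by (intro add_mono)
    also have "\<dots> \<le> \<epsilon> * exp t" using e by simp
    finally show ?thesis .
  qed
  moreover have "(LINT t|time_measure T. (nrm (\<lambda>i. (f t i + g t i) - exp_sum (L @ K) t i))\<^sup>2) \<le> \<epsilon>"
  proof -
    have "(\<lambda>i. (f t i + g t i) - exp_sum (L @ K) t i) = (\<lambda>i. (f t i - exp_sum L t i) + (g t i - exp_sum K t i))" for t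
      by (simp add: exp_sum_append algebra_simps)
    then show ?thesis
      using bochner_L2_sq_add_le[OF complete_time_measure
        bochner_L2_diff[OF complete_time_measure f(1) exp_sum_bochner_L2[OF L(1) T]]
        bochner_L2_diff[OF complete_time_measure g(1) exp_sum_bochner_L2[OF K(1) T]]] K(3) L(3) by simp
  qed
  ultimately show "\<exists>L. exp_list X L \<and> (\<forall>t\<le>0. nrm (exp_sum L t) \<le> \<epsilon> * exp t) \<and>
     (LINT t|time_measure T. (nrm (\<lambda>i. (f t i + g t i) - exp_sum L t i))\<^sup>2) \<le> \<epsilon>"
    using L(1) K(1) by (intro exI[of _ "L @ K"]) simp
qed

lemma indicator_bochner_L2:
  assumes A: "A \<in> sets (time_measure T)" and x: "x \<in> X"
  shows "(\<lambda>t i. indicator A t * x i) \<in> bochner_L2 (time_measure T) X nrm"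
proof -
  have s: "simple_function (time_measure T) (\<lambda>t i. indicator A t * x i)"
    by (rule simple_function_compose1[OF simple_function_indicator[OF A], where g="\<lambda>c i. c * x i"])
  have m: "(\<lambda>i. indicator A t * x i) \<in> X" for t by (rule scale_mem[OF x])
  have bm: "bochner_measurable (time_measure T) X nrm (\<lambda>t i. indicator A t * x i)"
    unfolding bochner_measurable_def
  proof (intro exI[of _ "\<lambda>_ t i. indicator A t * x i"] conjI allI AE_I2)
    show "(\<lambda>t i. indicator A t * x i) ` space (time_measure T) \<subseteq> X" using m by blast
  qed (simp_all add: s m nrm_zero)
  have "integrable (time_measure T) (\<lambda>t. (nrm (\<lambda>i. indicator A t * x i))\<^sup>2)"
  proof (rule finite_measure.integrable_const_bound[OF finite_time_measure, where B="(nrm x)\<^sup>2"])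
    show "(\<lambda>t. (nrm (\<lambda>i. indicator A t * x i))\<^sup>2) \<in> borel_measurable (time_measure T)"
      by (intro borel_measurable_power nrm_comp_measurable[OF complete_time_measure bm])
  qed (simp add: indicator_def nrm_zero)
  then show ?thesis using bm by (simp add: bochner_L2_iff)
qed

lemma indicator_exp_approximable:
  assumes A: "A \<in> sets (time_measure T)" and x: "x \<in> X" and T: "0 < T"
  shows "exp_approximable T (\<lambda>t i. indicator A t * x i)"
  unfolding exp_approximable_def
proof (intro allI impI)
  fix \<epsilon> :: real assume e: "0 < \<epsilon>"
  have A': "A \<in> sets lebesgue" "A \<subseteq> {0<..<T}" using A by (auto simp: sets_restrict_space_iff)
  define N where "N = nrm x + 1"
  have N: "N \<ge> 1" "nrm x \<le> N" using nrm_nonneg[OF x] by (auto simp: N_def)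
  define \<eta> where "\<eta> = \<epsilon> / N\<^sup>2"
  have et: "0 < \<eta>" "\<eta> * N\<^sup>2 = \<epsilon>" "\<eta> * N \<le> \<epsilon>"
  proof -
    show "0 < \<eta>" "\<eta> * N\<^sup>2 = \<epsilon>" using e N by (auto simp: \<eta>_def)
    then show "\<eta> * N \<le> \<epsilon>" using N mult_left_mono[of N "N\<^sup>2" \<eta>] by (simp add: power2_eq_square)
  qed
  obtain a n where an: "\<And>t. t \<le> 0 \<Longrightarrow> \<bar>\<Sum>k\<le>n. a k * exp (real (Suc k) * t)\<bar> \<le> \<eta> * exp t"
    "(LINT t|time_measure T. (indicator A t - (\<Sum>k\<le>n. a k * exp (real (Suc k) * t)))\<^sup>2) \<le> \<eta>"
    using indicator_exp_approximation[OF A' et(1) T] by blast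
  define Q where "Q t = (\<Sum>k\<le>n. a k * exp (real (Suc k) * t))" for t
  define L where "L = map (\<lambda>k. (real (Suc k), \<lambda>i. a k * x i)) [0..<Suc n]"
  have L: "exp_list X L" unfolding L_def exp_list_def by (auto simp: scale_mem x)
  have LQ: "exp_sum L t = (\<lambda>i. Q t * x i)" for t
  proof
    fix i
    have "exp_sum L t i = sum_list (map (\<lambda>k. exp (real (Suc k) * t) * (a k * x i)) [0..<Suc n])"
      unfolding exp_sum_def L_def map_map by (intro arg_cong[where f=sum_list] map_cong refl) simp
    also have "\<dots> = (\<Sum>k\<le>n. exp (real (Suc k) * t) * (a k * x i))"
      by (simp only: interv_sum_list_conv_sum_set_nat set_upt atLeast0LessThan lessThan_Suc_atMost)
    also have "\<dots> = Q t * x i"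
      unfolding Q_def sum_distrib_right by (rule sum.cong) (simp_all only: mult_ac)
    finally show "exp_sum L t i = Q t * x i" .
  qed
  have "nrm (exp_sum L t) \<le> \<epsilon> * exp t" if "t \<le> 0" for t
  proof -
    have "nrm (exp_sum L t) \<le> \<bar>Q t\<bar> * nrm x" unfolding LQ by (rule nrm_scale_le[OF x])
    also have "\<dots> \<le> (\<eta> * exp t) * N"
      using an(1)[OF that] N nrm_nonneg[OF x] et(1) unfolding Q_def by (intro mult_mono) auto
    also have "\<dots> = (\<eta> * N) * exp t" by simp
    also have "\<dots> \<le> \<epsilon> * exp t" using et(3) by (intro mult_right_mono) auto
    finally show ?thesis .
  qed
  moreover have "(LINT t|time_measure T. (nrm (\<lambda>i. indicator A t * x i - exp_sum L t i))\<^sup>2) \<le> \<epsilon>"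
  proof -
    have "continuous_on {0..T} Q" unfolding Q_def by (intro continuous_intros)
    then have Qm: "Q \<in> borel_measurable (time_measure T)" "integrable (time_measure T) (\<lambda>t. (Q t)\<^sup>2)"
      using continuous_integrable_time[of T Q] continuous_integrable_time[of T "\<lambda>t. (Q t)\<^sup>2"]
      by (auto intro: continuous_on_power)
    have Am: "(indicator A :: real \<Rightarrow> real) \<in> borel_measurable (time_measure T)" using A by simp
    have int: "integrable (time_measure T) (\<lambda>t. (indicator A t - Q t)\<^sup>2)"
    proof (rule Bochner_Integration.integrable_bound)
      show "integrable (time_measure T) (\<lambda>t. 2 + 2 * (Q t)\<^sup>2)"
        using Qm finite_measure.integrable_const[OF finite_time_measure] by (intro Bochner_Integration.integrable_add) auto
      show "AE t in time_measure T. norm ((indicator A t - Q t)\<^sup>2) \<le> norm (2 + 2 * (Q t)\<^sup>2)"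
      proof (intro AE_I2)
        fix t
        have "(1 - Q t)\<^sup>2 \<le> 2 + 2 * (Q t)\<^sup>2" using sum_squares_bound[of 1 "- Q t"] by (simp add: power2_diff)
        then show "norm ((indicator A t - Q t)\<^sup>2) \<le> norm (2 + 2 * (Q t)\<^sup>2)" by (simp add: indicator_def)
      qed
    qed (use Qm Am in measurable)
    have i1: "integrable (time_measure T) (\<lambda>t. (nrm (\<lambda>i. indicator A t * x i - exp_sum L t i))\<^sup>2)"
      using bochner_L2_diff[OF complete_time_measure indicator_bochner_L2[OF A x] exp_sum_bochner_L2[OF L T]]
      by (simp add: bochner_L2_iff)
    have "(LINT t|time_measure T. (nrm (\<lambda>i. indicator A t * x i - exp_sum L t i))\<^sup>2)
        \<le> (LINT t|time_measure T. (indicator A t - Q t)\<^sup>2 * N\<^sup>2)"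
    proof (rule integral_mono[OF i1])
      fix t
      have "(\<lambda>i. indicator A t * x i - exp_sum L t i) = (\<lambda>i. (indicator A t - Q t) * x i)"
        by (simp add: LQ algebra_simps)
      moreover have "(nrm (\<lambda>i. (indicator A t - Q t) * x i))\<^sup>2 \<le> (\<bar>indicator A t - Q t\<bar> * nrm x)\<^sup>2"
        by (intro power_mono nrm_scale_le x nrm_nonneg scale_mem)
      moreover have "(\<bar>indicator A t - Q t\<bar> * nrm x)\<^sup>2 \<le> (\<bar>indicator A t - Q t\<bar> * N)\<^sup>2"
        by (intro power_mono mult_left_mono N mult_nonneg_nonneg nrm_nonneg x) auto
      ultimately show "(nrm (\<lambda>i. indicator A t * x i - exp_sum L t i))\<^sup>2 \<le> (indicator A t - Q t)\<^sup>2 * N\<^sup>2"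
        by (simp add: power_mult_distrib)
    qed (use int in simp)
    also have "\<dots> = (LINT t|time_measure T. (indicator A t - Q t)\<^sup>2) * N\<^sup>2" by simp
    also have "\<dots> \<le> \<eta> * N\<^sup>2" using an(2) unfolding Q_def by (intro mult_right_mono) auto
    finally show ?thesis using et by simp
  qed
  ultimately show "\<exists>L. exp_list X L \<and> (\<forall>t\<le>0. nrm (exp_sum L t) \<le> \<epsilon> * exp t) \<and>
     (LINT t|time_measure T. (nrm (\<lambda>i. indicator A t * x i - exp_sum L t i))\<^sup>2) \<le> \<epsilon>"
    using L by blast
qed

lemma zero_exp_approximable: "exp_approximable T (\<lambda>t i. 0)"
  unfolding exp_approximable_def by (intro allI impI exI[of _ "[]"]) (simp add: exp_sum_Nil nrm_zero)

text \<open>Simple functions are finite sums of indicators times vectors, and each summand is covered by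
  the scalar case.\<close>

theorem exp_sums_dense:
  assumes T: "0 < T" and f: "f \<in> bochner_L2 (time_measure T) X nrm"
  shows "exp_approximable T f"
proof (rule exp_approximable_limit[OF T f])
  fix \<epsilon> :: real assume e: "0 < \<epsilon>"
  obtain S where S: "simple_function (time_measure T) S" "S ` space (time_measure T) \<subseteq> X"
      "S \<in> bochner_L2 (time_measure T) X nrm" "(LINT t|time_measure T. (nrm (\<lambda>i. f t i - S t i))\<^sup>2) < \<epsilon>"
    using bochner_L2_simple_approximation[OF complete_time_measure f e] by blast
  define A where "A x = S -` {x} \<inter> space (time_measure T)" for x
  have A: "A x \<in> sets (time_measure T)" if "x \<in> S ` space (time_measure T)" for x
    unfolding A_def using simple_functionD(2)[OF S(1), of "{x}"] .
  define R where "R F t i = (\<Sum>x\<in>F. indicator (A x) t * x i)" for F t i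
  have R: "R F \<in> bochner_L2 (time_measure T) X nrm \<and> exp_approximable T (R F)"
    if "finite F" "F \<subseteq> S ` space (time_measure T)" for F
    using that
  proof (induction F rule: finite_induct)
    case empty
    have e: "R {} = (\<lambda>t i. 0)" unfolding R_def[abs_def] by (simp only: sum.empty)
    have "(\<lambda>t i. indicator {} t * 0) \<in> bochner_L2 (time_measure T) X nrm"
      by (rule indicator_bochner_L2[OF sets.empty_sets zero_mem])
    then show ?case unfolding e by (simp only: mult_zero_right zero_exp_approximable conj_absorb simp_thms)
  next
    case (insert y F)
    have ys: "y \<in> S ` space (time_measure T)" by (rule subsetD[OF insert.prems insertI1])
    note y = A[OF ys] subsetD[OF S(2) ys]
    have e: "R (insert y F) = (\<lambda>t i. indicator (A y) t * y i + R F t i)"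
      unfolding R_def[abs_def] by (intro ext) (rule sum.insert[OF insert.hyps])
    have "F \<subseteq> S ` space (time_measure T)" by (rule subset_trans[OF subset_insertI insert.prems])
    note IH = insert.IH[OF this, THEN conjunct1] insert.IH[OF this, THEN conjunct2]
    have "(\<lambda>t i. indicator (A y) t * y i + R F t i) \<in> bochner_L2 (time_measure T) X nrm"
      by (rule bochner_L2_add[OF complete_time_measure indicator_bochner_L2[OF y] IH(1)])
    moreover have "exp_approximable T (\<lambda>t i. indicator (A y) t * y i + R F t i)"
      by (rule exp_approximable_add[OF T indicator_bochner_L2[OF y] indicator_exp_approximable[OF y T] IH])
    ultimately show ?case by (simp only: e simp_thms)
  qed
  define F where "F = S ` space (time_measure T)"
  have F: "finite F" using S(1) by (simp add: F_def simple_function_def)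
  have RS: "R F t = S t" if t: "t \<in> space (time_measure T)" for t
  proof
    fix i
    have "R F t i = (\<Sum>x\<in>{S t}. indicator (A x) t * x i)"
      unfolding R_def
    proof (rule sum.mono_neutral_right[OF F])
      show "{S t} \<subseteq> F" unfolding F_def using t by blast
      show "\<forall>x\<in>F - {S t}. indicator (A x) t * x i = 0"
      proof
        fix x assume "x \<in> F - {S t}"
        then have "t \<notin> A x" unfolding A_def by blast
        then show "indicator (A x) t * x i = 0" by (simp only: indicator_simps mult_zero_left not_False_eq_True)
      qed
    qed
    moreover have "t \<in> A (S t)" unfolding A_def using t by blast
    ultimately show "R F t i = S t i" by simp
  qed
  have "(LINT t|time_measure T. (nrm (\<lambda>i. f t i - R F t i))\<^sup>2) = (LINT t|time_measure T. (nrm (\<lambda>i. f t i - S t i))\<^sup>2)"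
    by (intro Bochner_Integration.integral_cong refl) (simp only: RS)
  then show "\<exists>g. g \<in> bochner_L2 (time_measure T) X nrm \<and> exp_approximable T g \<and>
              (LINT t|time_measure T. (nrm (\<lambda>i. f t i - g t i))\<^sup>2) \<le> \<epsilon>"
    using R[OF F eq_refl[OF F_def]] less_imp_le[OF S(4)] by (intro exI[of _ "R F"]) simp
qed

end

section \<open>Spaces of square integrable functions\<close>

lemma L2_spaceD:
  assumes "f \<in> L2_space M"
  shows "f \<in> borel_measurable M" "integrable M (\<lambda>x. (f x)\<^sup>2)"
  using assms by (simp_all add: L2_space_def)

lemma L2_space_mult_integrable:
  assumes f: "f \<in> L2_space M" and g: "g \<in> L2_space M"
  shows "integrable M (\<lambda>x. f x * g x)"
proof (rule Bochner_Integration.integrable_bound)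
  show "integrable M (\<lambda>x. (f x)\<^sup>2 + (g x)\<^sup>2)"
    by (intro Bochner_Integration.integrable_add L2_spaceD f g)
  show "(\<lambda>x. f x * g x) \<in> borel_measurable M"
    by (intro borel_measurable_times L2_spaceD f g)
  have *: "\<bar>a * b\<bar> \<le> a\<^sup>2 + b\<^sup>2" for a b :: real
  proof -
    have "2 * \<bar>a\<bar> * \<bar>b\<bar> \<le> \<bar>a\<bar>\<^sup>2 + \<bar>b\<bar>\<^sup>2" by (rule sum_squares_bound)
    then have "2 * \<bar>a * b\<bar> \<le> a\<^sup>2 + b\<^sup>2" by (simp add: abs_mult)
    then show ?thesis by linarith
  qed
  show "AE x in M. norm (f x * g x) \<le> norm ((f x)\<^sup>2 + (g x)\<^sup>2)"
    unfolding real_norm_def by (intro AE_I2 order_trans[OF * abs_ge_self])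
qed

lemma L2_space_lin:
  assumes f: "f \<in> L2_space M" and g: "g \<in> L2_space M"
  shows "(\<lambda>x. a * f x + b * g x) \<in> L2_space M"
proof -
  have "integrable M (\<lambda>x. a\<^sup>2 * (f x)\<^sup>2 + (2 * a * b) * (f x * g x) + b\<^sup>2 * (g x)\<^sup>2)"
    by (intro Bochner_Integration.integrable_add integrable_mult_right L2_spaceD
        L2_space_mult_integrable f g)
  also have "(\<lambda>x. a\<^sup>2 * (f x)\<^sup>2 + (2 * a * b) * (f x * g x) + b\<^sup>2 * (g x)\<^sup>2) = (\<lambda>x. (a * f x + b * g x)\<^sup>2)"
    by (simp add: power2_eq_square algebra_simps)
  finally show ?thesis
    using L2_spaceD(1)[OF f] L2_spaceD(1)[OF g] by (simp add: L2_space_def)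
qed

lemma L2_space_semi_inner: "semi_inner_space (L2_space M) (\<lambda>f g. LINT x|M. f x * g x)"
proof
  show "(\<lambda>i. 0) \<in> L2_space M" by (simp add: L2_space_def)
next
  fix v w y :: "'a \<Rightarrow> real" and a b :: real
  assume m: "v \<in> L2_space M" "w \<in> L2_space M" "y \<in> L2_space M"
  have "(\<lambda>x. (a * v x + b * w x) * y x) = (\<lambda>x. a * (v x * y x) + b * (w x * y x))"
    by (simp add: algebra_simps)
  then show "(LINT x|M. (a * v x + b * w x) * y x) = a * (LINT x|M. v x * y x) + b * (LINT x|M. w x * y x)"
    using L2_space_mult_integrable[OF m(1,3)] L2_space_mult_integrable[OF m(2,3)] by simp
qed (simp_all add: L2_space_lin mult.commute)

lemma L2_norm_eq: "L2_norm M f = sqrt (LINT x|M. f x * f x)"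
  by (simp add: L2_norm_def power2_eq_square)

interpretation L2: semi_inner_space "L2_space M" "\<lambda>f g. LINT x|M. f x * g x"
  rewrites "\<And>f. sqrt (LINT x|M. f x * f x) = L2_norm M f" for M
  by (rule L2_space_semi_inner) (simp add: L2_norm_eq)

lemma L2_norm_sq: "(L2_norm M f)\<^sup>2 = (LINT x|M. (f x)\<^sup>2)"
  by (simp add: L2_norm_def)

lemma L2_norm_nonneg: "0 \<le> L2_norm M f"
  by (simp add: L2_norm_def)

text \<open>Closed balls of \<open>L\<^sup>2\<close> are closed under almost everywhere convergence.\<close>

lemma L2_space_Fatou:
  assumes f: "\<And>n::nat. f n \<in> L2_space M" "\<And>n. n0 \<le> n \<Longrightarrow> L2_norm M (f n) \<le> B"
    and l: "l \<in> borel_measurable M" and lim: "AE x in M. (\<lambda>n. f n x) \<longlonglongrightarrow> l x" and B: "0 \<le> B"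
  shows "l \<in> L2_space M" "L2_norm M l \<le> B"
proof -
  note [measurable] = l L2_spaceD(1)[OF f(1)]
  have le: "(\<integral>\<^sup>+x. ennreal ((l x)\<^sup>2) \<partial>M) \<le> ennreal (B\<^sup>2)"
  proof -
    have "(\<integral>\<^sup>+x. ennreal ((l x)\<^sup>2) \<partial>M) = (\<integral>\<^sup>+x. liminf (\<lambda>n. ennreal ((f n x)\<^sup>2)) \<partial>M)"
    proof (rule nn_integral_cong_AE)
      show "AE x in M. ennreal ((l x)\<^sup>2) = liminf (\<lambda>n. ennreal ((f n x)\<^sup>2))"
        using lim
      proof eventually_elim
        fix x assume "(\<lambda>n. f n x) \<longlonglongrightarrow> l x"
        then have "(\<lambda>n. ennreal ((f n x)\<^sup>2)) \<longlonglongrightarrow> ennreal ((l x)\<^sup>2)"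
          by (intro tendsto_ennrealI tendsto_power)
        then show "ennreal ((l x)\<^sup>2) = liminf (\<lambda>n. ennreal ((f n x)\<^sup>2))"
          by (rule lim_imp_Liminf[OF sequentially_bot, symmetric])
      qed
    qed
    also have "\<dots> \<le> liminf (\<lambda>n. \<integral>\<^sup>+x. ennreal ((f n x)\<^sup>2) \<partial>M)"
      by (rule nn_integral_liminf) measurable
    also have "\<dots> \<le> liminf (\<lambda>n. ennreal (B\<^sup>2))"
    proof (rule Liminf_mono, unfold eventually_sequentially, intro exI[of _ n0] allI impI)
      fix n assume n: "n0 \<le> n"
      have "(\<integral>\<^sup>+x. ennreal ((f n x)\<^sup>2) \<partial>M) = ennreal (LINT x|M. (f n x)\<^sup>2)"
        by (rule nn_integral_eq_integral[OF L2_spaceD(2)[OF f(1)]]) simp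
      also have "\<dots> \<le> ennreal (B\<^sup>2)"
        unfolding L2_norm_sq[symmetric] by (intro ennreal_leI power_mono f(2) n L2_norm_nonneg)
      finally show "(\<integral>\<^sup>+x. ennreal ((f n x)\<^sup>2) \<partial>M) \<le> ennreal (B\<^sup>2)" .
    qed
    also have "\<dots> = ennreal (B\<^sup>2)" by (rule Liminf_const[OF sequentially_bot])
    finally show ?thesis .
  qed
  have int: "integrable M (\<lambda>x. (l x)\<^sup>2)"
  proof (rule integrableI_bounded)
    show "(\<integral>\<^sup>+x. ennreal (norm ((l x)\<^sup>2)) \<partial>M) < \<infinity>"
      using le_less_trans[OF le ennreal_less_top] by simp
  qed measurable
  then show "l \<in> L2_space M" using l by (simp add: L2_space_def)
  have "ennreal (LINT x|M. (l x)\<^sup>2) \<le> ennreal (B\<^sup>2)"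
    using le by (subst nn_integral_eq_integral[OF int, symmetric]) simp_all
  then have "(LINT x|M. (l x)\<^sup>2) \<le> B\<^sup>2" by (subst (asm) ennreal_le_iff) simp_all
  then show "L2_norm M l \<le> B" unfolding L2_norm_def using B by (intro real_le_lsqrt) simp_all
qed

text \<open>By monotone convergence the sum has a finite integral, so it is finite almost everywhere.\<close>

lemma AE_summable_of_integrals:
  fixes g :: "nat \<Rightarrow> 'a \<Rightarrow> real"
  assumes g: "\<And>n. integrable M (g n)" "\<And>n x. 0 \<le> g n x" "\<And>n. (LINT x|M. g n x) \<le> c n" and c: "summable c"
  shows "AE x in M. summable (\<lambda>n. g n x)"
proof -
  note [measurable] = borel_measurable_integrable[OF g(1)]
  have "(\<integral>\<^sup>+x. (\<Sum>n. ennreal (g n x)) \<partial>M) = (\<Sum>n. \<integral>\<^sup>+x. ennreal (g n x) \<partial>M)"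
    by (rule nn_integral_suminf) measurable
  also have "\<dots> = (\<Sum>n. ennreal (LINT x|M. g n x))"
    by (intro suminf_cong nn_integral_eq_integral g(1)) (simp add: g(2))
  also have "\<dots> \<noteq> top"
  proof (rule ennreal_suminf_neq_top)
    show "summable (\<lambda>n. LINT x|M. g n x)"
      by (rule summable_comparison_test'[OF c, of 0]) (simp add: g(3) g(2) integral_nonneg)
  qed (simp add: g(2) integral_nonneg)
  finally have "(\<integral>\<^sup>+x. (\<Sum>n. ennreal (g n x)) \<partial>M) \<noteq> top" .
  moreover have "(\<lambda>x. \<Sum>n. ennreal (g n x)) \<in> borel_measurable M" by measurable
  ultimately have "AE x in M. (\<Sum>n. ennreal (g n x)) \<noteq> top"
    using nn_integral_PInf_AE[of "\<lambda>x. \<Sum>n. ennreal (g n x)" M] by simp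
  then show ?thesis
    by eventually_elim (rule summable_suminf_not_top[OF g(2)])
qed

text \<open>Riesz--Fischer. Splitting \<open>\<bar>d\<^sub>n\<bar> \<le> d\<^sub>n\<^sup>2 / c\<^sub>n + c\<^sub>n\<close> with summable \<open>c\<^sub>n\<close> slightly above the norm of
  \<open>d\<^sub>n\<close> reduces pointwise summability to integrable functions.\<close>

lemma L2_space_summable:
  assumes d: "\<And>n::nat. d n \<in> L2_space M" and s: "summable (\<lambda>n. L2_norm M (d n))"
  shows "AE x in M. summable (\<lambda>n. \<bar>d n x\<bar>)"
    and "(\<lambda>x. \<Sum>n. d n x) \<in> L2_space M"
    and "(\<lambda>n. L2_norm M (\<lambda>x. (\<Sum>k. d k x) - (\<Sum>j<n. d j x))) \<longlonglongrightarrow> 0"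
proof -
  define c where "c n = L2_norm M (d n) + (1/2)^n" for n
  have c: "0 < c n" "L2_norm M (d n) \<le> c n" for n
    using L2_norm_nonneg[of M "d n"] by (simp_all add: c_def add_nonneg_pos)
  have cs: "summable c" unfolding c_def[abs_def] by (intro summable_add s summable_geometric) simp
  have "AE x in M. summable (\<lambda>n. (d n x)\<^sup>2 / c n)"
  proof (rule AE_summable_of_integrals[OF _ _ _ cs])
    show "integrable M (\<lambda>x. (d n x)\<^sup>2 / c n)" for n
      by (intro integrable_divide L2_spaceD d)
    show "0 \<le> (d n x)\<^sup>2 / c n" for n x using c(1)[of n] by simp
    show "(LINT x|M. (d n x)\<^sup>2 / c n) \<le> c n" for n
    proof -
      have "(LINT x|M. (d n x)\<^sup>2 / c n) = (L2_norm M (d n))\<^sup>2 / c n" by (simp add: L2_norm_sq)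
      also have "\<dots> \<le> (c n)\<^sup>2 / c n"
        using c[of n] by (intro divide_right_mono power_mono L2_norm_nonneg) simp_all
      finally show ?thesis using c(1)[of n] by (simp add: power2_eq_square)
    qed
  qed
  then show AEs: "AE x in M. summable (\<lambda>n. \<bar>d n x\<bar>)"
  proof eventually_elim
    fix x assume sx: "summable (\<lambda>n. (d n x)\<^sup>2 / c n)"
    show "summable (\<lambda>n. \<bar>d n x\<bar>)"
    proof (rule summable_comparison_test'[OF summable_add[OF sx cs], of 0])
      fix n
      have "\<bar>d n x\<bar> \<le> (d n x)\<^sup>2 / c n + c n"
      proof (cases "\<bar>d n x\<bar> \<le> c n")
        case True
        moreover have "0 \<le> (d n x)\<^sup>2 / c n" using c(1)[of n] by simp
        ultimately show ?thesis by linarith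
      next
        case False
        then have "\<bar>d n x\<bar> * c n \<le> \<bar>d n x\<bar> * \<bar>d n x\<bar>" by (intro mult_left_mono) simp_all
        then have "\<bar>d n x\<bar> \<le> (d n x)\<^sup>2 / c n" using c(1)[of n] by (simp add: pos_le_divide_eq power2_eq_square)
        then show ?thesis using c(1)[of n] by linarith
      qed
      then show "norm \<bar>d n x\<bar> \<le> (d n x)\<^sup>2 / c n + c n" by simp
    qed
  qed
  have Sm: "(\<lambda>x. \<Sum>j<n. d j x) \<in> L2_space M" for n by (rule L2.sum_mem) (rule d)
  have dm: "d n \<in> borel_measurable M" for n by (rule L2_spaceD(1)[OF d])
  have Dm: "(\<lambda>x. \<Sum>n. d n x) \<in> borel_measurable M" by (rule borel_measurable_suminf[OF dm])
  define \<tau> where "\<tau> n = (\<Sum>k. L2_norm M (d k)) - (\<Sum>k<n. L2_norm M (d k))" for n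
  have \<tau>0: "\<tau> \<longlonglongrightarrow> 0"
    unfolding \<tau>_def[abs_def] 
    using tendsto_diff[OF tendsto_const[of "\<Sum>k. L2_norm M (d k)"] summable_LIMSEQ[OF s]] by simp
  have \<tau>nn: "0 \<le> \<tau> n" for n
    unfolding \<tau>_def using sum_le_suminf[OF s finite_lessThan[of n] L2_norm_nonneg] by simp
  have tail: "(\<lambda>x. (\<Sum>k. d k x) - (\<Sum>j<n. d j x)) \<in> L2_space M \<and>
        L2_norm M (\<lambda>x. (\<Sum>k. d k x) - (\<Sum>j<n. d j x)) \<le> \<tau> n" for n
  proof -
    have mem: "(\<lambda>x. (\<Sum>j<m. d j x) - (\<Sum>j<n. d j x)) \<in> L2_space M" for m
      by (rule L2.diff_mem[OF Sm Sm])
    have bd: "L2_norm M (\<lambda>x. (\<Sum>j<m. d j x) - (\<Sum>j<n. d j x)) \<le> \<tau> n" if "n \<le> m" for m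
    proof -
      have split: "(\<Sum>j<m. (f j :: real)) = (\<Sum>j<n. f j) + (\<Sum>j\<in>{n..<m}. f j)" for f
        using sum.atLeastLessThan_concat[of 0 n m f] that by (simp add: atLeast0LessThan)
      have "(\<lambda>x. (\<Sum>j<m. d j x) - (\<Sum>j<n. d j x)) = (\<lambda>x. \<Sum>j\<in>{n..<m}. d j x)"
        unfolding split[of "\<lambda>j. d j x" for x] by simp
      then have "L2_norm M (\<lambda>x. (\<Sum>j<m. d j x) - (\<Sum>j<n. d j x)) \<le> (\<Sum>j\<in>{n..<m}. L2_norm M (d j))"
        using L2.nrm_sum[of "{n..<m}" d M] d by simp
      also have "\<dots> = (\<Sum>j<m. L2_norm M (d j)) - (\<Sum>j<n. L2_norm M (d j))"
        using split[of "\<lambda>j. L2_norm M (d j)"] by simp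
      also have "\<dots> \<le> \<tau> n"
        unfolding \<tau>_def using sum_le_suminf[OF s finite_lessThan[of m] L2_norm_nonneg] by simp
      finally show ?thesis .
    qed
    have meas: "(\<lambda>x. (\<Sum>k. d k x) - (\<Sum>j<n. d j x)) \<in> borel_measurable M"
      by (intro borel_measurable_diff Dm L2_spaceD(1)[OF Sm])
    have lim: "AE x in M. (\<lambda>m. (\<Sum>j<m. d j x) - (\<Sum>j<n. d j x)) \<longlonglongrightarrow> (\<Sum>k. d k x) - (\<Sum>j<n. d j x)"
      using AEs
    proof eventually_elim
      fix x assume "summable (\<lambda>n. \<bar>d n x\<bar>)"
      then have "summable (\<lambda>n. d n x)" by (rule summable_rabs_cancel)
      then show "(\<lambda>m. (\<Sum>j<m. d j x) - (\<Sum>j<n. d j x)) \<longlonglongrightarrow> (\<Sum>k. d k x) - (\<Sum>j<n. d j x)"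
        by (intro tendsto_diff summable_LIMSEQ tendsto_const)
    qed
    show ?thesis
      using L2_space_Fatou[of "\<lambda>m x. (\<Sum>j<m. d j x) - (\<Sum>j<n. d j x)", OF mem bd meas lim \<tau>nn] by blast
  qed
  show "(\<lambda>x. \<Sum>n. d n x) \<in> L2_space M" using conjunct1[OF tail[of 0]] by simp
  show "(\<lambda>n. L2_norm M (\<lambda>x. (\<Sum>k. d k x) - (\<Sum>j<n. d j x))) \<longlonglongrightarrow> 0"
    by (rule tendsto_sandwich[OF _ _ tendsto_const \<tau>0])
       (intro always_eventually allI L2_norm_nonneg conjunct2[OF tail])+
qed

lemma L2_space_complete: "abs_complete (L2_space M) (L2_norm M)"
  unfolding abs_complete_def
proof (intro allI impI, elim conjE)
  fix d :: "nat \<Rightarrow> 'a \<Rightarrow> real"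
  assume "\<forall>n. d n \<in> L2_space M" and s: "summable (\<lambda>n. L2_norm M (d n))"
  then have d: "\<And>n. d n \<in> L2_space M" by blast
  show "\<exists>u\<in>L2_space M. (\<lambda>n. L2_norm M (\<lambda>i. u i - (\<Sum>j<n. d j i))) \<longlonglongrightarrow> 0"
    by (rule bexI[of _ "\<lambda>x. \<Sum>n. d n x"]) (rule L2_space_summable[OF d s])+
qed

section \<open>Smooth bumps and functions with integrable weak derivative\<close>

text \<open>The factors \<open>p\<close> and \<open>n\<close> are there to make the family closed under differentiation, which shows at once
  that its members are smooth.\<close>

definition bump :: "real poly \<Rightarrow> real poly \<Rightarrow> nat \<Rightarrow> real \<Rightarrow> real" where
  "bump q p n t = (if 0 < poly q t then poly p t * (inverse (poly q t) ^ n * exp (- inverse (poly q t))) else 0)"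

lemma flat_at_zero: "isCont (\<lambda>y::real. if 0 < y then inverse y ^ m * exp (- inverse y) else 0) 0"
proof -
  have "((\<lambda>y::real. inverse y ^ m / exp (inverse y)) \<longlongrightarrow> 0) (at_right 0)"
    by (rule filterlim_compose[OF tendsto_power_div_exp_0 filterlim_inverse_at_top_right])
  then have "((\<lambda>y::real. if 0 < y then inverse y ^ m * exp (- inverse y) else 0) \<longlongrightarrow> 0) (at_right 0)"
    by (rule Lim_transform_eventually) (simp add: eventually_at_right_less exp_minus divide_inverse eventually_at_filter)
  moreover have "((\<lambda>y::real. if 0 < y then inverse y ^ m * exp (- inverse y) else 0) \<longlongrightarrow> 0) (at_left 0)"
    by (rule Lim_transform_eventually[OF tendsto_const]) (simp add: eventually_at_filter)
  ultimately show ?thesis by (simp add: isCont_def filterlim_split_at)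
qed

text \<open>At a zero \<open>t\<close> of \<open>q\<close> write \<open>q s = (s - t) * r s\<close>: the difference quotient there is \<open>p r\<close> times a power of
  \<open>1 / q\<close> times \<open>exp (- 1 / q)\<close>, and this tends to 0.\<close>

lemma bump_deriv:
  "(bump q p n has_real_derivative
      bump q (pderiv p * q\<^sup>2 - of_nat n * p * pderiv q * q + p * pderiv q) (n + 2) t) (at t)"
proof -
  consider (pos) "0 < poly q t" | (neg) "poly q t < 0" | (zero) "poly q t = 0" by linarith
  then show ?thesis
  proof cases
    case pos
    define y where "y = poly q t"
    define z where "z = inverse y"
    define E where "E = exp (- z)"
    have y: "0 < y" using pos by (simp add: y_def)
    have zy: "z * y = 1" using y by (simp add: z_def)
    have iz: "((\<lambda>t. inverse (poly q t)) has_real_derivative - (poly (pderiv q) t * z\<^sup>2)) (at t)"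
      using DERIV_inverse_fun[OF poly_DERIV[of q t]] y
      by (simp add: power2_eq_square mult_ac z_def y_def)
    have "((\<lambda>t. poly p t * (inverse (poly q t) ^ n * exp (- inverse (poly q t)))) has_real_derivative
        poly (pderiv p) t * (z ^ n * E) +
        (of_nat n * (z ^ (n - Suc 0) * - (poly (pderiv q) t * z\<^sup>2)) * E +
          E * (poly (pderiv q) t * z\<^sup>2) * z ^ n) * poly p t) (at t)"
      using DERIV_mult[OF poly_DERIV[of p t] DERIV_mult[OF DERIV_power[OF iz, of n] DERIV_fun_exp[OF DERIV_minus[OF iz]]]]
      by (rule DERIV_cong) (simp add: y_def[symmetric] z_def[symmetric] E_def[symmetric] mult_ac)
    then have "((\<lambda>t. poly p t * (inverse (poly q t) ^ n * exp (- inverse (poly q t)))) has_real_derivative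
        bump q (pderiv p * q\<^sup>2 - of_nat n * p * pderiv q * q + p * pderiv q) (n + 2) t) (at t)"
    proof (rule DERIV_cong)
      have zn: "of_nat n * (z ^ (n - Suc 0) * (w * z\<^sup>2)) = of_nat n * z ^ n * z * w" for w
        by (cases n) (simp_all add: power2_eq_square)
      have b: "bump q (pderiv p * q\<^sup>2 - of_nat n * p * pderiv q * q + p * pderiv q) (n + 2) t =
         (poly (pderiv p) t * (z * y)\<^sup>2 - of_nat n * poly p t * poly (pderiv q) t * (z * y) * z
            + poly p t * poly (pderiv q) t * z\<^sup>2) * (z ^ n * E)"
        using pos by (simp add: bump_def y_def[symmetric] z_def[symmetric] E_def[symmetric] power_add
            power2_eq_square algebra_simps)
      have zp: "of_nat n * (z ^ (n - Suc 0) * - (poly (pderiv q) t * z\<^sup>2)) = - (of_nat n * z ^ n * z * poly (pderiv q) t)"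
        using zn[of "poly (pderiv q) t"] by simp
      show "poly (pderiv p) t * (z ^ n * E) +
        (of_nat n * (z ^ (n - Suc 0) * - (poly (pderiv q) t * z\<^sup>2)) * E +
          E * (poly (pderiv q) t * z\<^sup>2) * z ^ n) * poly p t =
        bump q (pderiv p * q\<^sup>2 - of_nat n * p * pderiv q * q + p * pderiv q) (n + 2) t"
        unfolding b zy zp by (simp add: algebra_simps power2_eq_square)
    qed
    moreover have "open {s. 0 < poly q s}" by (intro open_Collect_less continuous_intros)
    ultimately show ?thesis
      by (rule has_field_derivative_transform_within_open) (use pos in \<open>simp_all add: bump_def\<close>)
  next
    case neg
    have "open {s. poly q s < 0}" by (intro open_Collect_less continuous_intros)
    from has_field_derivative_transform_within_open[OF DERIV_const[of 0] this, of t "bump q p n"] neg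
    show ?thesis by (simp add: bump_def)
  next
    case zero
    then obtain r where r: "q = [:- t, 1:] * r" unfolding poly_eq_0_iff_dvd by (elim dvdE)
    have qs: "poly q s = (s - t) * poly r s" for s unfolding r by (simp add: algebra_simps)
    define G where "G y = (if 0 < y then inverse y ^ (n+1) * exp (- inverse y) else 0)" for y :: real
    have G: "isCont G 0" unfolding G_def[abs_def] by (rule flat_at_zero)
    have qt: "((\<lambda>s. poly q s) \<longlongrightarrow> 0) (at t)" using poly_isCont[where p=q and x=t] zero by (simp add: isCont_def)
    have "((\<lambda>s. G (poly q s)) \<longlongrightarrow> G 0) (at t)" by (rule isCont_tendsto_compose[OF G qt])
    from tendsto_mult[OF tendsto_mult[OF poly_isCont[where p=p and x=t, unfolded isCont_def] poly_isCont[where p=r and x=t, unfolded isCont_def]] this]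
    have "((\<lambda>s. poly p s * poly r s * G (poly q s)) \<longlongrightarrow> 0) (at t)" by (simp add: G_def)
    moreover have "\<forall>\<^sub>F s in at t. poly p s * poly r s * G (poly q s) = (bump q p n s - bump q p n t) / (s - t)"
      unfolding eventually_at_filter
    proof (rule always_eventually, intro allI impI)
      fix s assume st: "s \<noteq> t"
      show "poly p s * poly r s * G (poly q s) = (bump q p n s - bump q p n t) / (s - t)"
      proof (cases "0 < poly q s")
        case True
        then have rz: "poly r s \<noteq> 0" unfolding qs by (intro notI) simp
        define z where "z = inverse (poly q s)"
        have rq: "poly r s * z = inverse (s - t)" unfolding z_def qs using st rz by (simp add: field_simps)
        have "poly p s * poly r s * G (poly q s) = poly p s * (z ^ n * exp (- z)) * (poly r s * z)"
          using True by (simp add: G_def z_def[symmetric])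
        also have "\<dots> = (bump q p n s - bump q p n t) / (s - t)"
          unfolding rq using True zero by (simp add: bump_def z_def[symmetric] divide_inverse)
        finally show ?thesis .
      next
        case False
        then show ?thesis using zero by (simp add: bump_def G_def)
      qed
    qed
    ultimately have "((\<lambda>s. (bump q p n s - bump q p n t) / (s - t)) \<longlongrightarrow> 0) (at t)"
      by (rule Lim_transform_eventually)
    then show ?thesis using zero by (simp add: has_field_derivative_iff bump_def)
  qed
qed

lemma bump_difference_derivs:
  "\<exists>p' n' u' m'. (deriv ^^ k) (\<lambda>t. a * bump q p n t - b * bump r u m t)
      = (\<lambda>t. a * bump q p' n' t - b * bump r u' m' t)"
proof (induction k arbitrary: p n u m)
  case 0
  show ?case by (intro exI[of _ p] exI[of _ n] exI[of _ u] exI[of _ m]) simp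
next
  case (Suc k)
  let ?p = "pderiv p * q\<^sup>2 - of_nat n * p * pderiv q * q + p * pderiv q"
  let ?u = "pderiv u * r\<^sup>2 - of_nat m * u * pderiv r * r + u * pderiv r"
  have "deriv (\<lambda>t. a * bump q p n t - b * bump r u m t) = (\<lambda>t. a * bump q ?p (n+2) t - b * bump r ?u (m+2) t)"
    by (intro ext DERIV_imp_deriv DERIV_diff DERIV_cmult bump_deriv)
  then have "(deriv ^^ Suc k) (\<lambda>t. a * bump q p n t - b * bump r u m t) =
     (deriv ^^ k) (\<lambda>t. a * bump q ?p (n+2) t - b * bump r ?u (m+2) t)"
    by (simp only: funpow_Suc_right o_apply)
  then show ?case using Suc[of ?p "n+2" ?u "m+2"] by simp
qed

text \<open>The normalised primitive of the bump for \<open>q t = \<epsilon>\<^sup>2 - (t - \<tau>)\<^sup>2\<close>.\<close>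

lemma smooth_step:
  assumes "0 < \<epsilon>" "\<epsilon> < \<tau>"
  shows "\<exists>c q \<Phi>. (\<forall>t. (\<Phi> has_real_derivative c * bump q 1 0 t) (at t)) \<and> (\<forall>t. 0 \<le> c * bump q 1 0 t) \<and>
     (\<forall>t. \<epsilon> \<le> \<bar>t - \<tau>\<bar> \<longrightarrow> c * bump q 1 0 t = 0) \<and> (\<forall>t\<le>\<tau> - \<epsilon>. \<Phi> t = 0) \<and> (\<forall>t\<ge>\<tau> + \<epsilon>. \<Phi> t = (1::real))"
proof -
  define q where "q = [:\<epsilon>\<^sup>2 - \<tau>\<^sup>2, 2 * \<tau>, -1:]"
  have q: "poly q t = \<epsilon>\<^sup>2 - (t - \<tau>)\<^sup>2" for t by (simp add: q_def power2_eq_square algebra_simps)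
  define \<beta> where "\<beta> = bump q 1 0"
  have \<beta>nn: "0 \<le> \<beta> t" for t by (simp add: \<beta>_def bump_def)
  have \<beta>0: "\<beta> t = 0" if "\<epsilon> \<le> \<bar>t - \<tau>\<bar>" for t
  proof -
    have "\<epsilon>\<^sup>2 \<le> (t - \<tau>)\<^sup>2" using power_mono[OF that, of 2] assms by simp
    then show ?thesis by (simp add: \<beta>_def bump_def q)
  qed
  have \<beta>c: "continuous_on A \<beta>" for A
    unfolding \<beta>_def by (intro continuous_at_imp_continuous_on ballI DERIV_isCont[OF bump_deriv])
  have \<beta>i: "\<beta> integrable_on {a..b}" for a b by (intro integrable_continuous_real \<beta>c)
  define \<Psi> where "\<Psi> t = integral {0..t} \<beta>" for t
  define I where "I = \<Psi> (\<tau> + \<epsilon>)"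
  have \<Psi>0: "\<Psi> t = 0" if "t \<le> \<tau> - \<epsilon>" for t
  proof -
    have "integral {0..t} \<beta> = integral {0..t} (\<lambda>x. 0)"
      by (intro integral_cong \<beta>0) (use that in auto)
    then show ?thesis by (simp add: \<Psi>_def)
  qed
  have \<Psi>1: "\<Psi> t = I" if "\<tau> + \<epsilon> \<le> t" for t
  proof -
    have "integral {\<tau> + \<epsilon>..t} \<beta> = integral {\<tau> + \<epsilon>..t} (\<lambda>x. 0)"
      by (intro integral_cong \<beta>0) (use that in auto)
    moreover have "integral {0..\<tau> + \<epsilon>} \<beta> + integral {\<tau> + \<epsilon>..t} \<beta> = integral {0..t} \<beta>"
      by (rule Henstock_Kurzweil_Integration.integral_combine[OF _ that \<beta>i]) (use assms in simp)
    ultimately show ?thesis by (simp add: \<Psi>_def I_def)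
  qed
  have \<Psi>d: "(\<Psi> has_real_derivative \<beta> t) (at t)" for t
  proof (cases "t < \<tau> - \<epsilon>")
    case True
    have "(\<Psi> has_real_derivative 0) (at t)"
      by (rule has_field_derivative_transform_within_open[OF DERIV_const[of 0] open_lessThan[of "\<tau> - \<epsilon>"]])
         (use True \<Psi>0 in simp_all)
    then show ?thesis using \<beta>0[of t] True by simp
  next
    case False
    then have t: "0 < t" "t < t + 1" using assms by simp_all
    have "(\<Psi> has_real_derivative \<beta> t) (at t within {0..t+1})"
      unfolding \<Psi>_def[abs_def] by (rule integral_has_real_derivative[OF \<beta>c]) (use t in simp)
    moreover have "at t within {0..t+1} = at t"
      by (rule at_within_interior) (use t in \<open>simp add: interior_atLeastAtMost_real\<close>)
    ultimately show ?thesis by simp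
  qed
  have I: "0 < I"
  proof (rule ccontr)
    assume "\<not> 0 < I"
    moreover have "0 \<le> I" unfolding I_def \<Psi>_def by (intro integral_nonneg \<beta>i \<beta>nn)
    ultimately have "I = 0" by simp
    then have "(\<beta> has_integral 0) {0..\<tau> + \<epsilon>}"
      using integrable_integral[OF \<beta>i[of 0 "\<tau> + \<epsilon>"]] by (simp add: I_def \<Psi>_def)
    then have "\<beta> \<tau> = 0"
      using has_integral_0_cbox_imp_0[of 0 "\<tau> + \<epsilon>" \<beta> \<tau>] \<beta>c \<beta>nn assms by simp
    then show False using assms by (simp add: \<beta>_def bump_def q)
  qed
  show ?thesis
  proof (intro exI[of _ "inverse I"] exI[of _ q] exI[of _ "\<lambda>t. inverse I * \<Psi> t"] conjI allI impI)
    show "((\<lambda>t. inverse I * \<Psi> t) has_real_derivative inverse I * bump q 1 0 t) (at t)" for t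
      using DERIV_cmult[OF \<Psi>d[of t], of "inverse I"] by (simp add: \<beta>_def)
    show "0 \<le> inverse I * bump q 1 0 t" for t using \<beta>nn[of t] I by (simp add: \<beta>_def)
    show "inverse I * bump q 1 0 t = 0" if "\<epsilon> \<le> \<bar>t - \<tau>\<bar>" for t using \<beta>0[OF that] by (simp add: \<beta>_def)
    show "inverse I * \<Psi> t = 0" if "t \<le> \<tau> - \<epsilon>" for t using \<Psi>0[OF that] by simp
    show "inverse I * \<Psi> t = 1" if "\<tau> + \<epsilon> \<le> t" for t using \<Psi>1[OF that] I by simp
  qed
qed

lemma steps_test_function:
  assumes "0 < \<epsilon>" "\<epsilon> < \<tau>1" "\<tau>1 < \<tau>2" "\<tau>2 + \<epsilon> < T"
    and D1: "\<And>t. (\<Phi>1 has_real_derivative a * bump q 1 0 t) (at t)"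
    and D2: "\<And>t. (\<Phi>2 has_real_derivative b * bump r 1 0 t) (at t)"
    and z1: "\<And>t. t \<le> \<tau>1 - \<epsilon> \<Longrightarrow> \<Phi>1 t = 0" and o1: "\<And>t. \<tau>1 + \<epsilon> \<le> t \<Longrightarrow> \<Phi>1 t = 1"
    and z2: "\<And>t. t \<le> \<tau>2 - \<epsilon> \<Longrightarrow> \<Phi>2 t = 0" and o2: "\<And>t. \<tau>2 + \<epsilon> \<le> t \<Longrightarrow> \<Phi>2 t = 1"
  shows "test_function T (\<lambda>t. \<Phi>1 t - \<Phi>2 t)"
    and "deriv (\<lambda>t. \<Phi>1 t - \<Phi>2 t) = (\<lambda>t. a * bump q 1 0 t - b * bump r 1 0 t)"
proof -
  let ?\<phi> = "\<lambda>t. \<Phi>1 t - \<Phi>2 t"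
  have D: "(?\<phi> has_real_derivative a * bump q 1 0 t - b * bump r 1 0 t) (at t)" for t
    by (rule DERIV_diff[OF D1 D2])
  then show dphi: "deriv ?\<phi> = (\<lambda>t. a * bump q 1 0 t - b * bump r 1 0 t)"
    by (intro ext DERIV_imp_deriv)
  have "(deriv ^^ k) ?\<phi> differentiable_on UNIV" for k
  proof (cases k)
    case 0
    then show ?thesis
      unfolding differentiable_on_def real_differentiable_def using D by (simp, blast)
  next
    case (Suc j)
    obtain p' n' u' m' where e: "(deriv ^^ j) (\<lambda>t. a * bump q 1 0 t - b * bump r 1 0 t)
      = (\<lambda>t. a * bump q p' n' t - b * bump r u' m' t)"
      using bump_difference_derivs by blast
    have "(deriv ^^ k) ?\<phi> = (\<lambda>t. a * bump q p' n' t - b * bump r u' m' t)"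
      unfolding Suc funpow_Suc_right o_apply dphi e ..
    moreover have "\<exists>D. ((\<lambda>t. a * bump q p' n' t - b * bump r u' m' t) has_real_derivative D) (at t)" for t
      by (rule exI) (rule DERIV_diff[OF DERIV_cmult[OF bump_deriv] DERIV_cmult[OF bump_deriv]])
    ultimately show ?thesis by (simp add: differentiable_on_def real_differentiable_def)
  qed
  moreover have "closure {t. ?\<phi> t \<noteq> 0} \<subseteq> {0<..<T}"
  proof -
    have "{t. ?\<phi> t \<noteq> 0} \<subseteq> {\<tau>1 - \<epsilon>..\<tau>2 + \<epsilon>}"
    proof
      fix t assume "t \<in> {t. ?\<phi> t \<noteq> 0}"
      then have n: "\<Phi>1 t \<noteq> \<Phi>2 t" by simp
      have "\<not> t \<le> \<tau>1 - \<epsilon>" using n z1[of t] z2[of t] assms(3) by auto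
      moreover have "\<not> \<tau>2 + \<epsilon> \<le> t" using n o1[of t] o2[of t] assms(3) by auto
      ultimately show "t \<in> {\<tau>1 - \<epsilon>..\<tau>2 + \<epsilon>}" by simp
    qed
    then have "closure {t. ?\<phi> t \<noteq> 0} \<subseteq> {\<tau>1 - \<epsilon>..\<tau>2 + \<epsilon>}" by (rule closure_minimal) simp
    then show ?thesis using assms(1-4) by (elim order_trans) auto
  qed
  ultimately show "test_function T ?\<phi>" by (simp add: test_function_def)
qed

lemma LINT_time_eq_integral:
  assumes "continuous_on {0..T} (f :: real \<Rightarrow> real)"
  shows "(LINT t|time_measure T. f t) = integral {0..T} f"
  using lebesgue_integral_eq_integral[OF continuous_integrable_time[OF assms]]
  by (simp add: integral_open_interval_real)

text \<open>Test with the difference of two smooth steps, an approximation of the indicator of \<open>(\<tau>1, \<tau>2)\<close>: its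
  derivative is a difference of approximate identities at \<open>\<tau>1\<close> and \<open>\<tau>2\<close>.\<close>

lemma weak_derivative_increment:
  assumes F: "continuous_on {0..T} (F :: real \<Rightarrow> real)" and g: "integrable (time_measure T) g"
    and weak: "\<And>\<phi>. test_function T \<phi> \<Longrightarrow>
       (LINT t|time_measure T. deriv \<phi> t * F t) = - (LINT t|time_measure T. \<phi> t * g t)"
    and \<tau>: "0 < \<tau>1" "\<tau>1 < \<tau>2" "\<tau>2 < T"
  shows "F \<tau>2 - F \<tau>1 = (LINT t|time_measure T. indicator {\<tau>1<..<\<tau>2} t * g t)"
proof -
  define \<delta> where "\<delta> = min \<tau>1 (T - \<tau>2)"
  have \<delta>: "0 < \<delta>" "\<delta> \<le> \<tau>1" "\<delta> \<le> T - \<tau>2" using \<tau> by (simp_all add: \<delta>_def)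
  define \<epsilon> where "\<epsilon> n = \<delta> / real (n + 2)" for n
  have \<epsilon>: "0 < \<epsilon> n" "\<epsilon> n < \<delta>" for n using \<delta>(1) by (simp_all add: \<epsilon>_def pos_divide_less_eq)
  have \<epsilon>0: "\<epsilon> \<longlonglongrightarrow> 0"
  proof -
    have "(\<lambda>n. \<delta> * inverse (real (n + 2))) \<longlonglongrightarrow> \<delta> * 0"
      by (intro tendsto_mult tendsto_const LIMSEQ_ignore_initial_segment[OF lim_inverse_n])
    then show ?thesis by (simp add: \<epsilon>_def[abs_def] divide_inverse)
  qed
  have step: "\<forall>n. \<exists>c q \<Phi>. (\<forall>t. (\<Phi> has_real_derivative c * bump q 1 0 t) (at t)) \<and> (\<forall>t. 0 \<le> c * bump q 1 0 t) \<and>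
     (\<forall>t. \<epsilon> n \<le> \<bar>t - \<tau>\<bar> \<longrightarrow> c * bump q 1 0 t = 0) \<and> (\<forall>t\<le>\<tau> - \<epsilon> n. \<Phi> t = 0) \<and> (\<forall>t\<ge>\<tau> + \<epsilon> n. \<Phi> t = (1::real))"
    if "\<delta> \<le> \<tau>" for \<tau>
    using smooth_step[OF \<epsilon>(1) less_le_trans[OF \<epsilon>(2) that]] by blast
  obtain a q \<Phi>1 where P1: "\<And>n t. (\<Phi>1 n has_real_derivative a n * bump (q n) 1 0 t) (at t)"
     "\<And>n t. 0 \<le> a n * bump (q n) 1 0 t" "\<And>n t. \<epsilon> n \<le> \<bar>t - \<tau>1\<bar> \<Longrightarrow> a n * bump (q n) 1 0 t = 0"
     "\<And>n t. t \<le> \<tau>1 - \<epsilon> n \<Longrightarrow> \<Phi>1 n t = 0" "\<And>n t. \<tau>1 + \<epsilon> n \<le> t \<Longrightarrow> \<Phi>1 n t = 1"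
    using step[OF \<delta>(2)] by metis
  have "\<delta> \<le> \<tau>2" using \<delta> \<tau> by simp
  obtain b r \<Phi>2 where P2: "\<And>n t. (\<Phi>2 n has_real_derivative b n * bump (r n) 1 0 t) (at t)"
     "\<And>n t. 0 \<le> b n * bump (r n) 1 0 t" "\<And>n t. \<epsilon> n \<le> \<bar>t - \<tau>2\<bar> \<Longrightarrow> b n * bump (r n) 1 0 t = 0"
     "\<And>n t. t \<le> \<tau>2 - \<epsilon> n \<Longrightarrow> \<Phi>2 n t = 0" "\<And>n t. \<tau>2 + \<epsilon> n \<le> t \<Longrightarrow> \<Phi>2 n t = 1"
    using step[OF \<open>\<delta> \<le> \<tau>2\<close>] by metis
  have T: "\<epsilon> n < \<tau>1" "\<tau>2 + \<epsilon> n < T" for n using \<epsilon>(2)[of n] \<delta> by simp_all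
  have tf: "test_function T (\<lambda>t. \<Phi>1 n t - \<Phi>2 n t)"
    "deriv (\<lambda>t. \<Phi>1 n t - \<Phi>2 n t) = (\<lambda>t. a n * bump (q n) 1 0 t - b n * bump (r n) 1 0 t)" for n
    by (rule steps_test_function[of "\<epsilon> n" \<tau>1 \<tau>2 T "\<Phi>1 n" "a n" "q n" "\<Phi>2 n" "b n" "r n",
          OF \<epsilon>(1) T(1) \<tau>(2) T(2) P1(1) P2(1) P1(4) P1(5) P2(4) P2(5)], assumption+)+
  have cont: "continuous_on S (\<lambda>t. c * bump q 1 0 t)" for S c q
    by (intro continuous_on_mult continuous_on_const continuous_at_imp_continuous_on ballI DERIV_isCont[OF bump_deriv])
  have mono: "0 \<le> \<Phi> t \<and> \<Phi> t \<le> 1"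
    if D: "\<And>t. (\<Phi> has_real_derivative \<eta> t) (at t)" and nn: "\<And>t. 0 \<le> \<eta> t"
      and z: "\<And>t. t \<le> x \<Longrightarrow> \<Phi> t = 0" and o: "\<And>t. y \<le> t \<Longrightarrow> \<Phi> t = (1::real)" for \<Phi> \<eta> x y t
  proof -
    have m: "\<Phi> s \<le> \<Phi> s'" if "s \<le> s'" for s s'
      using DERIV_nonneg_imp_nondecreasing[OF that, of \<Phi>] D nn by blast
    show ?thesis using m[of "min t x" t] z[of "min t x"] m[of t "max t y"] o[of "max t y"] by simp
  qed
  have R: "(\<lambda>n. LINT t|time_measure T. (\<Phi>1 n t - \<Phi>2 n t) * g t)
      \<longlonglongrightarrow> (LINT t|time_measure T. indicator {\<tau>1<..<\<tau>2} t * g t)"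
  proof (rule integral_dominated_convergence[where w="\<lambda>t. \<bar>g t\<bar>"])
    have gm: "g \<in> borel_measurable (time_measure T)" using g by (rule borel_measurable_integrable)
    have "(\<lambda>t. \<Phi>1 n t - \<Phi>2 n t) \<in> borel_measurable (time_measure T)" for n
      by (intro continuous_imp_measurable_on_sets_lebesgue continuous_at_imp_continuous_on ballI
          DERIV_isCont[OF DERIV_diff[OF P1(1) P2(1)]]) simp
    then show "(\<lambda>t. (\<Phi>1 n t - \<Phi>2 n t) * g t) \<in> borel_measurable (time_measure T)" for n
      using gm by (rule borel_measurable_times)
    have "(indicator {\<tau>1<..<\<tau>2} :: real \<Rightarrow> real) \<in> borel_measurable (time_measure T)"
      by (intro measurable_restrict_space1 borel_measurable_indicator) simp
    then show "(\<lambda>t. indicator {\<tau>1<..<\<tau>2} t * g t) \<in> borel_measurable (time_measure T)"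
      using gm by (rule borel_measurable_times)
    show "integrable (time_measure T) (\<lambda>t. \<bar>g t\<bar>)" using g by simp
    show "AE t in time_measure T. norm ((\<Phi>1 n t - \<Phi>2 n t) * g t) \<le> \<bar>g t\<bar>" for n
    proof (intro AE_I2)
      fix t
      have "0 \<le> \<Phi>1 n t \<and> \<Phi>1 n t \<le> 1" by (rule mono[OF P1(1,2,4,5)])
      moreover have "0 \<le> \<Phi>2 n t \<and> \<Phi>2 n t \<le> 1" by (rule mono[OF P2(1,2,4,5)])
      ultimately have "\<bar>\<Phi>1 n t - \<Phi>2 n t\<bar> \<le> 1" by linarith
      then have "\<bar>\<Phi>1 n t - \<Phi>2 n t\<bar> * \<bar>g t\<bar> \<le> 1 * \<bar>g t\<bar>" by (intro mult_right_mono) simp_all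
      then show "norm ((\<Phi>1 n t - \<Phi>2 n t) * g t) \<le> \<bar>g t\<bar>" by (simp add: abs_mult)
    qed
    have "AE t in lebesgue. t \<notin> {\<tau>1, \<tau>2}" by (intro AE_not_in) simp
    then have "AE t in time_measure T. t \<notin> {\<tau>1, \<tau>2}"
      by (subst AE_restrict_space_iff) (auto elim: AE_mp)
    then show "AE t in time_measure T. (\<lambda>n. (\<Phi>1 n t - \<Phi>2 n t) * g t) \<longlonglongrightarrow> indicator {\<tau>1<..<\<tau>2} t * g t"
    proof eventually_elim
      fix t assume t: "t \<notin> {\<tau>1, \<tau>2}"
      have ev: "\<forall>\<^sub>F n in sequentially. \<epsilon> n < \<bar>t - \<tau>\<bar>" if "t \<noteq> \<tau>" for \<tau>
        using order_tendstoD(2)[OF \<epsilon>0] that by simp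
      have ev1: "\<forall>\<^sub>F n in sequentially. \<epsilon> n < \<bar>t - \<tau>1\<bar>" and ev2: "\<forall>\<^sub>F n in sequentially. \<epsilon> n < \<bar>t - \<tau>2\<bar>"
        using t by (intro ev, simp)+
      have "\<forall>\<^sub>F n in sequentially. indicator {\<tau>1<..<\<tau>2} t * g t = (\<Phi>1 n t - \<Phi>2 n t) * g t"
        using ev1 ev2
      proof eventually_elim
        fix n assume n: "\<epsilon> n < \<bar>t - \<tau>1\<bar>" "\<epsilon> n < \<bar>t - \<tau>2\<bar>"
        consider "t < \<tau>1" | "\<tau>1 < t" "t < \<tau>2" | "\<tau>2 < t" using t by force
        then have "indicator {\<tau>1<..<\<tau>2} t = \<Phi>1 n t - \<Phi>2 n t"
        proof cases
          case 1
          then show ?thesis using P1(4)[of t n] P2(4)[of t n] n \<tau> by simp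
        next
          case 2
          then show ?thesis using P1(5)[of n t] P2(4)[of t n] n \<tau> by simp
        next
          case 3
          then show ?thesis using P1(5)[of n t] P2(5)[of n t] n \<tau> by simp
        qed
        then show "indicator {\<tau>1<..<\<tau>2} t * g t = (\<Phi>1 n t - \<Phi>2 n t) * g t" by simp
      qed
      then show "(\<lambda>n. (\<Phi>1 n t - \<Phi>2 n t) * g t) \<longlonglongrightarrow> indicator {\<tau>1<..<\<tau>2} t * g t"
        by (rule Lim_transform_eventually[OF tendsto_const])
    qed
  qed
  have L: "(\<lambda>n. LINT t|time_measure T. \<eta> n t * F t) \<longlonglongrightarrow> F \<tau>"
    if \<tau>T: "\<delta> \<le> \<tau>" "\<tau> + \<delta> \<le> T" and D: "\<And>n t. (\<Phi> n has_real_derivative \<eta> n t) (at t)" and nn: "\<And>n t. 0 \<le> \<eta> n t"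
      and z: "\<And>n t. \<epsilon> n \<le> \<bar>t - \<tau>\<bar> \<Longrightarrow> \<eta> n t = 0" and c: "\<And>n. continuous_on {0..T} (\<eta> n)"
      and z0: "\<And>n t. t \<le> \<tau> - \<epsilon> n \<Longrightarrow> \<Phi> n t = 0" and o: "\<And>n t. \<tau> + \<epsilon> n \<le> t \<Longrightarrow> \<Phi> n t = (1::real)"
    for \<Phi> \<eta> \<tau>
  proof (rule LIMSEQ_I)
    fix e :: real assume e: "0 < e"
    have "\<tau> \<in> {0..T}" using \<tau>T \<delta> by simp
    then obtain d where d: "0 < d" "\<And>t. t \<in> {0..T} \<Longrightarrow> dist t \<tau> < d \<Longrightarrow> dist (F t) (F \<tau>) < e/2"
      using F e unfolding continuous_on_iff by (metis half_gt_zero)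
    obtain n0 where n0: "\<And>n. n0 \<le> n \<Longrightarrow> \<epsilon> n < d"
      using order_tendstoD(2)[OF \<epsilon>0 d(1)] unfolding eventually_sequentially by blast
    have "norm ((LINT t|time_measure T. \<eta> n t * F t) - F \<tau>) < e" if "n0 \<le> n" for n
    proof -
      have i\<eta>: "integrable (time_measure T) (\<eta> n)" by (rule continuous_integrable_time[OF c])
      have "(\<eta> n has_integral (\<Phi> n T - \<Phi> n 0)) {0..T}"
        using \<tau>T \<delta> D by (intro fundamental_theorem_of_calculus)
          (auto simp: has_real_derivative_iff_has_vector_derivative[symmetric] intro: DERIV_subset)
      moreover have "\<Phi> n T = 1" "\<Phi> n 0 = 0" using z0[of 0 n] o[of n T] \<epsilon>(2)[of n] \<tau>T by simp_all
      ultimately have I1: "(LINT t|time_measure T. \<eta> n t) = 1"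
        using LINT_time_eq_integral[OF c] by (simp add: integral_unique)
      have iF: "integrable (time_measure T) (\<lambda>t. \<eta> n t * F t)"
        by (intro continuous_integrable_time continuous_on_mult c F)
      have "\<bar>(LINT t|time_measure T. \<eta> n t * F t) - F \<tau>\<bar> = \<bar>LINT t|time_measure T. \<eta> n t * F t - \<eta> n t * F \<tau>\<bar>"
        using iF i\<eta> I1 by simp
      also have "\<dots> \<le> (LINT t|time_measure T. \<bar>\<eta> n t * F t - \<eta> n t * F \<tau>\<bar>)" by (rule integral_abs_bound)
      also have "\<dots> \<le> (LINT t|time_measure T. \<eta> n t * (e/2))"
      proof (rule integral_mono)
        fix t assume "t \<in> space (time_measure T)"
        then have t: "t \<in> {0..T}" by simp
        show "\<bar>\<eta> n t * F t - \<eta> n t * F \<tau>\<bar> \<le> \<eta> n t * (e/2)"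
        proof (cases "\<epsilon> n \<le> \<bar>t - \<tau>\<bar>")
          case True
          then show ?thesis by (simp add: z)
        next
          case False
          then have "\<bar>F t - F \<tau>\<bar> \<le> e/2" using d(2)[OF t] n0[OF that] by (simp add: dist_real_def)
          then have "\<eta> n t * \<bar>F t - F \<tau>\<bar> \<le> \<eta> n t * (e/2)" by (intro mult_left_mono nn)
          moreover have "\<bar>\<eta> n t * F t - \<eta> n t * F \<tau>\<bar> = \<eta> n t * \<bar>F t - F \<tau>\<bar>"
            using nn[of n t] by (simp add: abs_mult right_diff_distrib[symmetric])
          ultimately show ?thesis by simp
        qed
      qed (use iF i\<eta> in simp_all)
      also have "\<dots> = e/2" using I1 by simp
      finally show ?thesis using e by simp
    qed
    then show "\<exists>n0. \<forall>n\<ge>n0. norm ((LINT t|time_measure T. \<eta> n t * F t) - F \<tau>) < e" by blast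
  qed
  have L1: "(\<lambda>n. LINT t|time_measure T. (a n * bump (q n) 1 0 t) * F t) \<longlonglongrightarrow> F \<tau>1"
    by (rule L[OF _ _ P1(1,2,3) cont P1(4,5)]) (use \<delta> \<tau> in simp_all)
  have L2: "(\<lambda>n. LINT t|time_measure T. (b n * bump (r n) 1 0 t) * F t) \<longlonglongrightarrow> F \<tau>2"
    by (rule L[OF _ _ P2(1,2,3) cont P2(4,5)]) (use \<delta> \<tau> in simp_all)
  have e: "(LINT t|time_measure T. (a n * bump (q n) 1 0 t) * F t) - (LINT t|time_measure T. (b n * bump (r n) 1 0 t) * F t)
      = - (LINT t|time_measure T. (\<Phi>1 n t - \<Phi>2 n t) * g t)" for n
  proof -
    have i: "integrable (time_measure T) (\<lambda>t. (c * bump q 1 0 t) * F t)" for c q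
      by (intro continuous_integrable_time continuous_on_mult cont F)
    have "(LINT t|time_measure T. (a n * bump (q n) 1 0 t - b n * bump (r n) 1 0 t) * F t)
      = - (LINT t|time_measure T. (\<Phi>1 n t - \<Phi>2 n t) * g t)"
      using weak[OF tf(1)[of n]] unfolding tf(2) .
    then show ?thesis using i[of "a n" "q n"] i[of "b n" "r n"] by (simp add: left_diff_distrib)
  qed
  have "(\<lambda>n. - (LINT t|time_measure T. (\<Phi>1 n t - \<Phi>2 n t) * g t)) \<longlonglongrightarrow> F \<tau>1 - F \<tau>2"
    unfolding e[symmetric] by (intro tendsto_diff L1 L2)
  from LIMSEQ_unique[OF this tendsto_minus[OF R]] show ?thesis by simp
qed

lemma weak_derivative_primitive:
  assumes F: "continuous_on {0..T} (F :: real \<Rightarrow> real)" "F 0 = 0" and g: "integrable (time_measure T) g"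
    and weak: "\<And>\<phi>. test_function T \<phi> \<Longrightarrow>
       (LINT t|time_measure T. deriv \<phi> t * F t) = - (LINT t|time_measure T. \<phi> t * g t)"
    and \<tau>: "0 < \<tau>" "\<tau> < T"
  shows "F \<tau> = (LINT t|time_measure T. indicator {0<..<\<tau>} t * g t)"
proof -
  define \<sigma> where "\<sigma> n = \<tau> / real (n + 2)" for n
  have \<sigma>: "0 < \<sigma> n" "\<sigma> n < \<tau>" for n using \<tau>(1) by (simp_all add: \<sigma>_def pos_divide_less_eq)
  have \<sigma>0: "\<sigma> \<longlonglongrightarrow> 0"
  proof -
    have "(\<lambda>n. \<tau> * inverse (real (n + 2))) \<longlonglongrightarrow> \<tau> * 0"
      by (intro tendsto_mult tendsto_const LIMSEQ_ignore_initial_segment[OF lim_inverse_n])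
    then show ?thesis by (simp add: \<sigma>_def[abs_def] divide_inverse)
  qed
  have "(\<lambda>n. F (\<sigma> n)) \<longlonglongrightarrow> F 0"
  proof (rule continuous_on_tendsto_compose[OF F(1) \<sigma>0])
    show "\<forall>\<^sub>F n in sequentially. \<sigma> n \<in> {0..T}"
      using less_imp_le[OF \<sigma>(1)] less_imp_le[OF less_trans[OF \<sigma>(2) \<tau>(2)]] by (intro always_eventually allI) simp
  qed (use \<tau> in simp)
  have inc: "F \<tau> - F (\<sigma> n) = (LINT t|time_measure T. indicator {\<sigma> n<..<\<tau>} t * g t)" for n
    by (rule weak_derivative_increment[OF F(1) g weak \<sigma> \<tau>(2)])
  from \<open>(\<lambda>n. F (\<sigma> n)) \<longlonglongrightarrow> F 0\<close>
  have "(\<lambda>n. F \<tau> - F (\<sigma> n)) \<longlonglongrightarrow> F \<tau> - 0" unfolding F(2) by (intro tendsto_intros)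
  moreover have "(\<lambda>n. F \<tau> - F (\<sigma> n)) \<longlonglongrightarrow> (LINT t|time_measure T. indicator {0<..<\<tau>} t * g t)"
    unfolding inc
  proof (rule integral_dominated_convergence[where w="\<lambda>t. \<bar>g t\<bar>"])
    have gm: "g \<in> borel_measurable (time_measure T)" using g by (rule borel_measurable_integrable)
    have i: "(indicator {x<..<y} :: real \<Rightarrow> real) \<in> borel_measurable (time_measure T)" for x y
      by (intro measurable_restrict_space1 borel_measurable_indicator) simp
    show "(\<lambda>t. indicator {0<..<\<tau>} t * g t) \<in> borel_measurable (time_measure T)"
      "(\<lambda>t. indicator {\<sigma> n<..<\<tau>} t * g t) \<in> borel_measurable (time_measure T)" for n
      by (intro borel_measurable_times i gm)+
    show "integrable (time_measure T) (\<lambda>t. \<bar>g t\<bar>)" using g by simp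
    show "AE t in time_measure T. norm (indicator {\<sigma> n<..<\<tau>} t * g t) \<le> \<bar>g t\<bar>" for n
      by (intro AE_I2) (simp add: indicator_def)
    show "AE t in time_measure T. (\<lambda>n. indicator {\<sigma> n<..<\<tau>} t * g t) \<longlonglongrightarrow> indicator {0<..<\<tau>} t * g t"
    proof (intro AE_I2)
      fix t assume "t \<in> space (time_measure T)"
      then have "0 < t" by simp
      from order_tendstoD(2)[OF \<sigma>0 this]
      have "\<forall>\<^sub>F n in sequentially. indicator {0<..<\<tau>} t * g t = indicator {\<sigma> n<..<\<tau>} t * g t"
        by eventually_elim (use \<open>0 < t\<close> in \<open>simp add: indicator_def\<close>)
      then show "(\<lambda>n. indicator {\<sigma> n<..<\<tau>} t * g t) \<longlonglongrightarrow> indicator {0<..<\<tau>} t * g t"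
        by (rule Lim_transform_eventually[OF tendsto_const])
    qed
  qed
  ultimately show ?thesis by (simp add: LIMSEQ_unique)
qed

section \<open>Dual spaces and pairings\<close>

lemma abs_complete_equivalent_norm:
  assumes "abs_complete X n1"
    and "\<And>v. v \<in> X \<Longrightarrow> 0 \<le> n1 v" "\<And>v. v \<in> X \<Longrightarrow> 0 \<le> n2 v"
    and "\<And>v. v \<in> X \<Longrightarrow> n1 v \<le> C * n2 v" "\<And>v. v \<in> X \<Longrightarrow> n2 v \<le> C' * n1 v"
    and X: "seminormed_space X n1"
  shows "abs_complete X n2"
  unfolding abs_complete_def
proof (intro allI impI, elim conjE)
  fix d :: "nat \<Rightarrow> 'a \<Rightarrow> real" assume "\<forall>n. d n \<in> X" and s: "summable (\<lambda>n. n2 (d n))"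
  then have d: "d n \<in> X" for n by blast
  have "summable (\<lambda>n. n1 (d n))"
    by (rule summable_comparison_test'[OF summable_mult[OF s, of C], of 0]) (simp add: assms(2,4) d)
  then obtain u where u: "u \<in> X" "(\<lambda>n. n1 (\<lambda>i. u i - (\<Sum>j<n. d j i))) \<longlonglongrightarrow> 0"
    using assms(1) d unfolding abs_complete_def by blast
  interpret seminormed_space X n1 by fact
  have m: "(\<lambda>i. u i - (\<Sum>j<n. d j i)) \<in> X" for n by (intro diff_mem sum_mem u d)
  have "(\<lambda>n. n2 (\<lambda>i. u i - (\<Sum>j<n. d j i))) \<longlonglongrightarrow> 0"
  proof (rule Lim_null_comparison)
    show "\<forall>\<^sub>F n in sequentially. norm (n2 (\<lambda>i. u i - (\<Sum>j<n. d j i))) \<le> C' * n1 (\<lambda>i. u i - (\<Sum>j<n. d j i))"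
      by (intro always_eventually allI) (simp add: assms(3,5) m)
  qed (use tendsto_mult_right_zero[OF u(2)] in simp)
  then show "\<exists>u\<in>X. (\<lambda>n. n2 (\<lambda>i. u i - (\<Sum>j<n. d j i))) \<longlonglongrightarrow> 0" by (rule bexI[OF _ u(1)])
qed

context seminormed_space
begin

lemma dual_norm_bdd:
  assumes "F \<in> dual_space X nrm"
  shows "bdd_above ((\<lambda>v. \<bar>F v\<bar>) ` {v \<in> X. nrm v \<le> 1})"
proof -
  obtain C where C: "\<And>v. v \<in> X \<Longrightarrow> \<bar>F v\<bar> \<le> C * nrm v" using assms unfolding dual_space_def by blast
  show ?thesis
  proof (rule bdd_aboveI2)
    fix v assume v: "v \<in> {v \<in> X. nrm v \<le> 1}"
    have "\<bar>F v\<bar> \<le> C * nrm v" using C v by simp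
    also have "\<dots> \<le> \<bar>C\<bar> * nrm v" using v nrm_nonneg[of v] by (intro mult_right_mono) simp_all
    also have "\<dots> \<le> \<bar>C\<bar> * 1" using v by (intro mult_left_mono) simp_all
    finally show "\<bar>F v\<bar> \<le> \<bar>C\<bar> * 1" .
  qed
qed

lemma dual_norm_upper:
  assumes "F \<in> dual_space X nrm" "v \<in> X" "nrm v \<le> 1"
  shows "\<bar>F v\<bar> \<le> dual_norm X nrm F"
  unfolding dual_norm_def by (rule cSUP_upper) (use assms dual_norm_bdd in simp_all)

lemma dual_norm_least:
  assumes "\<And>v. v \<in> X \<Longrightarrow> nrm v \<le> 1 \<Longrightarrow> \<bar>F v\<bar> \<le> C"
  shows "dual_norm X nrm F \<le> C"
  unfolding dual_norm_def
proof (rule cSUP_least)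
  have "(\<lambda>i. 0) \<in> {v \<in> X. nrm v \<le> 1}" by (simp add: zero_mem nrm_zero)
  then show "{v \<in> X. nrm v \<le> 1} \<noteq> {}" by blast
qed (use assms in simp)

lemma dual_norm_le:
  assumes "\<And>v. v \<in> X \<Longrightarrow> \<bar>F v\<bar> \<le> C * nrm v" "0 \<le> C"
  shows "dual_norm X nrm F \<le> C"
proof (rule dual_norm_least)
  fix v assume v: "v \<in> X" "nrm v \<le> 1"
  have "\<bar>F v\<bar> \<le> C * nrm v" by (rule assms(1)[OF v(1)])
  also have "\<dots> \<le> C * 1" by (rule mult_left_mono[OF v(2) assms(2)])
  finally show "\<bar>F v\<bar> \<le> C" by simp
qed

lemma dual_seminormed: "seminormed_space (dual_space X nrm) (dual_norm X nrm)"
proof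
  show "(\<lambda>v. 0) \<in> dual_space X nrm" unfolding dual_space_def by (auto intro: exI[of _ 0])
next
  fix F G a b assume F: "F \<in> dual_space X nrm" and G: "G \<in> dual_space X nrm"
  obtain C where C: "\<And>v. v \<in> X \<Longrightarrow> \<bar>F v\<bar> \<le> C * nrm v" using F unfolding dual_space_def by blast
  obtain D where D: "\<And>v. v \<in> X \<Longrightarrow> \<bar>G v\<bar> \<le> D * nrm v" using G unfolding dual_space_def by blast
  have tri: "\<bar>a * F v + b * G v\<bar> \<le> \<bar>a\<bar> * \<bar>F v\<bar> + \<bar>b\<bar> * \<bar>G v\<bar>" for v
    using abs_triangle_ineq[of "a * F v" "b * G v"] by (simp add: abs_mult)
  have "\<bar>a * F v + b * G v\<bar> \<le> (\<bar>a\<bar> * C + \<bar>b\<bar> * D) * nrm v" if "v \<in> X" for v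
  proof -
    have "\<bar>a\<bar> * \<bar>F v\<bar> + \<bar>b\<bar> * \<bar>G v\<bar> \<le> \<bar>a\<bar> * (C * nrm v) + \<bar>b\<bar> * (D * nrm v)"
      by (intro add_mono mult_left_mono C D that) simp_all
    then show ?thesis using tri[of v] by (simp add: algebra_simps)
  qed
  moreover have "a * F (\<lambda>i. x * v i + y * w i) + b * G (\<lambda>i. x * v i + y * w i)
      = x * (a * F v + b * G v) + y * (a * F w + b * G w)" if "v \<in> X" "w \<in> X" for v w x y
  proof -
    have "F (\<lambda>i. x * v i + y * w i) = x * F v + y * F w" "G (\<lambda>i. x * v i + y * w i) = x * G v + y * G w"
      using F G that unfolding dual_space_def by blast+
    then show ?thesis by (simp add: algebra_simps)
  qed
  ultimately show "(\<lambda>v. a * F v + b * G v) \<in> dual_space X nrm" unfolding dual_space_def by blast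
  show "dual_norm X nrm (\<lambda>v. a * F v + b * G v) \<le> \<bar>a\<bar> * dual_norm X nrm F + \<bar>b\<bar> * dual_norm X nrm G"
  proof (rule dual_norm_least)
    fix v assume v: "v \<in> X" "nrm v \<le> 1"
    have "\<bar>a\<bar> * \<bar>F v\<bar> + \<bar>b\<bar> * \<bar>G v\<bar> \<le> \<bar>a\<bar> * dual_norm X nrm F + \<bar>b\<bar> * dual_norm X nrm G"
      by (intro add_mono mult_left_mono dual_norm_upper F G v) simp_all
    then show "\<bar>a * F v + b * G v\<bar> \<le> \<bar>a\<bar> * dual_norm X nrm F + \<bar>b\<bar> * dual_norm X nrm G"
      using tri[of v] by linarith
  qed
next
  fix F assume F: "F \<in> dual_space X nrm"
  show "0 \<le> dual_norm X nrm F"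
    using dual_norm_upper[OF F zero_mem] by (simp add: nrm_zero)
qed

lemma nrm_L2_space:
  assumes "f \<in> bochner_L2 (time_measure T) X nrm"
  shows "(\<lambda>t. nrm (f t)) \<in> L2_space (time_measure T)"
  using assms nrm_comp_measurable[OF complete_time_measure] by (simp add: L2_space_def bochner_L2_iff)

lemma functional_L2_space:
  assumes f: "f \<in> bochner_L2 (time_measure T) X nrm"
    and l: "\<And>x y. x \<in> X \<Longrightarrow> y \<in> X \<Longrightarrow> \<bar>l x - l y\<bar> \<le> C * nrm (\<lambda>i. x i - y i)" "\<And>x. x \<in> X \<Longrightarrow> \<bar>l x\<bar> \<le> C * nrm x"
  shows "(\<lambda>t. l (f t)) \<in> L2_space (time_measure T)"
proof -
  have bm: "bochner_measurable (time_measure T) X nrm f" and int: "integrable (time_measure T) (\<lambda>t. (nrm (f t))\<^sup>2)"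
    using f by (simp_all add: bochner_L2_iff)
  have m: "(\<lambda>t. l (f t)) \<in> borel_measurable (time_measure T)"
    by (rule Lipschitz_comp_measurable[OF complete_time_measure bm l(1)])
  have "integrable (time_measure T) (\<lambda>t. (l (f t))\<^sup>2)"
  proof (rule Bochner_Integration.integrable_bound)
    show "integrable (time_measure T) (\<lambda>t. C\<^sup>2 * (nrm (f t))\<^sup>2)" using int by simp
    show "(\<lambda>t. (l (f t))\<^sup>2) \<in> borel_measurable (time_measure T)" using m by (rule borel_measurable_power)
    show "AE t in time_measure T. norm ((l (f t))\<^sup>2) \<le> norm (C\<^sup>2 * (nrm (f t))\<^sup>2)"
      using bochner_measurable_AE_mem[OF bm]
    proof eventually_elim
      fix t assume t: "f t \<in> X"
      have "\<bar>l (f t)\<bar>\<^sup>2 \<le> (C * nrm (f t))\<^sup>2" by (rule power_mono[OF l(2)[OF t]]) simp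
      then show "norm ((l (f t))\<^sup>2) \<le> norm (C\<^sup>2 * (nrm (f t))\<^sup>2)" by (simp add: power_mult_distrib)
    qed
  qed
  then show ?thesis using m by (simp add: L2_space_def)
qed

end

lemma const_L2_space: "(\<lambda>t. c) \<in> L2_space (time_measure T)"
  using finite_measure.integrable_const[OF finite_time_measure, of T "c\<^sup>2"] by (simp add: L2_space_def)

lemma continuous_L2_space:
  assumes "continuous_on {0..T} h" shows "h \<in> L2_space (time_measure T)"
  using borel_measurable_integrable[OF continuous_integrable_time[OF assms]]
    continuous_integrable_time[OF continuous_on_power[OF assms, of 2]]
  by (simp add: L2_space_def)

lemma L2_space_integrable_time: "f \<in> L2_space (time_measure T) \<Longrightarrow> integrable (time_measure T) f"
  using L2_space_mult_integrable[OF _ const_L2_space[of 1]] by simp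

lemma L2_norm_one:
  assumes "0 < T" shows "L2_norm (time_measure T) (\<lambda>t. 1) = sqrt T"
  using assms by (simp add: L2_norm_def measure_restrict_space)

lemma LINT_le_L2_norm:
  assumes "0 < T" "f \<in> L2_space (time_measure T)"
  shows "(LINT t|time_measure T. f t) \<le> sqrt T * L2_norm (time_measure T) f"
  using L2.cauchy_schwarz[OF assms(2) const_L2_space[of 1]] L2_norm_one[OF assms(1)]
  by (simp add: mult.commute)

text \<open>Cauchy--Schwarz in time. The weight \<open>h\<close> will be a test function or its derivative, and \<open>l\<close> the pairing
  with a fixed element.\<close>

lemma (in seminormed_space) functional_integral_tendsto:
  assumes T: "0 < T" and h: "continuous_on {0..T} h"
    and f: "\<And>n::nat. f n \<in> bochner_L2 (time_measure T) X nrm" and g: "g \<in> bochner_L2 (time_measure T) X nrm"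
    and lim: "(\<lambda>n. L2_norm (time_measure T) (\<lambda>t. nrm (\<lambda>i. f n t i - g t i))) \<longlonglongrightarrow> 0"
    and l: "\<And>x y. x \<in> X \<Longrightarrow> y \<in> X \<Longrightarrow> \<bar>l x - l y\<bar> \<le> C * nrm (\<lambda>i. x i - y i)" "\<And>x. x \<in> X \<Longrightarrow> \<bar>l x\<bar> \<le> C * nrm x"
  shows "(\<lambda>n. LINT t|time_measure T. h t * l (f n t)) \<longlonglongrightarrow> (LINT t|time_measure T. h t * l (g t))"
proof -
  let ?M = "time_measure T"
  have hL: "h \<in> L2_space ?M" by (rule continuous_L2_space[OF h])
  have fL: "(\<lambda>t. l (f n t)) \<in> L2_space ?M" for n by (rule functional_L2_space[OF f l])
  have gL: "(\<lambda>t. l (g t)) \<in> L2_space ?M" by (rule functional_L2_space[OF g l])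
  have dL: "(\<lambda>t. nrm (\<lambda>i. f n t i - g t i)) \<in> L2_space ?M" for n
    by (rule nrm_L2_space[OF bochner_L2_diff[OF complete_time_measure f g]])
  have "(\<lambda>n. (LINT t|?M. h t * l (f n t)) - (LINT t|?M. h t * l (g t))) \<longlonglongrightarrow> 0"
  proof (rule Lim_null_comparison)
    show "\<forall>\<^sub>F n in sequentially. norm ((LINT t|?M. h t * l (f n t)) - (LINT t|?M. h t * l (g t)))
        \<le> L2_norm ?M h * (\<bar>C\<bar> * L2_norm ?M (\<lambda>t. nrm (\<lambda>i. f n t i - g t i)))"
    proof (intro always_eventually allI)
      fix n
      have ldL: "(\<lambda>t. l (f n t) - l (g t)) \<in> L2_space ?M" by (rule L2.diff_mem[OF fL gL])
      have "(LINT t|?M. h t * l (f n t)) - (LINT t|?M. h t * l (g t)) = (LINT t|?M. h t * (l (f n t) - l (g t)))"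
        using L2_space_mult_integrable[OF hL fL[of n]] L2_space_mult_integrable[OF hL gL]
        by (simp add: right_diff_distrib)
      also have "\<bar>\<dots>\<bar> \<le> L2_norm ?M h * L2_norm ?M (\<lambda>t. l (f n t) - l (g t))"
        by (rule L2.cauchy_schwarz[OF hL ldL])
      finally have 1: "\<bar>(LINT t|?M. h t * l (f n t)) - (LINT t|?M. h t * l (g t))\<bar> \<le> \<dots>" .
      have "L2_norm ?M (\<lambda>t. l (f n t) - l (g t)) \<le> \<bar>C\<bar> * L2_norm ?M (\<lambda>t. nrm (\<lambda>i. f n t i - g t i))"
        unfolding L2_norm_def
      proof (rule real_le_lsqrt)
        have "(LINT t|?M. (l (f n t) - l (g t))\<^sup>2) \<le> (LINT t|?M. C\<^sup>2 * (nrm (\<lambda>i. f n t i - g t i))\<^sup>2)"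
        proof (rule integral_mono_AE)
          show "AE t in ?M. (l (f n t) - l (g t))\<^sup>2 \<le> C\<^sup>2 * (nrm (\<lambda>i. f n t i - g t i))\<^sup>2"
            using bochner_L2_AE_mem[OF f[of n]] bochner_L2_AE_mem[OF g]
          proof eventually_elim
            fix t assume t: "f n t \<in> X" "g t \<in> X"
            have "\<bar>l (f n t) - l (g t)\<bar>\<^sup>2 \<le> (C * nrm (\<lambda>i. f n t i - g t i))\<^sup>2" by (rule power_mono[OF l(1)[OF t]]) simp
            then show "(l (f n t) - l (g t))\<^sup>2 \<le> C\<^sup>2 * (nrm (\<lambda>i. f n t i - g t i))\<^sup>2" by (simp add: power_mult_distrib)
          qed
        qed (use L2_spaceD(2)[OF ldL] L2_spaceD(2)[OF dL[of n]] in simp_all)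
        then show "(LINT t|?M. (l (f n t) - l (g t))\<^sup>2)
           \<le> (\<bar>C\<bar> * sqrt (LINT t|?M. (nrm (\<lambda>i. f n t i - g t i))\<^sup>2))\<^sup>2"
          by (simp add: power_mult_distrib)
      qed simp_all
      then have "L2_norm ?M h * L2_norm ?M (\<lambda>t. l (f n t) - l (g t))
          \<le> L2_norm ?M h * (\<bar>C\<bar> * L2_norm ?M (\<lambda>t. nrm (\<lambda>i. f n t i - g t i)))"
        by (intro mult_left_mono L2_norm_nonneg)
      with 1 show "norm ((LINT t|?M. h t * l (f n t)) - (LINT t|?M. h t * l (g t)))
        \<le> L2_norm ?M h * (\<bar>C\<bar> * L2_norm ?M (\<lambda>t. nrm (\<lambda>i. f n t i - g t i)))" by simp
    qed
    show "(\<lambda>n. L2_norm ?M h * (\<bar>C\<bar> * L2_norm ?M (\<lambda>t. nrm (\<lambda>i. f n t i - g t i)))) \<longlonglongrightarrow> 0"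
      by (intro tendsto_mult_right_zero lim)
  qed
  then show ?thesis by (simp only: LIM_zero_iff)
qed

section \<open>Derivatives of exponential sums\<close>

definition exp_deriv :: "(real \<times> ('i \<Rightarrow> real)) list \<Rightarrow> (real \<times> ('i \<Rightarrow> real)) list" where
  "exp_deriv L = map (\<lambda>(l, x). (l, \<lambda>i. l * x i)) L"

lemma exp_deriv_simps: "exp_deriv [] = []" "exp_deriv ((l, x) # L) = (l, \<lambda>i. l * x i) # exp_deriv L"
  by (simp_all add: exp_deriv_def)

context semi_inner_space
begin

lemma exp_list_deriv: "exp_list X L \<Longrightarrow> exp_list X (exp_deriv L)"
  by (induction rule: exp_list_induct) (simp_all add: exp_deriv_simps scale_mem)

lemma ip_exp_sum_Cons:
  assumes "x \<in> X" "exp_list X L" "v \<in> X"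
  shows "ip (exp_sum ((l, x) # L) t) v = exp (l * t) * ip x v + ip (exp_sum L t) v"
  unfolding exp_sum_Cons ip_lin[OF assms(1) exp_sum_mem[OF assms(2)] assms(3)] by simp

lemma ip_exp_sum_deriv:
  assumes "exp_list X L" "v \<in> X"
  shows "((\<lambda>t. ip (exp_sum L t) v) has_real_derivative ip (exp_sum (exp_deriv L) t) v) (at t)"
  using assms(1)
proof (induction rule: exp_list_induct)
  case Nil
  show ?case by (simp add: exp_sum_Nil exp_deriv_simps ip_zero_left assms(2))
next
  case (Cons l x L)
  have "((\<lambda>t. exp (l * t) * ip x v) has_real_derivative exp (l * t) * l * ip x v) (at t)"
    by (auto intro!: derivative_eq_intros)
  from DERIV_add[OF this Cons(4)] show ?case
    unfolding exp_deriv_simps ip_exp_sum_Cons[OF Cons(2,3) assms(2)]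
      ip_exp_sum_Cons[OF scale_mem[OF Cons(2)] exp_list_deriv[OF Cons(3)] assms(2)]
    by (simp add: ip_scale_left Cons(2) assms(2) mult_ac)
qed

lemma ip_exp_sum_exp_sum_deriv:
  assumes "exp_list X L" "exp_list X R"
  shows "((\<lambda>t. ip (exp_sum L t) (exp_sum R t)) has_real_derivative
     ip (exp_sum (exp_deriv L) t) (exp_sum R t) + ip (exp_sum L t) (exp_sum (exp_deriv R) t)) (at t)"
  using assms(1)
proof (induction rule: exp_list_induct)
  case Nil
  have z: "ip (\<lambda>i. 0) (exp_sum M s) = 0" if "exp_list X M" for M s by (rule ip_zero_left[OF exp_sum_mem[OF that]])
  show ?case
    unfolding exp_deriv_simps exp_sum_Nil z[OF assms(2)] z[OF exp_list_deriv[OF assms(2)]] by simp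
next
  case (Cons l x L)
  have dR: "((\<lambda>t. ip x (exp_sum R t)) has_real_derivative ip x (exp_sum (exp_deriv R) t)) (at t)"
    unfolding ip_sym[OF Cons(2) exp_sum_mem[OF assms(2)]] ip_sym[OF Cons(2) exp_sum_mem[OF exp_list_deriv[OF assms(2)]]]
    by (rule ip_exp_sum_deriv[OF assms(2) Cons(2)])
  have "((\<lambda>t. exp (l * t)) has_real_derivative exp (l * t) * l) (at t)"
    by (auto intro!: derivative_eq_intros)
  from DERIV_add[OF DERIV_mult[OF this dR] Cons(4)]
  show ?case
    unfolding exp_deriv_simps ip_exp_sum_Cons[OF Cons(2,3) exp_sum_mem[OF assms(2)]]
      ip_exp_sum_Cons[OF Cons(2,3) exp_sum_mem[OF exp_list_deriv[OF assms(2)]]]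
      ip_exp_sum_Cons[OF scale_mem[OF Cons(2)] exp_list_deriv[OF Cons(3)] exp_sum_mem[OF assms(2)]]
    by (simp add: ip_scale_left Cons(2) exp_sum_mem[OF assms(2)] algebra_simps)
qed

lemma ip_exp_sum_square_deriv:
  assumes "exp_list X L"
  shows "((\<lambda>t. ip (exp_sum L t) (exp_sum L t)) has_real_derivative
     2 * ip (exp_sum (exp_deriv L) t) (exp_sum L t)) (at t)"
  using ip_exp_sum_exp_sum_deriv[OF assms assms, of t]
    ip_sym[OF exp_sum_mem[OF assms, of t] exp_sum_mem[OF exp_list_deriv[OF assms], of t]] by simp

lemma ip_exp_sum_continuous:
  assumes "exp_list X L" "v \<in> X" shows "continuous_on S (\<lambda>t. ip (exp_sum L t) v)"
  by (intro continuous_at_imp_continuous_on ballI DERIV_isCont[OF ip_exp_sum_deriv[OF assms]])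

lemma ip_exp_sum_exp_sum_continuous:
  assumes "exp_list X L" "exp_list X R" shows "continuous_on S (\<lambda>t. ip (exp_sum L t) (exp_sum R t))"
  by (intro continuous_at_imp_continuous_on ballI DERIV_isCont[OF ip_exp_sum_exp_sum_deriv[OF assms]])

end

section \<open>The abstract degenerate parabolic equation\<close>

text \<open>The space \<open>V\<close> carries the form \<open>b\<close> of the larger space \<open>H\<close>, the form \<open>k\<close> of the space \<open>Z\<close> of data and its own
  form \<open>e\<close>. The problem is degenerate because \<open>b v v = 0\<close> is possible for \<open>v \<noteq> 0\<close>: the inclusion of \<open>V\<close> in
  \<open>H\<close> stands for restriction to a subdomain.\<close>

locale degenerate_parabolic =
  fixes V H Z :: "('i \<Rightarrow> real) set"
    and b k e :: "('i \<Rightarrow> real) \<Rightarrow> ('i \<Rightarrow> real) \<Rightarrow> real" and c :: real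
  assumes H: "semi_inner_space H b" and Z: "semi_inner_space Z k" and E: "semi_inner_space V e"
    and VH: "V \<subseteq> H" and VZ: "V \<subseteq> Z" and c: "0 < c"
    and V_complete: "abs_complete V (\<lambda>v. sqrt (b v v + k v v + e v v))"
    and H_complete: "abs_complete H (\<lambda>v. sqrt (b v v))"
begin

definition ipV :: "('i \<Rightarrow> real) \<Rightarrow> ('i \<Rightarrow> real) \<Rightarrow> real" where
  "ipV u v = b u v + k u v + e u v"

definition a :: "('i \<Rightarrow> real) \<Rightarrow> ('i \<Rightarrow> real) \<Rightarrow> real" where
  "a u v = c * e u v + k u v"

sublocale H: semi_inner_space H b by (rule H)
sublocale Z: semi_inner_space Z k by (rule Z)
sublocale E: semi_inner_space V e by (rule E)
sublocale B: semi_inner_space V b by (rule semi_inner_space_subset[OF H E VH])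
sublocale K: semi_inner_space V k by (rule semi_inner_space_subset[OF Z E VZ])

sublocale A: semi_inner_space V a
  using semi_inner_space_combine[OF E K.semi_inner_space_axioms, of c 1] c by (simp add: a_def[abs_def])

sublocale V: semi_inner_space V ipV
  using semi_inner_space_combine[OF semi_inner_space_combine[OF B.semi_inner_space_axioms K.semi_inner_space_axioms, of 1 1] E, of 1 1]
  by (simp add: ipV_def[abs_def])

lemma V_in_H: "v \<in> V \<Longrightarrow> v \<in> H" using VH by blast
lemma V_in_Z: "v \<in> V \<Longrightarrow> v \<in> Z" using VZ by blast

lemma V_complete': "abs_complete V V.nrm"
  using V_complete by (simp add: ipV_def)

lemma nrm_le_V:
  assumes "v \<in> V" shows "H.nrm v \<le> V.nrm v" "Z.nrm v \<le> V.nrm v" "E.nrm v \<le> V.nrm v"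
  using B.ip_nonneg[OF assms] K.ip_nonneg[OF assms] E.ip_nonneg[OF assms]
  by (simp_all add: ipV_def)

lemma a_bounded:
  assumes "u \<in> V" "v \<in> V" shows "\<bar>a u v\<bar> \<le> (c + 1) * V.nrm u * V.nrm v"
proof -
  have "\<bar>e u v\<bar> \<le> V.nrm u * V.nrm v"
    by (rule order_trans[OF E.cauchy_schwarz[OF assms]]) (intro mult_mono nrm_le_V assms V.nrm_nonneg E.nrm_nonneg)
  then have "c * \<bar>e u v\<bar> \<le> c * (V.nrm u * V.nrm v)" using c by (intro mult_left_mono) simp_all
  moreover have "\<bar>k u v\<bar> \<le> V.nrm u * V.nrm v"
    by (rule order_trans[OF K.cauchy_schwarz[OF assms]]) (intro mult_mono nrm_le_V assms V.nrm_nonneg K.nrm_nonneg)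
  moreover have "\<bar>a u v\<bar> \<le> c * \<bar>e u v\<bar> + \<bar>k u v\<bar>"
    unfolding a_def using abs_triangle_ineq[of "c * e u v" "k u v"] c by (simp add: abs_mult)
  ultimately show ?thesis by (simp add: algebra_simps)
qed

lemma b_bounded:
  assumes "u \<in> V" "v \<in> V" shows "\<bar>b u v\<bar> \<le> V.nrm u * V.nrm v"
  by (rule order_trans[OF B.cauchy_schwarz[OF assms]]) (intro mult_mono nrm_le_V assms V.nrm_nonneg B.nrm_nonneg)

lemma k_bounded:
  assumes "u \<in> Z" "v \<in> V" shows "\<bar>k u v\<bar> \<le> Z.nrm u * V.nrm v"
  by (rule order_trans[OF Z.cauchy_schwarz[OF assms(1) V_in_Z[OF assms(2)]]])
     (intro mult_left_mono nrm_le_V assms Z.nrm_nonneg)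

lemma coercive:
  assumes "v \<in> V" shows "ipV v v \<le> (1 + 1 / c) * (a v v + b v v)"
proof -
  have "(1 + 1 / c) * (a v v + b v v) = ipV v v + c * e v v + (k v v + b v v) / c"
    using c by (simp add: a_def ipV_def field_simps)
  moreover have "0 \<le> c * e v v" using c E.ip_nonneg[OF assms] by simp
  moreover have "0 \<le> (k v v + b v v) / c"
    using c K.ip_nonneg[OF assms] B.ip_nonneg[OF assms] by simp
  ultimately show ?thesis by linarith
qed

lemma k_le_a: "v \<in> V \<Longrightarrow> k v v \<le> a v v"
  using c E.ip_nonneg[of v] by (simp add: a_def)

text \<open>By \<open>coercive\<close> the form \<open>l * b + a\<close> is equivalent to the inner product of \<open>V\<close>, and the right side is bounded
  because \<open>k \<le> a\<close>.\<close>

lemma stationary_problem: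
  assumes l: "1 \<le> l" and \<zeta>: "\<zeta> \<in> Z"
  shows "\<exists>w\<in>V. \<forall>v\<in>V. l * b w v + a w v = k \<zeta> v"
proof -
  interpret Q: semi_inner_space V "\<lambda>u v. l * b u v + 1 * a u v"
    by (rule semi_inner_space_combine[OF B.semi_inner_space_axioms A.semi_inner_space_axioms]) (use l in simp_all)
  have "abs_complete V Q.nrm"
  proof (rule abs_complete_equivalent_norm[OF V_complete' V.nrm_nonneg Q.nrm_nonneg _ _ V.seminormed_space_axioms])
    fix v assume v: "v \<in> V"
    have "ipV v v \<le> (1 + 1/c) * (a v v + b v v)" by (rule coercive[OF v])
    also have "\<dots> \<le> (1 + 1/c) * (l * b v v + 1 * a v v)"
      using c l B.ip_nonneg[OF v] by (intro mult_left_mono) (simp_all add: mult_right_le_one_le mult_le_cancel_right1)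
    finally show "V.nrm v \<le> sqrt (1 + 1/c) * Q.nrm v" by (simp only: real_sqrt_mult[symmetric] real_sqrt_le_mono)
    have "b v v \<le> ipV v v" using K.ip_nonneg[OF v] E.ip_nonneg[OF v] by (simp add: ipV_def)
    then have "l * b v v \<le> l * ipV v v" using l by (intro mult_left_mono) simp_all
    moreover have "a v v \<le> (c + 1) * ipV v v"
      using a_bounded[OF v v] V.nrm_sq[OF v] by (simp add: power2_eq_square mult.assoc)
    ultimately have "l * b v v + 1 * a v v \<le> (l + c + 1) * ipV v v" by (simp add: algebra_simps)
    then show "Q.nrm v \<le> sqrt (l + c + 1) * V.nrm v" by (simp only: real_sqrt_mult[symmetric] real_sqrt_le_mono)
  qed
  then have "\<exists>w\<in>V. \<forall>v\<in>V. l * b w v + 1 * a w v = k \<zeta> v"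
  proof (rule Q.riesz_representation)
    show "k \<zeta> (\<lambda>i. x * v i + y * w i) = x * k \<zeta> v + y * k \<zeta> w" if "v \<in> V" "w \<in> V" for v w x y
      by (rule Z.ip_lin_right[OF V_in_Z[OF that(1)] V_in_Z[OF that(2)] \<zeta>])
    show "\<bar>k \<zeta> v\<bar> \<le> Z.nrm \<zeta> * Q.nrm v" if v: "v \<in> V" for v
    proof (rule order_trans[OF Z.cauchy_schwarz[OF \<zeta> V_in_Z[OF v]]], rule mult_left_mono[OF _ Z.nrm_nonneg[OF \<zeta>]])
      have "0 \<le> l * b v v" using l B.ip_nonneg[OF v] by simp
      then show "Z.nrm v \<le> Q.nrm v" using k_le_a[OF v] by simp
    qed
  qed
  then show ?thesis by simp
qed

text \<open>Lists of modes: an exponential datum \<open>exp (l t) \<zeta>\<close> with the response \<open>exp (l t) w\<close>.\<close>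

definition modes :: "(real \<times> ('i \<Rightarrow> real) \<times> ('i \<Rightarrow> real)) list \<Rightarrow> bool" where
  "modes K \<longleftrightarrow> (\<forall>(l, \<zeta>, w)\<in>set K. 1 \<le> l \<and> \<zeta> \<in> Z \<and> w \<in> V \<and> (\<forall>v\<in>V. l * b w v + a w v = k \<zeta> v))"

definition datum :: "(real \<times> ('i \<Rightarrow> real) \<times> ('i \<Rightarrow> real)) list \<Rightarrow> (real \<times> ('i \<Rightarrow> real)) list" where
  "datum K = map (\<lambda>(l, \<zeta>, w). (l, \<zeta>)) K"

definition response :: "(real \<times> ('i \<Rightarrow> real) \<times> ('i \<Rightarrow> real)) list \<Rightarrow> (real \<times> ('i \<Rightarrow> real)) list" where
  "response K = map (\<lambda>(l, \<zeta>, w). (l, w)) K"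

text \<open>Linearity of the problem in the data is used only through differences of two lists.\<close>

definition negate :: "(real \<times> ('i \<Rightarrow> real) \<times> ('i \<Rightarrow> real)) list \<Rightarrow> (real \<times> ('i \<Rightarrow> real) \<times> ('i \<Rightarrow> real)) list" where
  "negate K = map (\<lambda>(l, \<zeta>, w). (l, \<lambda>i. - 1 * \<zeta> i, \<lambda>i. - 1 * w i)) K"

lemma modes_append: "modes (K @ K') \<longleftrightarrow> modes K \<and> modes K'"
  by (simp add: modes_def ball_Un)

lemma datum_append: "datum (K @ K') = datum K @ datum K'" and response_append: "response (K @ K') = response K @ response K'"
  by (simp_all add: datum_def response_def)

lemma exp_list_modes:
  assumes "modes K" shows "exp_list Z (datum K)" "exp_list V (response K)"
  using assms by (auto simp: modes_def datum_def response_def exp_list_def)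

lemma modes_negate:
  assumes "modes K" shows "modes (negate K)"
  unfolding modes_def
proof
  fix m assume "m \<in> set (negate K)"
  then obtain l \<zeta> w where m: "m = (l, \<lambda>i. - 1 * \<zeta> i, \<lambda>i. - 1 * w i)" "(l, \<zeta>, w) \<in> set K"
    by (auto simp: negate_def)
  then have K: "1 \<le> l" "\<zeta> \<in> Z" "w \<in> V" "\<And>v. v \<in> V \<Longrightarrow> l * b w v + a w v = k \<zeta> v"
    using assms by (auto simp: modes_def)
  have "l * b (\<lambda>i. - 1 * w i) v + a (\<lambda>i. - 1 * w i) v = k (\<lambda>i. - 1 * \<zeta> i) v" if v: "v \<in> V" for v
    unfolding B.ip_scale_left[OF K(3) v] A.ip_scale_left[OF K(3) v] Z.ip_scale_left[OF K(2) V_in_Z[OF v]]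
    using K(4)[OF v] by simp
  then show "case m of (l, \<zeta>, w) \<Rightarrow> 1 \<le> l \<and> \<zeta> \<in> Z \<and> w \<in> V \<and> (\<forall>v\<in>V. l * b w v + a w v = k \<zeta> v)"
    unfolding m(1) prod.case using K(1) Z.scale_mem[OF K(2), of "- 1"] V.scale_mem[OF K(3), of "- 1"] by blast
qed

lemma exp_sum_negate:
  "exp_sum (datum (negate K)) t = (\<lambda>i. - exp_sum (datum K) t i)"
  "exp_sum (response (negate K)) t = (\<lambda>i. - exp_sum (response K) t i)"
  by (induction K) (auto simp: exp_sum_def datum_def response_def negate_def fun_eq_iff)

lemma exp_sum_difference:
  "exp_sum (datum (K @ negate K')) t = (\<lambda>i. exp_sum (datum K) t i - exp_sum (datum K') t i)"
  "exp_sum (response (K @ negate K')) t = (\<lambda>i. exp_sum (response K) t i - exp_sum (response K') t i)"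
  by (simp_all add: datum_append response_append exp_sum_append exp_sum_negate)

lemma modes_exist:
  assumes "exp_list Z L" shows "\<exists>K. modes K \<and> datum K = L"
  using assms
proof (induction rule: exp_list_induct)
  case Nil
  show ?case by (intro exI[of _ "[]"]) (simp add: modes_def datum_def)
next
  case (Cons l \<zeta> L)
  then obtain K where K: "modes K" "datum K = L" by blast
  obtain w where w: "w \<in> V" "\<forall>v\<in>V. l * b w v + a w v = k \<zeta> v"
    using stationary_problem[OF Cons(1,2)] by blast
  have "modes ((l, \<zeta>, w) # K)" using K(1) w Cons(1,2) by (simp add: modes_def)
  moreover have "datum ((l, \<zeta>, w) # K) = (l, \<zeta>) # L" using K(2) by (simp add: datum_def)
  ultimately show ?case by blast
qed

lemma modes_equation:
  assumes "modes K" "v \<in> V"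
  shows "b (exp_sum (exp_deriv (response K)) t) v + a (exp_sum (response K) t) v = k (exp_sum (datum K) t) v"
  using assms(1)
proof (induction K)
  case Nil
  show ?case by (simp add: response_def datum_def exp_deriv_simps exp_sum_Nil
        B.ip_zero_left A.ip_zero_left K.ip_zero_left assms(2))
next
  case (Cons m K)
  obtain l \<zeta> w where m: "m = (l, \<zeta>, w)" by (cases m)
  have K: "modes K" and mm: "\<zeta> \<in> Z" "w \<in> V" "l * b w v + a w v = k \<zeta> v"
    using Cons.prems assms(2) by (simp_all add: modes_def m)
  note L = exp_list_modes[OF K]
  have s: "response (m # K) = (l, w) # response K" "datum (m # K) = (l, \<zeta>) # datum K"
    by (simp_all add: response_def datum_def m)
  have "exp (l * t) * (l * b w v + a w v) = exp (l * t) * k \<zeta> v" using mm(3) by simp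
  then show ?case
    unfolding s exp_deriv_simps A.ip_exp_sum_Cons[OF mm(2) L(2) assms(2)]
      B.ip_exp_sum_Cons[OF B.scale_mem[OF mm(2)] B.exp_list_deriv[OF L(2)] assms(2)]
      Z.ip_exp_sum_Cons[OF mm(1) L(1) V_in_Z[OF assms(2)]] B.ip_scale_left[OF mm(2) assms(2)]
    using Cons.IH[OF K] by (simp add: algebra_simps)
qed

text \<open>Test the equation with the response itself and absorb \<open>2 * k P u \<le> k P P + k u u\<close> into \<open>2 * a u u\<close>.\<close>

lemma energy_inequality:
  assumes "modes K"
  shows "2 * b (exp_sum (exp_deriv (response K)) t) (exp_sum (response K) t)
    \<le> k (exp_sum (datum K) t) (exp_sum (datum K) t) - a (exp_sum (response K) t) (exp_sum (response K) t)"
proof -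
  note L = exp_list_modes[OF assms]
  define u where "u = exp_sum (response K) t"
  define P where "P = exp_sum (datum K) t"
  have u: "u \<in> V" and P: "P \<in> Z"
    unfolding u_def P_def by (rule V.exp_sum_mem[OF L(2)], rule Z.exp_sum_mem[OF L(1)])
  have "0 \<le> k (\<lambda>i. 1 * P i + (- 1) * u i) (\<lambda>i. 1 * P i + (- 1) * u i)"
    by (rule Z.ip_nonneg[OF Z.lin_mem[OF P V_in_Z[OF u]]])
  then have "2 * k P u \<le> k P P + k u u" unfolding Z.ip_lin_square[OF P V_in_Z[OF u]] by simp
  then show ?thesis
    using modes_equation[OF assms u, of t] k_le_a[OF u] unfolding u_def[symmetric] P_def[symmetric] by linarith
qed

text \<open>The energy starts from 0 at \<open>t = -\<infinity>\<close>, and on the negative half line the datum contributes at most the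
  integral of \<open>\<delta>\<^sup>2 * exp (2 * t)\<close>.\<close>

lemma energy_at_zero:
  assumes "modes K" and d: "\<And>t. t \<le> 0 \<Longrightarrow> Z.nrm (exp_sum (datum K) t) \<le> \<delta> * exp t"
  shows "b (exp_sum (response K) 0) (exp_sum (response K) 0) \<le> \<delta>\<^sup>2"
proof -
  note L = exp_list_modes[OF assms(1)]
  define f where "f t = b (exp_sum (response K) t) (exp_sum (response K) t)" for t
  define h where "h t = f t - \<delta>\<^sup>2 / 2 * exp (2 * t)" for t
  have hd: "(h has_real_derivative 2 * b (exp_sum (exp_deriv (response K)) t) (exp_sum (response K) t)
      - \<delta>\<^sup>2 * exp (2 * t)) (at t)" for t
  proof -
    have "((\<lambda>t. \<delta>\<^sup>2 / 2 * exp (2 * t)) has_real_derivative \<delta>\<^sup>2 * exp (2 * t)) (at t)"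
      by (auto intro!: derivative_eq_intros)
    from DERIV_diff[OF B.ip_exp_sum_square_deriv[OF L(2)] this] show ?thesis
      by (simp add: h_def[abs_def] f_def)
  qed
  have neg: "2 * b (exp_sum (exp_deriv (response K)) t) (exp_sum (response K) t) - \<delta>\<^sup>2 * exp (2 * t) \<le> 0" if "t \<le> 0" for t
  proof -
    have "0 \<le> Z.nrm (exp_sum (datum K) t)" by (rule Z.nrm_nonneg[OF Z.exp_sum_mem[OF L(1)]])
    then have "(Z.nrm (exp_sum (datum K) t))\<^sup>2 \<le> (\<delta> * exp t)\<^sup>2" by (rule power_mono[OF d[OF that]])
    also have "\<dots> = \<delta>\<^sup>2 * exp (2 * t)" by (simp add: power_mult_distrib exp_double)
    finally have "k (exp_sum (datum K) t) (exp_sum (datum K) t) \<le> \<delta>\<^sup>2 * exp (2 * t)"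
      unfolding Z.nrm_sq[OF Z.exp_sum_mem[OF L(1)]] .
    then show ?thesis
      using energy_inequality[OF assms(1), of t] A.ip_nonneg[OF A.exp_sum_mem[OF L(2)], of t] by linarith
  qed
  have dec: "h 0 \<le> h t" if "t \<le> 0" for t
  proof (rule DERIV_nonpos_imp_nonincreasing[OF that])
    fix x assume "t \<le> x" "x \<le> 0"
    then show "\<exists>y. (h has_real_derivative y) (at x) \<and> y \<le> 0" using hd neg by blast
  qed
  obtain C where C: "0 \<le> C" "\<And>t. t \<le> 0 \<Longrightarrow> B.nrm (exp_sum (response K) t) \<le> C * exp t"
    using B.exp_sum_decay[OF L(2)] by blast
  have hle: "h 0 \<le> C\<^sup>2 * exp (2 * t)" if "t \<le> 0" for t
  proof -
    have "0 \<le> B.nrm (exp_sum (response K) t)" by (rule B.nrm_nonneg[OF B.exp_sum_mem[OF L(2)]])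
    then have "(B.nrm (exp_sum (response K) t))\<^sup>2 \<le> (C * exp t)\<^sup>2" by (rule power_mono[OF C(2)[OF that]])
    then have "f t \<le> C\<^sup>2 * exp (2 * t)"
      unfolding B.nrm_sq[OF B.exp_sum_mem[OF L(2)]] f_def by (simp add: power_mult_distrib exp_double)
    moreover have "0 \<le> \<delta>\<^sup>2 / 2 * exp (2 * t)" by simp
    ultimately show ?thesis using dec[OF that] unfolding h_def[of t] by linarith
  qed
  \<comment> \<open>The function \<open>h\<close> is decreasing and tends to 0 at \<open>-\<infinity>\<close>, so \<open>h 0 \<le> 0\<close>.\<close>
  have "((\<lambda>t. exp (2 * t)) \<longlongrightarrow> (0::real)) at_bot"
    by (rule filterlim_compose[OF exp_at_bot])
       (rule filterlim_tendsto_pos_mult_at_bot[OF tendsto_const _ filterlim_ident], simp)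
  then have "((\<lambda>t. C\<^sup>2 * exp (2 * t)) \<longlongrightarrow> 0) at_bot" by (rule tendsto_mult_right_zero)
  then have "h 0 \<le> 0"
  proof (rule tendsto_lowerbound)
    show "\<forall>\<^sub>F t in at_bot. h 0 \<le> C\<^sup>2 * exp (2 * t)"
      using hle by (auto simp: eventually_at_bot_linorder)
  qed simp
  then have "f 0 \<le> \<delta>\<^sup>2 / 2" by (simp add: h_def)
  moreover have "0 \<le> \<delta>\<^sup>2" by simp
  ultimately show ?thesis unfolding f_def by linarith
qed

lemma energy_estimate:
  assumes K: "modes K" and d: "\<And>t. t \<le> 0 \<Longrightarrow> Z.nrm (exp_sum (datum K) t) \<le> \<delta> * exp t"
    and \<eta>: "(LINT t|time_measure T. (Z.nrm (exp_sum (datum K) t))\<^sup>2) \<le> \<eta>"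
  shows "t \<in> {0..T} \<Longrightarrow> b (exp_sum (response K) t) (exp_sum (response K) t) \<le> \<delta>\<^sup>2 + \<eta>"
    and "0 \<le> T \<Longrightarrow> (LINT t|time_measure T. a (exp_sum (response K) t) (exp_sum (response K) t)) \<le> \<delta>\<^sup>2 + \<eta>"
proof -
  note L = exp_list_modes[OF K]
  let ?u = "exp_sum (response K)" and ?P = "exp_sum (datum K)" and ?u' = "exp_sum (exp_deriv (response K))"
  have ca: "continuous_on S (\<lambda>t. a (?u t) (?u t))" for S by (rule A.ip_exp_sum_exp_sum_continuous[OF L(2) L(2)])
  have ck: "continuous_on S (\<lambda>t. k (?P t) (?P t))" for S by (rule Z.ip_exp_sum_exp_sum_continuous[OF L(1) L(1)])
  have kk: "(Z.nrm (?P t))\<^sup>2 = k (?P t) (?P t)" for t by (rule Z.nrm_sq[OF Z.exp_sum_mem[OF L(1)]])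
  have kpos: "0 \<le> k (?P t) (?P t)" for t by (rule Z.ip_nonneg[OF Z.exp_sum_mem[OF L(1)]])
  have apos: "0 \<le> a (?u t) (?u t)" for t by (rule A.ip_nonneg[OF A.exp_sum_mem[OF L(2)]])
  have bpos: "0 \<le> b (?u t) (?u t)" for t by (rule B.ip_nonneg[OF B.exp_sum_mem[OF L(2)]])
  have \<eta>': "integral {0..T} (\<lambda>t. k (?P t) (?P t)) \<le> \<eta>"
    using \<eta> unfolding kk LINT_time_eq_integral[OF ck] .
  have main: "b (?u t) (?u t) + integral {0..t} (\<lambda>t. a (?u t) (?u t)) \<le> \<delta>\<^sup>2 + \<eta>" if t: "t \<in> {0..T}" for t
  proof -
    have ftc: "((\<lambda>t. 2 * b (?u' t) (?u t)) has_integral (b (?u t) (?u t) - b (?u 0) (?u 0))) {0..t}"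
    proof (rule fundamental_theorem_of_calculus)
      fix x assume "x \<in> {0..t}"
      show "((\<lambda>t. b (?u t) (?u t)) has_vector_derivative 2 * b (?u' x) (?u x)) (at x within {0..t})"
        unfolding has_real_derivative_iff_has_vector_derivative[symmetric]
        by (rule has_field_derivative_at_within[OF B.ip_exp_sum_square_deriv[OF L(2)]])
    qed (use t in simp)
    have "(\<lambda>t. k (?P t) (?P t) - a (?u t) (?u t)) integrable_on {0..t}"
      by (intro integrable_continuous_real continuous_on_diff ca ck)
    from integrable_integral[OF this]
    have "b (?u t) (?u t) - b (?u 0) (?u 0) \<le> integral {0..t} (\<lambda>t. k (?P t) (?P t) - a (?u t) (?u t))"
      by (rule has_integral_le[OF ftc]) (rule energy_inequality[OF K])
    also have "\<dots> = integral {0..t} (\<lambda>t. k (?P t) (?P t)) - integral {0..t} (\<lambda>t. a (?u t) (?u t))"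
      by (intro Henstock_Kurzweil_Integration.integral_diff integrable_continuous_real ca ck)
    also have "integral {0..t} (\<lambda>t. k (?P t) (?P t)) \<le> integral {0..T} (\<lambda>t. k (?P t) (?P t))"
      by (rule integral_subset_le) (use t kpos in \<open>auto intro!: integrable_continuous_real ck\<close>)
    finally show ?thesis using energy_at_zero[OF K d] \<eta>' by linarith
  qed
  show "b (?u t) (?u t) \<le> \<delta>\<^sup>2 + \<eta>" if t: "t \<in> {0..T}"
  proof -
    have "0 \<le> integral {0..t} (\<lambda>t. a (?u t) (?u t))"
      by (intro integral_nonneg integrable_continuous_real ca apos)
    then show ?thesis using main[OF t] by linarith
  qed
  show "(LINT t|time_measure T. a (?u t) (?u t)) \<le> \<delta>\<^sup>2 + \<eta>" if "0 \<le> T"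
    unfolding LINT_time_eq_integral[OF ca] using main[of T] bpos[of T] that by simp
qed

end

section \<open>Existence for the abstract equation\<close>

lemma test_function_facts:
  assumes "test_function T \<phi>" "0 < T"
  shows "(\<phi> has_real_derivative deriv \<phi> t) (at t)" "continuous_on S \<phi>" "continuous_on S (deriv \<phi>)"
    "\<phi> 0 = 0" "\<phi> T = 0"
proof -
  have d: "(deriv ^^ n) \<phi> differentiable_on UNIV" for n
    using assms(1) by (simp add: test_function_def)
  have cl: "closure {t. \<phi> t \<noteq> 0} \<subseteq> {0<..<T}"
    using assms(1) by (simp add: test_function_def)
  have d0: "\<phi> differentiable_on UNIV" and d1: "deriv \<phi> differentiable_on UNIV"
    using d[of 0] d[of 1] by simp_all
  have "\<exists>D. (\<phi> has_real_derivative D) (at t)"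
    using d0 by (simp add: differentiable_on_def real_differentiable_def)
  then obtain D where "(\<phi> has_real_derivative D) (at t)" by blast
  then show "(\<phi> has_real_derivative deriv \<phi> t) (at t)" using DERIV_imp_deriv by blast
  show "continuous_on S \<phi>" "continuous_on S (deriv \<phi>)"
    by (rule continuous_on_subset[OF differentiable_imp_continuous_on[OF d0] subset_UNIV],
        rule continuous_on_subset[OF differentiable_imp_continuous_on[OF d1] subset_UNIV])
  have z: "\<phi> t = 0" if "t \<notin> {0<..<T}" for t
    using that cl closure_subset[of "{t. \<phi> t \<noteq> 0}"] by blast
  show "\<phi> 0 = 0" "\<phi> T = 0" by (rule z, simp)+
qed

context degenerate_parabolic
begin

definition solves :: "real \<Rightarrow> (real \<Rightarrow> 'i \<Rightarrow> real) \<Rightarrow> (real \<Rightarrow> 'i \<Rightarrow> real) \<Rightarrow> bool" where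
  "solves T z u \<longleftrightarrow>
     u \<in> bochner_L2 (time_measure T) V V.nrm \<and>
     (\<lambda>t. b (u t)) \<in> bochner_L2 (time_measure T) (dual_space V V.nrm) (dual_norm V V.nrm) \<and>
     (\<exists>u'. u' \<in> bochner_L2 (time_measure T) (dual_space V V.nrm) (dual_norm V V.nrm) \<and>
        has_weak_time_derivative T V (\<lambda>t. b (u t)) u' \<and>
        (\<forall>v\<in>V. AE t in time_measure T. u' t v + a (u t) v = k (z t) v)) \<and>
     (\<exists>U. continuous_into {0..T} H H.nrm U \<and>
        (AE t in time_measure T. H.nrm (\<lambda>i. U t i - u t i) = 0) \<and> H.nrm (U 0) = 0)"

lemma response_estimate:
  assumes K: "modes K" and T: "0 < T" and d: "\<And>t. t \<le> 0 \<Longrightarrow> Z.nrm (exp_sum (datum K) t) \<le> \<delta> * exp t"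
    and \<eta>: "(LINT t|time_measure T. (Z.nrm (exp_sum (datum K) t))\<^sup>2) \<le> \<eta>"
  shows "(LINT t|time_measure T. (V.nrm (exp_sum (response K) t))\<^sup>2) \<le> (1 + 1 / c) * ((1 + T) * (\<delta>\<^sup>2 + \<eta>))"
proof -
  note L = exp_list_modes[OF K]
  let ?u = "exp_sum (response K)" and ?M = "time_measure T"
  have ia: "integrable ?M (\<lambda>t. a (?u t) (?u t))" and ib: "integrable ?M (\<lambda>t. b (?u t) (?u t))"
    and iv: "integrable ?M (\<lambda>t. ipV (?u t) (?u t))"
    by (intro continuous_integrable_time A.ip_exp_sum_exp_sum_continuous[OF L(2) L(2)]
        B.ip_exp_sum_exp_sum_continuous[OF L(2) L(2)] V.ip_exp_sum_exp_sum_continuous[OF L(2) L(2)])+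
  have "(LINT t|?M. b (?u t) (?u t)) \<le> (LINT t|?M. \<delta>\<^sup>2 + \<eta>)"
  proof (rule integral_mono[OF ib finite_measure.integrable_const[OF finite_time_measure]])
    fix t assume "t \<in> space ?M"
    then show "b (?u t) (?u t) \<le> \<delta>\<^sup>2 + \<eta>" by (intro energy_estimate(1)[OF K d \<eta>]) simp_all
  qed
  also have "\<dots> = T * (\<delta>\<^sup>2 + \<eta>)" using T by (simp add: measure_restrict_space)
  finally have "(LINT t|?M. a (?u t) (?u t)) + (LINT t|?M. b (?u t) (?u t)) \<le> (\<delta>\<^sup>2 + \<eta>) + T * (\<delta>\<^sup>2 + \<eta>)"
    using T by (intro add_mono energy_estimate(2)[OF K d \<eta>]) simp_all
  then have sum: "(LINT t|?M. a (?u t) (?u t)) + (LINT t|?M. b (?u t) (?u t)) \<le> (1 + T) * (\<delta>\<^sup>2 + \<eta>)"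
    by (simp add: distrib_right)
  have "(LINT t|?M. (V.nrm (?u t))\<^sup>2) = (LINT t|?M. ipV (?u t) (?u t))"
    by (simp only: V.nrm_sq[OF V.exp_sum_mem[OF L(2)]])
  also have "\<dots> \<le> (LINT t|?M. (1 + 1 / c) * (a (?u t) (?u t) + b (?u t) (?u t)))"
    by (intro integral_mono iv integrable_mult_right Bochner_Integration.integrable_add ia ib coercive V.exp_sum_mem[OF L(2)])
  also have "\<dots> = (1 + 1 / c) * ((LINT t|?M. a (?u t) (?u t)) + (LINT t|?M. b (?u t) (?u t)))"
    using ia ib by simp
  also have "\<dots> \<le> (1 + 1 / c) * ((1 + T) * (\<delta>\<^sup>2 + \<eta>))"
    using c by (intro mult_left_mono sum) simp
  finally show ?thesis .
qed

text \<open>The errors are squared norms; with this rate the norms of the increments are of order \<open>(1/4)^n\<close> and hence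
  summable.\<close>

definition approximates :: "real \<Rightarrow> (real \<Rightarrow> 'i \<Rightarrow> real) \<Rightarrow> (nat \<Rightarrow> (real \<times> ('i \<Rightarrow> real) \<times> ('i \<Rightarrow> real)) list) \<Rightarrow> bool" where
  "approximates T z K \<longleftrightarrow> (\<forall>n. modes (K n) \<and> (\<forall>t\<le>0. Z.nrm (exp_sum (datum (K n)) t) \<le> (1/16)^n * exp t) \<and>
     (LINT t|time_measure T. (Z.nrm (\<lambda>i. z t i - exp_sum (datum (K n)) t i))\<^sup>2) \<le> (1/16)^n)"

lemma approximates_exist:
  assumes T: "0 < T" and z: "z \<in> bochner_L2 (time_measure T) Z Z.nrm"
  shows "\<exists>K. approximates T z K"
proof -
  have "\<exists>K. modes K \<and> (\<forall>t\<le>0. Z.nrm (exp_sum (datum K) t) \<le> (1/16)^n * exp t) \<and>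
     (LINT t|time_measure T. (Z.nrm (\<lambda>i. z t i - exp_sum (datum K) t i))\<^sup>2) \<le> (1/16)^n" for n :: nat
  proof -
    have "(0::real) < (1/16)^n" by simp
    from Z.exp_sums_dense[OF T z, unfolded Z.exp_approximable_def, rule_format, OF this]
    obtain L where L: "exp_list Z L" "\<forall>t\<le>0. Z.nrm (exp_sum L t) \<le> (1/16)^n * exp t"
      "(LINT t|time_measure T. (Z.nrm (\<lambda>i. z t i - exp_sum L t i))\<^sup>2) \<le> (1/16)^n" by blast
    obtain K where "modes K" "datum K = L" using modes_exist[OF L(1)] by blast
    then show ?thesis using L(2,3) by blast
  qed
  then have "\<forall>n. \<exists>K. modes K \<and> (\<forall>t\<le>0. Z.nrm (exp_sum (datum K) t) \<le> (1/16)^n * exp t) \<and>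
     (LINT t|time_measure T. (Z.nrm (\<lambda>i. z t i - exp_sum (datum K) t i))\<^sup>2) \<le> (1/16)^n" by blast
  from choice[OF this] show ?thesis unfolding approximates_def .
qed

context
  fixes T :: real and z :: "real \<Rightarrow> 'i \<Rightarrow> real" and K :: "nat \<Rightarrow> (real \<times> ('i \<Rightarrow> real) \<times> ('i \<Rightarrow> real)) list"
  assumes T: "0 < T" and z: "z \<in> bochner_L2 (time_measure T) Z Z.nrm" and K: "approximates T z K"
begin

abbreviation (input) "un n \<equiv> exp_sum (response (K n))"
abbreviation (input) "Pn n \<equiv> exp_sum (datum (K n))"
abbreviation (input) "C0 \<equiv> (1 + 1 / c) * ((1 + T) * 8)"

lemma approximating_modes: "modes (K n)" "t \<le> 0 \<Longrightarrow> Z.nrm (Pn n t) \<le> (1/16)^n * exp t"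
  "(LINT t|time_measure T. (Z.nrm (\<lambda>i. z t i - Pn n t i))\<^sup>2) \<le> (1/16)^n"
  using K unfolding approximates_def by blast+

lemma response_exp_list: "exp_list V (response (K n))" and datum_exp_list: "exp_list Z (datum (K n))"
  by (rule exp_list_modes[OF approximating_modes(1)])+

lemma datum_bochner_L2: "Pn n \<in> bochner_L2 (time_measure T) Z Z.nrm"
  by (rule Z.exp_sum_bochner_L2[OF datum_exp_list T])

lemma response_bochner_L2: "un n \<in> bochner_L2 (time_measure T) V V.nrm"
  by (rule V.exp_sum_bochner_L2[OF response_exp_list T])

lemma data_error: "(LINT t|time_measure T. (Z.nrm (\<lambda>i. Pn n t i - z t i))\<^sup>2) \<le> (1/16)^n"
proof -
  have "(LINT t|time_measure T. (Z.nrm (\<lambda>i. Pn n t i - z t i))\<^sup>2) = (LINT t|time_measure T. (Z.nrm (\<lambda>i. z t i - Pn n t i))\<^sup>2)"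
  proof (rule integral_cong_AE)
    show "AE t in time_measure T. (Z.nrm (\<lambda>i. Pn n t i - z t i))\<^sup>2 = (Z.nrm (\<lambda>i. z t i - Pn n t i))\<^sup>2"
      using Z.bochner_L2_AE_mem[OF z]
    proof eventually_elim
      fix t assume "z t \<in> Z"
      from Z.nrm_diff_commute[OF Z.exp_sum_mem[OF datum_exp_list] this, of n t]
      show "(Z.nrm (\<lambda>i. Pn n t i - z t i))\<^sup>2 = (Z.nrm (\<lambda>i. z t i - Pn n t i))\<^sup>2" by (rule arg_cong)
    qed
    show "(\<lambda>t. (Z.nrm (\<lambda>i. Pn n t i - z t i))\<^sup>2) \<in> borel_measurable (time_measure T)"
      "(\<lambda>t. (Z.nrm (\<lambda>i. z t i - Pn n t i))\<^sup>2) \<in> borel_measurable (time_measure T)"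
      using Z.bochner_L2_diff[OF complete_time_measure z datum_bochner_L2] Z.bochner_L2_diff[OF complete_time_measure datum_bochner_L2 z]
      unfolding Z.bochner_L2_iff by (intro borel_measurable_integrable, blast)+
  qed
  then show ?thesis using approximating_modes(3)[of n] by simp
qed

text \<open>The difference of two responses is the response to the difference of the data, so the energy
  estimate applies to it. The constant collects \<open>\<delta> = 2 * (1/16)^n\<close> and \<open>\<eta> = 4 * (1/16)^n\<close>, for which
  \<open>\<delta>\<^sup>2 + \<eta> \<le> 8 * (1/16)^n\<close>.\<close>

lemma differences_small:
  assumes "n \<le> m"
  shows "t \<in> {0..T} \<Longrightarrow> H.nrm (\<lambda>i. un n t i - un m t i) \<le> 3 * (1/4)^n"
    and "L2_norm (time_measure T) (\<lambda>t. V.nrm (\<lambda>i. un n t i - un m t i)) \<le> sqrt C0 * (1/4)^n"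
proof -
  let ?K = "K n @ negate (K m)" and ?\<epsilon> = "(1/16::real)^n"
  have K: "modes ?K" using approximating_modes(1) modes_negate[OF approximating_modes(1)] by (simp add: modes_append)
  have em: "(1/16::real)^m \<le> ?\<epsilon>" using assms by (intro power_decreasing) simp_all
  have d: "Z.nrm (exp_sum (datum ?K) t) \<le> (2 * ?\<epsilon>) * exp t" if "t \<le> 0" for t
  proof -
    have "Z.nrm (exp_sum (datum ?K) t) \<le> Z.nrm (Pn n t) + Z.nrm (Pn m t)"
      unfolding exp_sum_difference by (intro Z.nrm_diff Z.exp_sum_mem datum_exp_list)
    also have "\<dots> \<le> ?\<epsilon> * exp t + (1/16)^m * exp t" by (intro add_mono approximating_modes that)
    also have "\<dots> \<le> ?\<epsilon> * exp t + ?\<epsilon> * exp t" using em by (intro add_left_mono mult_right_mono) simp_all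
    finally show ?thesis by (simp add: mult_ac)
  qed
  have \<eta>: "(LINT t|time_measure T. (Z.nrm (exp_sum (datum ?K) t))\<^sup>2) \<le> 4 * ?\<epsilon>"
  proof -
    note zP = Z.bochner_L2_diff[OF complete_time_measure z datum_bochner_L2]
    note Pz = Z.bochner_L2_diff[OF complete_time_measure datum_bochner_L2 z]
    have "(LINT t|time_measure T. (Z.nrm (exp_sum (datum ?K) t))\<^sup>2)
       = (LINT t|time_measure T. (Z.nrm (\<lambda>i. (Pn n t i - z t i) + (z t i - Pn m t i)))\<^sup>2)"
      by (simp add: exp_sum_difference)
    also have "\<dots> \<le> 2 * (LINT t|time_measure T. (Z.nrm (\<lambda>i. Pn n t i - z t i))\<^sup>2)
         + 2 * (LINT t|time_measure T. (Z.nrm (\<lambda>i. z t i - Pn m t i))\<^sup>2)"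
      by (rule Z.bochner_L2_sq_add_le[OF complete_time_measure Pz zP])
    also have "(LINT t|time_measure T. (Z.nrm (\<lambda>i. Pn n t i - z t i))\<^sup>2) \<le> ?\<epsilon>" by (rule data_error)
    also have "(LINT t|time_measure T. (Z.nrm (\<lambda>i. z t i - Pn m t i))\<^sup>2) \<le> ?\<epsilon>" by (rule order_trans[OF approximating_modes(3) em])
    finally show ?thesis by simp
  qed
  have e2: "(2 * ?\<epsilon>)\<^sup>2 + 4 * ?\<epsilon> \<le> 8 * ?\<epsilon>"
  proof -
    have "?\<epsilon> * ?\<epsilon> \<le> ?\<epsilon> * 1" by (intro mult_left_mono power_le_one) simp_all
    then show ?thesis by (simp add: power2_eq_square)
  qed
  have q: "((1/4::real)^n)\<^sup>2 = ?\<epsilon>" by (simp add: power2_eq_square power_mult_distrib[symmetric])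
  show "H.nrm (\<lambda>i. un n t i - un m t i) \<le> 3 * (1/4)^n" if "t \<in> {0..T}"
  proof (rule real_le_lsqrt)
    have "b (\<lambda>i. un n t i - un m t i) (\<lambda>i. un n t i - un m t i) \<le> 8 * ?\<epsilon>"
      using energy_estimate(1)[OF K d \<eta> that] e2 unfolding exp_sum_difference by linarith
    also have "\<dots> \<le> (3 * (1/4)^n)\<^sup>2" unfolding power_mult_distrib q by simp
    finally show "b (\<lambda>i. un n t i - un m t i) (\<lambda>i. un n t i - un m t i) \<le> (3 * (1/4)^n)\<^sup>2" .
  qed simp
  show "L2_norm (time_measure T) (\<lambda>t. V.nrm (\<lambda>i. un n t i - un m t i)) \<le> sqrt C0 * (1/4)^n"
    unfolding L2_norm_def
  proof (rule real_le_lsqrt)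
    have "(LINT t|time_measure T. (V.nrm (\<lambda>i. un n t i - un m t i))\<^sup>2)
        \<le> (1 + 1 / c) * ((1 + T) * ((2 * ?\<epsilon>)\<^sup>2 + 4 * ?\<epsilon>))"
      using response_estimate[OF K T d \<eta>] unfolding exp_sum_difference .
    also have "\<dots> \<le> (1 + 1 / c) * ((1 + T) * (8 * ?\<epsilon>))"
      using c T by (intro mult_left_mono e2) simp_all
    also have "\<dots> = (sqrt C0 * (1/4)^n)\<^sup>2"
      using c T unfolding power_mult_distrib q by simp
    finally show "(LINT t|time_measure T. (V.nrm (\<lambda>i. un n t i - un m t i))\<^sup>2) \<le> (sqrt C0 * (1/4)^n)\<^sup>2" .
  qed (use c T in simp)
qed

text \<open>The increments are summable in \<open>L\<^sup>1(0,T;V)\<close>, hence summable in \<open>V\<close> for almost every time, and completeness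
  of \<open>V\<close> gives a limit pointwise in time.\<close>

lemma limit_in_V:
  "\<exists>u. u \<in> bochner_L2 (time_measure T) V V.nrm \<and>
     (AE t in time_measure T. u t \<in> V \<and> (\<lambda>n. V.nrm (\<lambda>i. un n t i - u t i)) \<longlonglongrightarrow> 0) \<and>
     (\<lambda>n. L2_norm (time_measure T) (\<lambda>t. V.nrm (\<lambda>i. un n t i - u t i))) \<longlonglongrightarrow> 0"
proof -
  let ?M = "time_measure T"
  have dL2: "(\<lambda>t. V.nrm (\<lambda>i. un n t i - un m t i)) \<in> L2_space ?M" for n m
    by (rule V.nrm_L2_space[OF V.bochner_L2_diff[OF complete_time_measure response_bochner_L2 response_bochner_L2]])
  have C0: "0 \<le> C0" using c T by simp
  have AEs: "AE t in ?M. summable (\<lambda>n. V.nrm (\<lambda>i. un n t i - un (Suc n) t i))"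
  proof (rule AE_summable_of_integrals)
    show "integrable ?M (\<lambda>t. V.nrm (\<lambda>i. un n t i - un (Suc n) t i))" for n
      by (rule L2_space_integrable_time[OF dL2])
    show "0 \<le> V.nrm (\<lambda>i. un n t i - un (Suc n) t i)" for n t
      by (intro V.nrm_nonneg V.diff_mem V.exp_sum_mem response_exp_list)
    show "(LINT t|?M. V.nrm (\<lambda>i. un n t i - un (Suc n) t i)) \<le> sqrt T * (sqrt C0 * (1/4)^n)" for n
      by (rule order_trans[OF LINT_le_L2_norm[OF T dL2]])
         (intro mult_left_mono differences_small, use T in simp_all)
    show "summable (\<lambda>n. sqrt T * (sqrt C0 * (1/4)^n))"
      by (intro summable_mult summable_geometric) simp
  qed
  define u where "u t = (if \<exists>l\<in>V. (\<lambda>n. V.nrm (\<lambda>i. un n t i - l i)) \<longlonglongrightarrow> 0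
      then SOME l. l \<in> V \<and> (\<lambda>n. V.nrm (\<lambda>i. un n t i - l i)) \<longlonglongrightarrow> 0 else (\<lambda>i. 0))" for t
  have lim: "AE t in ?M. u t \<in> V \<and> (\<lambda>n. V.nrm (\<lambda>i. un n t i - u t i)) \<longlonglongrightarrow> 0"
    using AEs
  proof eventually_elim
    fix t assume s: "summable (\<lambda>n. V.nrm (\<lambda>i. un n t i - un (Suc n) t i))"
    have "V.nrm (\<lambda>i. un (Suc n) t i - un n t i) = V.nrm (\<lambda>i. un n t i - un (Suc n) t i)" for n
      by (rule V.nrm_diff_commute[OF V.exp_sum_mem[OF response_exp_list] V.exp_sum_mem[OF response_exp_list]])
    then have "summable (\<lambda>n. V.nrm (\<lambda>i. un (Suc n) t i - un n t i))" using s by (simp only:)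
    from V.summable_steps_converge[of "\<lambda>n. un n t", OF V_complete' V.exp_sum_mem[OF response_exp_list] this]
    have ex: "\<exists>l\<in>V. (\<lambda>n. V.nrm (\<lambda>i. un n t i - l i)) \<longlonglongrightarrow> 0" .
    then have "\<exists>l. l \<in> V \<and> (\<lambda>n. V.nrm (\<lambda>i. un n t i - l i)) \<longlonglongrightarrow> 0" by blast
    from someI_ex[OF this] show "u t \<in> V \<and> (\<lambda>n. V.nrm (\<lambda>i. un n t i - u t i)) \<longlonglongrightarrow> 0"
      unfolding u_def using ex by simp
  qed
  have bm: "bochner_measurable ?M V V.nrm u"
    by (rule V.bochner_measurable_exp_sum_limit[OF response_exp_list T lim])
  have bmn: "bochner_measurable ?M V V.nrm (\<lambda>t i. un n t i - u t i)" for n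
    using V.bochner_measurable_lin[of ?M "un n" u 1 "- 1"] response_bochner_L2[of n] bm by (simp add: V.bochner_L2_iff)
  have err: "(\<lambda>t. V.nrm (\<lambda>i. un n t i - u t i)) \<in> L2_space ?M"
    "L2_norm ?M (\<lambda>t. V.nrm (\<lambda>i. un n t i - u t i)) \<le> sqrt C0 * (1/4)^n" for n
  proof -
    have l: "AE t in ?M. (\<lambda>m. V.nrm (\<lambda>i. un n t i - un m t i)) \<longlonglongrightarrow> V.nrm (\<lambda>i. un n t i - u t i)"
      using lim
    proof eventually_elim
      fix t assume t: "u t \<in> V \<and> (\<lambda>n. V.nrm (\<lambda>i. un n t i - u t i)) \<longlonglongrightarrow> 0"
      note mem = V.exp_sum_mem[OF response_exp_list]
      have ut: "u t \<in> V" using t by blast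
      have e: "(\<lambda>i. (un n t i - un m t i) - (un n t i - u t i)) = (\<lambda>i. u t i - un m t i)" for m by simp
      show "(\<lambda>m. V.nrm (\<lambda>i. un n t i - un m t i)) \<longlonglongrightarrow> V.nrm (\<lambda>i. un n t i - u t i)"
      proof (rule V.nrm_tendsto[of "\<lambda>m i. un n t i - un m t i" "\<lambda>i. un n t i - u t i"])
        show "(\<lambda>m. V.nrm (\<lambda>i. (un n t i - un m t i) - (un n t i - u t i))) \<longlonglongrightarrow> 0"
          unfolding e V.nrm_diff_commute[OF ut mem] using t by blast
      qed (intro V.diff_mem mem ut)+
    qed
    have m: "(\<lambda>t. V.nrm (\<lambda>i. un n t i - u t i)) \<in> borel_measurable ?M"
      by (rule V.nrm_comp_measurable[OF complete_time_measure bmn])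
    have nn: "0 \<le> sqrt C0 * (1/4)^n" by (rule mult_nonneg_nonneg[OF real_sqrt_ge_zero[OF C0]]) simp
    show "(\<lambda>t. V.nrm (\<lambda>i. un n t i - u t i)) \<in> L2_space ?M"
      by (rule L2_space_Fatou(1)[OF dL2 differences_small(2) m l nn])
    show "L2_norm ?M (\<lambda>t. V.nrm (\<lambda>i. un n t i - u t i)) \<le> sqrt C0 * (1/4)^n"
      by (rule L2_space_Fatou(2)[OF dL2 differences_small(2) m l nn])
  qed
  have dB: "(\<lambda>t i. un n t i - u t i) \<in> bochner_L2 ?M V V.nrm" for n
    using bmn[of n] L2_spaceD(2)[OF err(1)[of n]] by (simp only: V.bochner_L2_iff simp_thms)
  have "u \<in> bochner_L2 ?M V V.nrm"
    using V.bochner_L2_diff[OF complete_time_measure response_bochner_L2[of 0] dB[of 0]] by simp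
  moreover have "(\<lambda>n. L2_norm ?M (\<lambda>t. V.nrm (\<lambda>i. un n t i - u t i))) \<longlonglongrightarrow> 0"
  proof (rule tendsto_sandwich[OF _ _ tendsto_const])
    show "\<forall>\<^sub>F n in sequentially. 0 \<le> L2_norm ?M (\<lambda>t. V.nrm (\<lambda>i. un n t i - u t i))"
      by (intro always_eventually allI L2_norm_nonneg)
    show "\<forall>\<^sub>F n in sequentially. L2_norm ?M (\<lambda>t. V.nrm (\<lambda>i. un n t i - u t i)) \<le> sqrt C0 * (1/4)^n"
      by (intro always_eventually allI err(2))
    show "(\<lambda>n. sqrt C0 * (1/4)^n) \<longlonglongrightarrow> 0" by (intro tendsto_mult_right_zero LIMSEQ_power_zero) simp
  qed
  ultimately show ?thesis using lim by blast
qed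

text \<open>A uniform limit of continuous functions. At time 0 the energy of the \<open>n\<close>-th response is at most
  the square of \<open>(1/16)^n\<close>.\<close>

lemma limit_in_H:
  "\<exists>U. continuous_into {0..T} H H.nrm U \<and> H.nrm (U 0) = 0 \<and>
     (\<forall>t\<in>{0..T}. (\<lambda>n. H.nrm (\<lambda>i. un n t i - U t i)) \<longlonglongrightarrow> 0)"
proof -
  have memV: "un n t \<in> V" for n t by (rule V.exp_sum_mem[OF response_exp_list])
  note mem = V_in_H[OF memV]
  have "\<exists>l\<in>H. (\<lambda>n. H.nrm (\<lambda>i. un n t i - l i)) \<longlonglongrightarrow> 0" if t: "t \<in> {0..T}" for t
  proof (rule H.summable_steps_converge[of "\<lambda>n. un n t", OF H_complete mem])
    show "summable (\<lambda>n. H.nrm (\<lambda>i. un (Suc n) t i - un n t i))"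
    proof (rule summable_comparison_test'[where g="\<lambda>n. 3 * (1/4)^n" and N=0])
      show "norm (H.nrm (\<lambda>i. un (Suc n) t i - un n t i)) \<le> 3 * (1/4)^n" for n
        unfolding H.nrm_diff_commute[OF mem[of "Suc n"] mem[of n]]
        using differences_small(1)[of n "Suc n", OF _ t] H.nrm_nonneg[OF H.diff_mem[OF mem[of n t] mem[of "Suc n" t]]] by simp
    qed (intro summable_mult summable_geometric, simp)
  qed
  then have "\<forall>t\<in>{0..T}. \<exists>l. l \<in> H \<and> (\<lambda>n. H.nrm (\<lambda>i. un n t i - l i)) \<longlonglongrightarrow> 0" by blast
  from bchoice[OF this] obtain U where U: "\<And>t. t \<in> {0..T} \<Longrightarrow> U t \<in> H"
    "\<And>t. t \<in> {0..T} \<Longrightarrow> (\<lambda>n. H.nrm (\<lambda>i. un n t i - U t i)) \<longlonglongrightarrow> 0" by blast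
  have unif: "H.nrm (\<lambda>i. un n t i - U t i) \<le> 3 * (1/4)^n" if t: "t \<in> {0..T}" for n t
  proof -
    have e: "(\<lambda>i. (un n t i - un m t i) - (un n t i - U t i)) = (\<lambda>i. U t i - un m t i)" for m by simp
    have "(\<lambda>m. H.nrm (\<lambda>i. un n t i - un m t i)) \<longlonglongrightarrow> H.nrm (\<lambda>i. un n t i - U t i)"
    proof (rule H.nrm_tendsto[of "\<lambda>m i. un n t i - un m t i" "\<lambda>i. un n t i - U t i"])
      show "(\<lambda>m. H.nrm (\<lambda>i. (un n t i - un m t i) - (un n t i - U t i))) \<longlonglongrightarrow> 0"
        unfolding e H.nrm_diff_commute[OF U(1)[OF t] mem] by (rule U(2)[OF t])
    qed (intro H.diff_mem mem U(1)[OF t])+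
    then show ?thesis
      by (rule LIMSEQ_le_const2) (intro exI[of _ n] allI impI differences_small(1) t)
  qed
  have cont: "((\<lambda>r. H.nrm (\<lambda>i. U r i - U t i)) \<longlongrightarrow> 0) (at t within {0..T})" if t: "t \<in> {0..T}" for t
    unfolding tendsto_iff
  proof (intro allI impI)
    fix \<epsilon> :: real assume \<epsilon>: "0 < \<epsilon>"
    have "(\<lambda>n. 6 * (1/4::real)^n) \<longlonglongrightarrow> 0" by (intro tendsto_mult_right_zero LIMSEQ_power_zero) simp
    from order_tendstoD(2)[OF this, of "\<epsilon>/2"] \<epsilon> obtain n where n: "6 * (1/4::real)^n < \<epsilon>/2"
      by (auto simp: eventually_sequentially)
    obtain C where C: "0 \<le> C" "\<And>t r. t \<le> T \<Longrightarrow> r \<le> T \<Longrightarrow> B.nrm (\<lambda>i. un n t i - un n r i) \<le> C * \<bar>t - r\<bar>"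
      using B.exp_sum_Lipschitz[OF response_exp_list[of n], of T] by blast
    have "\<forall>\<^sub>F r in at t within {0..T}. dist r t < \<epsilon> / (2 * (C + 1)) \<and> r \<in> {0..T}"
      unfolding eventually_at using \<epsilon> C(1) by (intro exI[of _ "\<epsilon> / (2 * (C + 1))"]) simp
    then show "\<forall>\<^sub>F r in at t within {0..T}. dist (H.nrm (\<lambda>i. U r i - U t i)) 0 < \<epsilon>"
    proof eventually_elim
      fix r assume r: "dist r t < \<epsilon> / (2 * (C + 1)) \<and> r \<in> {0..T}"
      then have rT: "r \<in> {0..T}" by blast
      have "H.nrm (\<lambda>i. U r i - U t i) \<le> H.nrm (\<lambda>i. U r i - un n r i) + H.nrm (\<lambda>i. un n r i - U t i)"
        by (intro H.nrm_diff_triangle U mem rT t)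
      also have "H.nrm (\<lambda>i. un n r i - U t i) \<le> H.nrm (\<lambda>i. un n r i - un n t i) + H.nrm (\<lambda>i. un n t i - U t i)"
        by (intro H.nrm_diff_triangle U mem rT t)
      also have "H.nrm (\<lambda>i. U r i - un n r i) \<le> 3 * (1/4)^n"
        unfolding H.nrm_diff_commute[OF U(1)[OF rT] mem] by (rule unif[OF rT])
      also have "H.nrm (\<lambda>i. un n t i - U t i) \<le> 3 * (1/4)^n" by (rule unif[OF t])
      also have "H.nrm (\<lambda>i. un n r i - un n t i) \<le> C * \<bar>r - t\<bar>" using rT t by (intro C(2)) simp_all
      finally have 1: "H.nrm (\<lambda>i. U r i - U t i) \<le> 6 * (1/4)^n + C * \<bar>r - t\<bar>" by simp
      have "C * \<bar>r - t\<bar> \<le> (C + 1) * \<bar>r - t\<bar>" by (intro mult_right_mono) simp_all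
      also have "\<dots> < (C + 1) * (\<epsilon> / (2 * (C + 1)))"
        using r C(1) by (intro mult_strict_left_mono) (simp_all add: dist_real_def)
      also have "\<dots> = \<epsilon>/2"
      proof -
        have "D * (\<epsilon> / (2 * D)) = \<epsilon>/2" if "0 < D" for D :: real using that by simp
        then show ?thesis using C(1) by (meson add_nonneg_pos zero_less_one)
      qed
      finally have "H.nrm (\<lambda>i. U r i - U t i) < \<epsilon>" using 1 n by linarith
      then show "dist (H.nrm (\<lambda>i. U r i - U t i)) 0 < \<epsilon>"
        using H.nrm_nonneg[OF H.diff_mem[OF U(1)[OF rT] U(1)[OF t]]] by (simp add: dist_real_def)
    qed
  qed
  have T0: "0 \<in> {0..T}" using T by simp
  have "(\<lambda>n. H.nrm (un n 0)) \<longlonglongrightarrow> H.nrm (U 0)" by (rule H.nrm_tendsto[OF mem U(1)[OF T0] U(2)[OF T0]])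
  moreover have "(\<lambda>n. H.nrm (un n 0)) \<longlonglongrightarrow> 0"
  proof (rule tendsto_sandwich[OF _ _ tendsto_const])
    show "\<forall>\<^sub>F n in sequentially. 0 \<le> H.nrm (un n 0)" by (intro always_eventually allI H.nrm_nonneg mem)
    show "\<forall>\<^sub>F n in sequentially. H.nrm (un n 0) \<le> (1/16)^n"
    proof (intro always_eventually allI real_le_lsqrt)
      show "b (un n 0) (un n 0) \<le> ((1/16)^n)\<^sup>2" for n by (rule energy_at_zero[OF approximating_modes(1,2)])
    qed simp
    show "(\<lambda>n. (1/16::real)^n) \<longlonglongrightarrow> 0" by (intro LIMSEQ_power_zero) simp
  qed
  ultimately have "H.nrm (U 0) = 0" by (rule LIMSEQ_unique)
  then show ?thesis unfolding continuous_into_def using U cont by blast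
qed

text \<open>The responses satisfy the equation classically, and \<open>\<phi>\<close> vanishes at both ends.\<close>

lemma response_weak_form:
  assumes \<phi>: "test_function T \<phi>" and v: "v \<in> V"
  shows "(LINT t|time_measure T. deriv \<phi> t * b (un n t) v)
     = - (LINT t|time_measure T. \<phi> t * k (Pn n t) v) + (LINT t|time_measure T. \<phi> t * a (un n t) v)"
proof -
  note tf = test_function_facts[OF \<phi> T]
  note cb = B.ip_exp_sum_continuous[OF response_exp_list v] and ca = A.ip_exp_sum_continuous[OF response_exp_list v]
    and ck = Z.ip_exp_sum_continuous[OF datum_exp_list V_in_Z[OF v]]
  have e: "b (exp_sum (exp_deriv (response (K n))) t) v = k (Pn n t) v - a (un n t) v" for t
    using modes_equation[OF approximating_modes(1) v, of n t] by linarith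
  have "((\<lambda>t. deriv \<phi> t * b (un n t) v + (k (Pn n t) v - a (un n t) v) * \<phi> t) has_integral
      (\<phi> T * b (un n T) v - \<phi> 0 * b (un n 0) v)) {0..T}"
  proof (rule fundamental_theorem_of_calculus)
    fix t
    from DERIV_mult[OF tf(1)[of t] B.ip_exp_sum_deriv[OF response_exp_list[of n] v, of t]]
    show "((\<lambda>t. \<phi> t * b (un n t) v) has_vector_derivative (deriv \<phi> t * b (un n t) v + (k (Pn n t) v - a (un n t) v) * \<phi> t)) (at t within {0..T})"
      unfolding e has_real_derivative_iff_has_vector_derivative[symmetric] by (rule has_field_derivative_at_within)
  qed (use T in simp)
  then have "integral {0..T} (\<lambda>t. deriv \<phi> t * b (un n t) v + (k (Pn n t) v - a (un n t) v) * \<phi> t) = 0"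
    unfolding tf(4,5) by (simp add: integral_unique)
  moreover have "continuous_on {0..T} (\<lambda>t. deriv \<phi> t * b (un n t) v + (k (Pn n t) v - a (un n t) v) * \<phi> t)"
    by (intro continuous_on_add continuous_on_mult continuous_on_diff tf cb ca ck)
  ultimately have 0: "(LINT t|time_measure T. deriv \<phi> t * b (un n t) v + (k (Pn n t) v - a (un n t) v) * \<phi> t) = 0"
    by (simp only: LINT_time_eq_integral)
  have i: "integrable (time_measure T) (\<lambda>t. deriv \<phi> t * b (un n t) v)" "integrable (time_measure T) (\<lambda>t. \<phi> t * k (Pn n t) v)"
     "integrable (time_measure T) (\<lambda>t. \<phi> t * a (un n t) v)"
    by (intro continuous_integrable_time continuous_on_mult tf cb ca ck)+
  have "(LINT t|time_measure T. deriv \<phi> t * b (un n t) v + (k (Pn n t) v - a (un n t) v) * \<phi> t)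
     = (LINT t|time_measure T. deriv \<phi> t * b (un n t) v + (\<phi> t * k (Pn n t) v - \<phi> t * a (un n t) v))"
    by (simp only: left_diff_distrib right_diff_distrib mult.commute[of _ "\<phi> _"])
  also have "\<dots> = (LINT t|time_measure T. deriv \<phi> t * b (un n t) v) + ((LINT t|time_measure T. \<phi> t * k (Pn n t) v)
      - (LINT t|time_measure T. \<phi> t * a (un n t) v))"
    using i by simp
  finally show ?thesis using 0 by linarith
qed

lemma dual_map:
  assumes f: "f \<in> bochner_L2 (time_measure T) X n" and X: "seminormed_space X n"
    and lin: "\<And>x. x \<in> X \<Longrightarrow> (\<forall>v\<in>V. \<forall>w\<in>V. \<forall>r s. \<beta> x (\<lambda>i. r * v i + s * w i) = r * \<beta> x v + s * \<beta> x w)"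
    and diff: "\<And>x y v. x \<in> X \<Longrightarrow> y \<in> X \<Longrightarrow> v \<in> V \<Longrightarrow> \<beta> x v - \<beta> y v = \<beta> (\<lambda>i. x i - y i) v"
    and bd: "\<And>x v. x \<in> X \<Longrightarrow> v \<in> V \<Longrightarrow> \<bar>\<beta> x v\<bar> \<le> C * n x * V.nrm v" and C: "0 \<le> C"
  shows "(\<lambda>t. \<beta> (f t)) \<in> bochner_L2 (time_measure T) (dual_space V V.nrm) (dual_norm V V.nrm)"
proof (rule bochner_L2_map[OF X V.dual_seminormed complete_time_measure f, where C=C])
  interpret X: seminormed_space X n by fact
  show "\<beta> x \<in> dual_space V V.nrm" if "x \<in> X" for x
    unfolding dual_space_def using lin[OF that] bd[OF that] by blast
  show "dual_norm V V.nrm (\<beta> x) \<le> C * n x" if "x \<in> X" for x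
    by (rule V.dual_norm_le) (use bd[OF that] C X.nrm_nonneg[OF that] in simp_all)
  show "dual_norm V V.nrm (\<lambda>v. \<beta> x v - \<beta> y v) \<le> C * n (\<lambda>i. x i - y i)" if "x \<in> X" "y \<in> X" for x y
    by (rule V.dual_norm_le)
       (use bd[OF X.diff_mem[OF that]] diff[OF that] C X.nrm_nonneg[OF X.diff_mem[OF that]] in simp_all)
qed

text \<open>The derivative is defined by the equation, as \<open>v \<mapsto> k (z t) v - a (u t) v\<close>. What has to be proved is that it is
  the weak derivative, and this passes to the limit from the responses.\<close>

lemma limit_solves: "\<exists>u. solves T z u"
proof -
  let ?M = "time_measure T"
  obtain u where u: "u \<in> bochner_L2 ?M V V.nrm"
    "AE t in ?M. u t \<in> V \<and> (\<lambda>n. V.nrm (\<lambda>i. un n t i - u t i)) \<longlonglongrightarrow> 0"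
    "(\<lambda>n. L2_norm ?M (\<lambda>t. V.nrm (\<lambda>i. un n t i - u t i))) \<longlonglongrightarrow> 0" using limit_in_V by blast
  obtain U where U: "continuous_into {0..T} H H.nrm U" "H.nrm (U 0) = 0"
     "\<And>t. t \<in> {0..T} \<Longrightarrow> (\<lambda>n. H.nrm (\<lambda>i. un n t i - U t i)) \<longlonglongrightarrow> 0" using limit_in_H by blast
  have UH: "U t \<in> H" if "t \<in> {0..T}" for t using U(1) that unfolding continuous_into_def by blast
  have Uu: "AE t in ?M. H.nrm (\<lambda>i. U t i - u t i) = 0"
    using u(2) AE_space
  proof eventually_elim
    fix t assume t: "u t \<in> V \<and> (\<lambda>n. V.nrm (\<lambda>i. un n t i - u t i)) \<longlonglongrightarrow> 0" and "t \<in> space ?M"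
    then have tT: "t \<in> {0..T}" by simp
    have mV: "un n t \<in> V" for n by (rule V.exp_sum_mem[OF response_exp_list])
    have uV: "u t \<in> V" using t by blast
    have l: "(\<lambda>n. H.nrm (\<lambda>i. un n t i - U t i) + V.nrm (\<lambda>i. un n t i - u t i)) \<longlonglongrightarrow> 0 + 0"
      using t by (intro tendsto_add U(3)[OF tT]) blast
    have m: "H.nrm (\<lambda>i. U t i - u t i) \<le> H.nrm (\<lambda>i. un n t i - U t i) + V.nrm (\<lambda>i. un n t i - u t i)" for n
    proof -
      have "H.nrm (\<lambda>i. U t i - u t i) \<le> H.nrm (\<lambda>i. U t i - un n t i) + H.nrm (\<lambda>i. un n t i - u t i)"
        by (intro H.nrm_diff_triangle UH tT V_in_H mV uV)
      also have "H.nrm (\<lambda>i. U t i - un n t i) = H.nrm (\<lambda>i. un n t i - U t i)"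
        by (rule H.nrm_diff_commute[OF UH[OF tT] V_in_H[OF mV]])
      also have "H.nrm (\<lambda>i. un n t i - u t i) \<le> V.nrm (\<lambda>i. un n t i - u t i)"
        by (rule nrm_le_V(1)[OF V.diff_mem[OF mV uV]])
      finally show ?thesis by simp
    qed
    have "H.nrm (\<lambda>i. U t i - u t i) \<le> 0 + 0"
      by (rule LIMSEQ_le_const[OF l]) (intro exI[of _ 0] allI impI m)
    then show "H.nrm (\<lambda>i. U t i - u t i) = 0"
      using H.nrm_nonneg[OF H.diff_mem[OF UH[OF tT] V_in_H[OF uV]]] by linarith
  qed
  define u' where "u' t v = 1 * k (z t) v + (- 1) * a (u t) v" for t v
  have bu: "(\<lambda>t. b (u t)) \<in> bochner_L2 ?M (dual_space V V.nrm) (dual_norm V V.nrm)"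
    by (rule dual_map[OF u(1) V.seminormed_space_axioms, where C=1])
       (simp_all add: B.ip_lin_right B.ip_diff_left b_bounded)
  have au: "(\<lambda>t. a (u t)) \<in> bochner_L2 ?M (dual_space V V.nrm) (dual_norm V V.nrm)"
    by (rule dual_map[OF u(1) V.seminormed_space_axioms, where C="c + 1"])
       (use c in \<open>simp_all add: A.ip_lin_right A.ip_diff_left a_bounded\<close>)
  have kz: "(\<lambda>t. k (z t)) \<in> bochner_L2 ?M (dual_space V V.nrm) (dual_norm V V.nrm)"
    by (rule dual_map[OF z Z.seminormed_space_axioms, where C=1])
       (simp_all add: Z.ip_lin_right Z.ip_diff_left V_in_Z k_bounded)
  have u'L: "u' \<in> bochner_L2 ?M (dual_space V V.nrm) (dual_norm V V.nrm)"
    unfolding u'_def[abs_def]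
    by (rule seminormed_space.bochner_L2_lin[OF V.dual_seminormed complete_time_measure kz au])
  have weak: "has_weak_time_derivative T V (\<lambda>t. b (u t)) u'"
    unfolding has_weak_time_derivative_def
  proof (intro allI impI ballI)
    fix \<phi> v assume \<phi>: "test_function T \<phi>" and v: "v \<in> V"
    note tf = test_function_facts[OF \<phi> T]
    have bl: "\<bar>b x v - b y v\<bar> \<le> V.nrm v * V.nrm (\<lambda>i. x i - y i)" if "x \<in> V" "y \<in> V" for x y
      unfolding B.ip_diff_left[OF that v, symmetric]
      using b_bounded[OF V.diff_mem[OF that] v] by (simp only: mult.commute)
    have bl': "\<bar>b x v\<bar> \<le> V.nrm v * V.nrm x" if "x \<in> V" for x
      using b_bounded[OF that v] by (simp only: mult.commute)
    have al: "\<bar>a x v - a y v\<bar> \<le> ((c + 1) * V.nrm v) * V.nrm (\<lambda>i. x i - y i)" if "x \<in> V" "y \<in> V" for x y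
      unfolding A.ip_diff_left[OF that v, symmetric]
      using a_bounded[OF V.diff_mem[OF that] v] by (simp only: mult_ac)
    have al': "\<bar>a x v\<bar> \<le> ((c + 1) * V.nrm v) * V.nrm x" if "x \<in> V" for x
      using a_bounded[OF that v] by (simp only: mult_ac)
    have kl: "\<bar>k x v - k y v\<bar> \<le> V.nrm v * Z.nrm (\<lambda>i. x i - y i)" if "x \<in> Z" "y \<in> Z" for x y
      unfolding Z.ip_diff_left[OF that V_in_Z[OF v], symmetric]
      using k_bounded[OF Z.diff_mem[OF that] v] by (simp only: mult.commute)
    have kl': "\<bar>k x v\<bar> \<le> V.nrm v * Z.nrm x" if "x \<in> Z" for x
      using k_bounded[OF that v] by (simp only: mult.commute)
    have limb: "(\<lambda>n. LINT t|?M. deriv \<phi> t * b (un n t) v) \<longlonglongrightarrow> (LINT t|?M. deriv \<phi> t * b (u t) v)"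
      by (rule V.functional_integral_tendsto[OF T tf(3) response_bochner_L2 u(1) u(3) bl bl'])
    have lima: "(\<lambda>n. LINT t|?M. \<phi> t * a (un n t) v) \<longlonglongrightarrow> (LINT t|?M. \<phi> t * a (u t) v)"
      by (rule V.functional_integral_tendsto[OF T tf(2) response_bochner_L2 u(1) u(3) al al'])
    have Plim: "(\<lambda>n. L2_norm ?M (\<lambda>t. Z.nrm (\<lambda>i. Pn n t i - z t i))) \<longlonglongrightarrow> 0"
    proof (rule tendsto_sandwich[OF _ _ tendsto_const])
      show "\<forall>\<^sub>F n in sequentially. 0 \<le> L2_norm ?M (\<lambda>t. Z.nrm (\<lambda>i. Pn n t i - z t i))"
        by (intro always_eventually allI L2_norm_nonneg)
      show "\<forall>\<^sub>F n in sequentially. L2_norm ?M (\<lambda>t. Z.nrm (\<lambda>i. Pn n t i - z t i)) \<le> (1/4)^n"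
        unfolding L2_norm_def
      proof (intro always_eventually allI real_le_lsqrt)
        have q: "((1/4::real)^n)\<^sup>2 = (1/16)^n" for n
          by (simp add: power2_eq_square power_mult_distrib[symmetric])
        show "(LINT t|?M. (Z.nrm (\<lambda>i. Pn n t i - z t i))\<^sup>2) \<le> ((1/4)^n)\<^sup>2" for n
          unfolding q by (rule data_error)
      qed simp
      show "(\<lambda>n. (1/4::real)^n) \<longlonglongrightarrow> 0" by (intro LIMSEQ_power_zero) simp
    qed
    have limk: "(\<lambda>n. LINT t|?M. \<phi> t * k (Pn n t) v) \<longlonglongrightarrow> (LINT t|?M. \<phi> t * k (z t) v)"
      by (rule Z.functional_integral_tendsto[OF T tf(2) datum_bochner_L2 z Plim kl kl'])
    have "(\<lambda>n. LINT t|?M. deriv \<phi> t * b (un n t) v) \<longlonglongrightarrow>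
        - (LINT t|?M. \<phi> t * k (z t) v) + (LINT t|?M. \<phi> t * a (u t) v)"
      unfolding response_weak_form[OF \<phi> v] by (intro tendsto_add tendsto_minus limk lima)
    from LIMSEQ_unique[OF limb this]
    have "(LINT t|?M. deriv \<phi> t * b (u t) v) = - (LINT t|?M. \<phi> t * k (z t) v) + (LINT t|?M. \<phi> t * a (u t) v)" .
    moreover have "integrable ?M (\<lambda>t. \<phi> t * k (z t) v)"
      by (intro L2_space_mult_integrable continuous_L2_space tf Z.functional_L2_space[OF z kl kl'])
    moreover have "integrable ?M (\<lambda>t. \<phi> t * a (u t) v)"
      by (intro L2_space_mult_integrable continuous_L2_space tf V.functional_L2_space[OF u(1) al al'])
    ultimately show "(LINT t|?M. deriv \<phi> t * b (u t) v) = - (LINT t|?M. \<phi> t * u' t v)"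
      by (simp add: u'_def right_diff_distrib)
  qed
  have "AE t in ?M. u' t v + a (u t) v = k (z t) v" for v by (simp add: u'_def)
  then show ?thesis
    unfolding solves_def using u(1) bu u'L weak U(1,2) Uu by (intro exI[of _ u] conjI exI[of _ u'] exI[of _ U] ballI)
qed

end

theorem solution_exists:
  assumes "0 < T" "z \<in> bochner_L2 (time_measure T) Z Z.nrm"
  shows "\<exists>u. solves T z u"
  using approximates_exist[OF assms] limit_solves[OF assms] by blast

end

section \<open>Uniqueness for the abstract equation\<close>

lemma LINT_indicator_time:
  assumes "\<tau> \<le> T"
  shows "(LINT t|time_measure T. indicator {0<..<\<tau>} t * f t) = (LINT t|time_measure \<tau>. f t :: real)"
proof -
  have e: "indicator {0<..<T} t *\<^sub>R (indicator {0<..<\<tau>} t * f t) = indicator {0<..<\<tau>} t *\<^sub>R f t" for t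
    using assms by (auto simp: indicator_def)
  have "(LINT t|time_measure T. indicator {0<..<\<tau>} t * f t)
      = (LINT t|lebesgue. indicator {0<..<T} t *\<^sub>R (indicator {0<..<\<tau>} t * f t))"
    by (rule integral_restrict_space) simp
  also have "\<dots> = (LINT t|time_measure \<tau>. f t)"
    unfolding e by (rule integral_restrict_space[symmetric]) simp
  finally show ?thesis .
qed

lemma integrable_indicator_mult_time:
  assumes "integrable (time_measure T) f"
  shows "integrable (time_measure T) (\<lambda>t. indicator {x<..<y} t * f t :: real)"
proof (rule Bochner_Integration.integrable_bound[OF assms])
  have "(indicator {x<..<y} :: real \<Rightarrow> real) \<in> borel_measurable (time_measure T)"
    by (intro measurable_restrict_space1 borel_measurable_indicator) simp
  then show "(\<lambda>t. indicator {x<..<y} t * f t) \<in> borel_measurable (time_measure T)"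
    by (rule borel_measurable_times[OF _ borel_measurable_integrable[OF assms]])
qed (simp add: indicator_def)

text \<open>A function with vanishing primitive is orthogonal to step functions, hence to continuous
  functions.\<close>

lemma zero_primitive_orthogonal:
  assumes T: "0 < T" and g: "integrable (time_measure T) g"
    and zero: "\<And>\<tau>. 0 < \<tau> \<Longrightarrow> \<tau> < T \<Longrightarrow> (LINT t|time_measure T. indicator {0<..<\<tau>} t * g t) = 0"
    and h: "continuous_on {0..T} h"
  shows "(LINT t|time_measure T. h t * g t) = (0::real)"
proof -
  let ?M = "time_measure T"
  define \<delta> where "\<delta> n = T / real (Suc n)" for n
  have \<delta>: "0 < \<delta> n" "real (Suc n) * \<delta> n = T" for n using T by (simp_all add: \<delta>_def)
  define J where "J n i = {0<..<real (Suc i) * \<delta> n}" for n i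
  define I where "I n i = {0<..<real i * \<delta> n}" for n i
  define s where "s n t = (\<Sum>i<n. h (real i * \<delta> n) * (indicator (J n i) t - indicator (I n i) t))" for n t
  define j where "j n t = nat \<lfloor>t / \<delta> n\<rfloor>" for n t
  have ind: "indicator (J n i) t - indicator (I n i) t = (if i = j n t then 1 else (0::real))" if t: "0 < t" for n i t
  proof -
    have "i = j n t \<longleftrightarrow> \<lfloor>t / \<delta> n\<rfloor> = int i"
      using t \<delta>(1)[of n] by (simp add: j_def) (metis divide_nonneg_pos int_nat_eq less_imp_le nat_int zero_le_floor)
    also have "\<dots> \<longleftrightarrow> real i * \<delta> n \<le> t \<and> t < real (Suc i) * \<delta> n"
      using \<delta>(1)[of n] by (simp add: floor_eq_iff pos_le_divide_eq pos_divide_less_eq add.commute)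
    finally have e: "i = j n t \<longleftrightarrow> real i * \<delta> n \<le> t \<and> t < real (Suc i) * \<delta> n" .
    have "real i * \<delta> n \<le> real (Suc i) * \<delta> n" using \<delta>(1)[of n] by (intro mult_right_mono) simp_all
    then show ?thesis using t unfolding e J_def I_def indicator_def by auto
  qed
  have sj: "s n t = (if j n t < n then h (real (j n t) * \<delta> n) else 0)" if "0 < t" for n t
    unfolding s_def ind[OF that] by (simp add: if_distrib sum.delta cong: if_cong)
  have jt: "real (j n t) * \<delta> n \<le> t" "t < real (j n t) * \<delta> n + \<delta> n" if t: "0 < t" for n t
  proof -
    have "0 \<le> \<lfloor>t / \<delta> n\<rfloor>" using t \<delta>(1)[of n] by simp
    then have r: "real (j n t) = of_int \<lfloor>t / \<delta> n\<rfloor>" by (simp add: j_def)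
    have f: "of_int \<lfloor>t / \<delta> n\<rfloor> \<le> t / \<delta> n" "t / \<delta> n < of_int \<lfloor>t / \<delta> n\<rfloor> + 1" by linarith+
    show "real (j n t) * \<delta> n \<le> t" "t < real (j n t) * \<delta> n + \<delta> n"
      unfolding r using mult_right_mono[OF f(1), of "\<delta> n"] mult_strict_right_mono[OF f(2) \<delta>(1)[of n]] \<delta>(1)[of n]
      by (simp_all add: distrib_right)
  qed
  have \<delta>0: "\<delta> \<longlonglongrightarrow> 0"
    unfolding \<delta>_def[abs_def] divide_inverse
    using tendsto_mult_right_zero[OF LIMSEQ_Suc[OF lim_inverse_n], of T] by simp
  obtain B where B: "\<And>t. t \<in> {0..T} \<Longrightarrow> \<bar>h t\<bar> \<le> B"
    using compact_imp_bounded[OF compact_continuous_image[OF h compact_Icc]]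
    unfolding bounded_iff by (metis imageI real_norm_def)
  have B0: "0 \<le> B" using B[of 0] T by simp
  have iJ: "integrable ?M (\<lambda>t. indicator (J n i) t * g t)" and iI: "integrable ?M (\<lambda>t. indicator (I n i) t * g t)" for n i
    unfolding J_def I_def by (intro integrable_indicator_mult_time g)+
  have zJ: "(LINT t|?M. indicator (J n i) t * g t) = 0" if "i < n" for n i
    unfolding J_def
  proof (rule zero)
    show "0 < real (Suc i) * \<delta> n" using \<delta>(1)[of n] by simp
    have "real (Suc i) * \<delta> n < real (Suc n) * \<delta> n" using that \<delta>(1)[of n] by (intro mult_strict_right_mono) simp_all
    then show "real (Suc i) * \<delta> n < T" unfolding \<delta>(2) .
  qed
  have zI: "(LINT t|?M. indicator (I n i) t * g t) = 0" if "i < n" for n i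
  proof (cases i)
    case 0
    then show ?thesis by (simp add: I_def)
  next
    case (Suc i')
    then have "I n i = J n i'" by (simp add: I_def J_def)
    then show ?thesis using zJ[of i' n] that Suc by simp
  qed
  have z: "(LINT t|?M. s n t * g t) = 0" for n
  proof -
    have "(\<lambda>t. s n t * g t) = (\<lambda>t. \<Sum>i<n. h (real i * \<delta> n) * (indicator (J n i) t * g t - indicator (I n i) t * g t))"
      unfolding s_def sum_distrib_right by (intro ext sum.cong refl) (simp add: algebra_simps)
    then have "(LINT t|?M. s n t * g t) = (\<Sum>i<n. LINT t|?M. h (real i * \<delta> n) * (indicator (J n i) t * g t - indicator (I n i) t * g t))"
      using iJ iI by (simp only:) (intro Bochner_Integration.integral_sum integrable_mult_right Bochner_Integration.integrable_diff)
    also have "\<dots> = 0" using iJ iI by (intro sum.neutral ballI) (simp add: zJ zI)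
    finally show ?thesis .
  qed
  have sg: "(\<lambda>t. s n t * g t) \<in> borel_measurable ?M" for n
  proof -
    have m: "(indicator {x<..<y} :: real \<Rightarrow> real) \<in> borel_measurable ?M" for x y
      by (intro measurable_restrict_space1 borel_measurable_indicator) simp
    show ?thesis unfolding s_def J_def I_def
      by (intro borel_measurable_times borel_measurable_sum borel_measurable_diff borel_measurable_const m
          borel_measurable_integrable[OF g])
  qed
  have hm: "h \<in> borel_measurable ?M" by (rule borel_measurable_integrable[OF continuous_integrable_time[OF h]])
  have "(\<lambda>n. LINT t|?M. s n t * g t) \<longlonglongrightarrow> (LINT t|?M. h t * g t)"
  proof (rule integral_dominated_convergence[where w="\<lambda>t. B * \<bar>g t\<bar>"])
    show "integrable ?M (\<lambda>t. B * \<bar>g t\<bar>)" using g by simp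
    show "AE t in ?M. norm (s n t * g t) \<le> B * \<bar>g t\<bar>" for n
    proof (intro AE_I2)
      fix t assume "t \<in> space ?M"
      then have t: "0 < t" "t < T" by simp_all
      have "\<bar>s n t\<bar> \<le> B"
      proof (cases "j n t < n")
        case True
        have "0 \<le> real (j n t) * \<delta> n" using \<delta>(1)[of n] by simp
        then have "real (j n t) * \<delta> n \<in> {0..T}" using jt(1)[OF t(1), of n] t(2) by simp
        then show ?thesis unfolding sj[OF t(1)] using True B by simp
      qed (simp add: sj[OF t(1)] B0)
      then show "norm (s n t * g t) \<le> B * \<bar>g t\<bar>" by (simp add: abs_mult mult_right_mono)
    qed
    show "AE t in ?M. (\<lambda>n. s n t * g t) \<longlonglongrightarrow> h t * g t"
    proof (intro AE_I2 tendsto_mult tendsto_const)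
      fix t assume "t \<in> space ?M"
      then have t: "0 < t" "t < T" by simp_all
      have "\<forall>\<^sub>F n in sequentially. \<delta> n < T - t" using order_tendstoD(2)[OF \<delta>0, of "T - t"] t by simp
      then have ev: "\<forall>\<^sub>F n in sequentially. h (real (j n t) * \<delta> n) = s n t"
      proof eventually_elim
        fix n assume n: "\<delta> n < T - t"
        have "real (j n t) * \<delta> n < real n * \<delta> n"
          using jt(1)[OF t(1), of n] n \<delta>(2)[of n] by (simp add: distrib_right)
        then have "j n t < n" using \<delta>(1)[of n] by simp
        then show "h (real (j n t) * \<delta> n) = s n t" by (simp add: sj[OF t(1)])
      qed
      have "(\<lambda>n. real (j n t) * \<delta> n) \<longlonglongrightarrow> t"
      proof (rule tendsto_sandwich[of "\<lambda>n. t - \<delta> n" _ _ "\<lambda>n. t"])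
        show "(\<lambda>n. t - \<delta> n) \<longlonglongrightarrow> t" using tendsto_diff[OF tendsto_const[of t] \<delta>0] by simp
        show "\<forall>\<^sub>F n in sequentially. t - \<delta> n \<le> real (j n t) * \<delta> n"
        proof (intro always_eventually allI)
          fix n show "t - \<delta> n \<le> real (j n t) * \<delta> n" using jt(2)[OF t(1), of n] by linarith
        qed
        show "\<forall>\<^sub>F n in sequentially. real (j n t) * \<delta> n \<le> t" by (intro always_eventually allI jt(1) t)
      qed simp
      then have "(\<lambda>n. h (real (j n t) * \<delta> n)) \<longlonglongrightarrow> h t"
      proof (rule continuous_on_tendsto_compose[OF h])
        show "\<forall>\<^sub>F n in sequentially. real (j n t) * \<delta> n \<in> {0..T}"
        proof (intro always_eventually allI)
          fix n
          show "real (j n t) * \<delta> n \<in> {0..T}" using jt(1)[OF t(1), of n] \<delta>(1)[of n] t(2) by simp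
        qed
      qed (use t in simp)
      from Lim_transform_eventually[OF this ev] show "(\<lambda>n. s n t) \<longlonglongrightarrow> h t" .
    qed
    show "(\<lambda>t. h t * g t) \<in> borel_measurable ?M" by (intro borel_measurable_times hm borel_measurable_integrable[OF g])
  qed (rule sg)
  then show ?thesis unfolding z by (simp add: LIMSEQ_const_iff)
qed

lemma (in seminormed_space) dual_norm_bound:
  assumes F: "F \<in> dual_space X nrm" and v: "v \<in> X"
  shows "\<bar>F v\<bar> \<le> dual_norm X nrm F * nrm v"
proof (cases "nrm v = 0")
  case True
  obtain C where "\<bar>F v\<bar> \<le> C * nrm v" using F v unfolding dual_space_def by blast
  then show ?thesis using True by simp
next
  case False
  then have p: "0 < nrm v" using nrm_nonneg[OF v] by simp
  define w where "w = (\<lambda>i. inverse (nrm v) * v i)"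
  have w: "w \<in> X" unfolding w_def by (rule scale_mem[OF v])
  have "nrm w \<le> \<bar>inverse (nrm v)\<bar> * nrm v" unfolding w_def by (rule nrm_scale_le[OF v])
  then have "nrm w \<le> 1" using p by simp
  then have 1: "\<bar>F w\<bar> \<le> dual_norm X nrm F" by (rule dual_norm_upper[OF F w])
  have "F (\<lambda>i. inverse (nrm v) * v i + 0 * v i) = inverse (nrm v) * F v + 0 * F v"
    using F v unfolding dual_space_def by blast
  then have "F w = inverse (nrm v) * F v" by (simp add: w_def)
  then have "\<bar>F v\<bar> = \<bar>F w\<bar> * nrm v" using p by (simp add: abs_mult)
  then show ?thesis using mult_right_mono[OF 1, of "nrm v"] p by simp
qed

context degenerate_parabolic
begin

lemma continuous_into_ip:
  assumes U: "continuous_into {0..T} H H.nrm U" and v: "v \<in> H"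
  shows "continuous_on {0..T} (\<lambda>t. b (U t) v)"
  unfolding continuous_on_def
proof
  fix t assume t: "t \<in> {0..T}"
  have UH: "U r \<in> H" if "r \<in> {0..T}" for r using U that unfolding continuous_into_def by blast
  have l: "((\<lambda>r. H.nrm (\<lambda>i. U r i - U t i)) \<longlongrightarrow> 0) (at t within {0..T})"
    using U t unfolding continuous_into_def by blast
  have "((\<lambda>r. b (U r) v - b (U t) v) \<longlongrightarrow> 0) (at t within {0..T})"
  proof (rule Lim_null_comparison)
    show "\<forall>\<^sub>F r in at t within {0..T}. norm (b (U r) v - b (U t) v) \<le> H.nrm v * H.nrm (\<lambda>i. U r i - U t i)"
      unfolding eventually_at_filter
      by (intro always_eventually allI impI) (simp only: real_norm_def H.ip_Lipschitz[OF UH UH[OF t] v])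
    show "((\<lambda>r. H.nrm v * H.nrm (\<lambda>i. U r i - U t i)) \<longlongrightarrow> 0) (at t within {0..T})"
      by (rule tendsto_mult_right_zero[OF l])
  qed
  then show "((\<lambda>t. b (U t) v) \<longlongrightarrow> b (U t) v) (at t within {0..T})" by (simp only: LIM_zero_iff)
qed

lemma b_eq_of_nrm_zero:
  assumes "x \<in> H" "y \<in> H" "v \<in> H" "H.nrm (\<lambda>i. x i - y i) = 0"
  shows "b x v = b y v"
  using H.ip_Lipschitz[OF assms(1,2,3)] unfolding assms(4) by simp

lemma a_L2_space:
  assumes "f \<in> bochner_L2 (time_measure T) V V.nrm" "v \<in> V"
  shows "(\<lambda>t. a (f t) v) \<in> L2_space (time_measure T)"
proof (rule V.functional_L2_space[OF assms(1), where C="(c + 1) * V.nrm v"])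
  show "\<bar>a x v - a y v\<bar> \<le> ((c + 1) * V.nrm v) * V.nrm (\<lambda>i. x i - y i)" if "x \<in> V" "y \<in> V" for x y
    unfolding A.ip_diff_left[OF that assms(2), symmetric]
    using a_bounded[OF V.diff_mem[OF that] assms(2)] by (simp only: mult_ac)
  show "\<bar>a x v\<bar> \<le> ((c + 1) * V.nrm v) * V.nrm x" if "x \<in> V" for x
    using a_bounded[OF that assms(2)] by (simp only: mult_ac)
qed

lemma b_L2_space:
  assumes "f \<in> bochner_L2 (time_measure T) V V.nrm" "v \<in> V"
  shows "(\<lambda>t. b (f t) v) \<in> L2_space (time_measure T)"
proof (rule V.functional_L2_space[OF assms(1), where C="V.nrm v"])
  show "\<bar>b x v - b y v\<bar> \<le> V.nrm v * V.nrm (\<lambda>i. x i - y i)" if "x \<in> V" "y \<in> V" for x y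
    unfolding B.ip_diff_left[OF that assms(2), symmetric]
    using b_bounded[OF V.diff_mem[OF that] assms(2)] by (simp only: mult_ac)
  show "\<bar>b x v\<bar> \<le> V.nrm v * V.nrm x" if "x \<in> V" for x
    using b_bounded[OF that assms(2)] by (simp only: mult_ac)
qed

lemma dual_L2_space:
  assumes "f \<in> bochner_L2 (time_measure T) (dual_space V V.nrm) (dual_norm V V.nrm)" "v \<in> V"
  shows "(\<lambda>t. f t v) \<in> L2_space (time_measure T)"
proof (rule seminormed_space.functional_L2_space[OF V.dual_seminormed assms(1), where C="V.nrm v"])
  show "\<bar>F v - G v\<bar> \<le> V.nrm v * dual_norm V V.nrm (\<lambda>v. F v - G v)"
    if "F \<in> dual_space V V.nrm" "G \<in> dual_space V V.nrm" for F G
    using V.dual_norm_bound[OF seminormed_space.diff_mem[OF V.dual_seminormed that] assms(2)] by (simp only: mult.commute)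
  show "\<bar>F v\<bar> \<le> V.nrm v * dual_norm V V.nrm F" if "F \<in> dual_space V V.nrm" for F
    using V.dual_norm_bound[OF that assms(2)] by (simp only: mult.commute)
qed

text \<open>For fixed \<open>v\<close> the function \<open>b (U t) v\<close> is continuous, vanishes at 0 and has the integrable weak derivative
  \<open>- a (w t - u t) v\<close>. Continuity gives the identity for every \<open>\<tau>\<close>, outside no exceptional set
  depending on \<open>v\<close>, so a test element depending on \<open>\<tau>\<close> may be inserted later.\<close>

lemma difference_equation:
  assumes T: "0 < T" and u: "solves T z u" and w: "solves T z w"
  shows "\<exists>U. (AE t in time_measure T. H.nrm (\<lambda>i. U t i - (w t i - u t i)) = 0) \<and> (\<forall>t\<in>{0..T}. U t \<in> H) \<and>
     (\<forall>v\<in>V. continuous_on {0..T} (\<lambda>t. b (U t) v)) \<and>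
     (\<forall>v\<in>V. \<forall>\<tau>. 0 < \<tau> \<longrightarrow> \<tau> < T \<longrightarrow>
        b (U \<tau>) v = - (LINT t|time_measure T. indicator {0<..<\<tau>} t * a (\<lambda>i. w t i - u t i) v))"
proof -
  let ?M = "time_measure T"
  obtain u' Uu where u: "u \<in> bochner_L2 ?M V V.nrm" "u' \<in> bochner_L2 ?M (dual_space V V.nrm) (dual_norm V V.nrm)"
    "has_weak_time_derivative T V (\<lambda>t. b (u t)) u'" "\<And>v. v \<in> V \<Longrightarrow> AE t in ?M. u' t v + a (u t) v = k (z t) v"
    "continuous_into {0..T} H H.nrm Uu" "AE t in ?M. H.nrm (\<lambda>i. Uu t i - u t i) = 0" "H.nrm (Uu 0) = 0"
    using u unfolding solves_def by blast
  obtain w' Uw where w: "w \<in> bochner_L2 ?M V V.nrm" "w' \<in> bochner_L2 ?M (dual_space V V.nrm) (dual_norm V V.nrm)"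
    "has_weak_time_derivative T V (\<lambda>t. b (w t)) w'" "\<And>v. v \<in> V \<Longrightarrow> AE t in ?M. w' t v + a (w t) v = k (z t) v"
    "continuous_into {0..T} H H.nrm Uw" "AE t in ?M. H.nrm (\<lambda>i. Uw t i - w t i) = 0" "H.nrm (Uw 0) = 0"
    using w unfolding solves_def by blast
  have Uu: "Uu t \<in> H" and Uw: "Uw t \<in> H" if "t \<in> {0..T}" for t
    using u(5) w(5) that unfolding continuous_into_def by blast+
  have AEu: "AE t in ?M. u t \<in> V" and AEw: "AE t in ?M. w t \<in> V"
    by (rule V.bochner_L2_AE_mem[OF u(1)], rule V.bochner_L2_AE_mem[OF w(1)])
  define U where "U t = (\<lambda>i. Uw t i - Uu t i)" for t
  have 1: "AE t in ?M. H.nrm (\<lambda>i. U t i - (w t i - u t i)) = 0"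
    using AEu AEw u(6) w(6) AE_space
  proof eventually_elim
    fix t assume t: "u t \<in> V" "w t \<in> V" "H.nrm (\<lambda>i. Uu t i - u t i) = 0" "H.nrm (\<lambda>i. Uw t i - w t i) = 0" "t \<in> space ?M"
    have tT: "t \<in> {0..T}" using t(5) by simp
    note m = H.diff_mem[OF Uw[OF tT] V_in_H[OF t(2)]] H.diff_mem[OF Uu[OF tT] V_in_H[OF t(1)]]
    have e: "(\<lambda>i. U t i - (w t i - u t i)) = (\<lambda>i. (Uw t i - w t i) - (Uu t i - u t i))"
      by (simp add: U_def algebra_simps)
    have "H.nrm (\<lambda>i. U t i - (w t i - u t i)) \<le> 0" unfolding e using H.nrm_diff[OF m] t(3,4) by simp
    then show "H.nrm (\<lambda>i. U t i - (w t i - u t i)) = 0"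
      unfolding e using H.nrm_nonneg[OF H.diff_mem[OF m]] by linarith
  qed
  have 2: "U t \<in> H" if "t \<in> {0..T}" for t unfolding U_def by (rule H.diff_mem[OF Uw[OF that] Uu[OF that]])
  have FU: "b (U t) v = b (Uw t) v - b (Uu t) v" if "t \<in> {0..T}" "v \<in> V" for t v
    unfolding U_def by (rule H.ip_diff_left[OF Uw[OF that(1)] Uu[OF that(1)] V_in_H[OF that(2)]])
  have cF: "continuous_on {0..T} (\<lambda>t. b (Uw t) v - b (Uu t) v)" if "v \<in> V" for v
    by (intro continuous_on_diff continuous_into_ip u(5) w(5) V_in_H that)
  have 3: "continuous_on {0..T} (\<lambda>t. b (U t) v)" if "v \<in> V" for v
    by (rule continuous_on_eq[OF cF[OF that]]) (simp add: FU that)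
  have 4: "b (U \<tau>) v = - (LINT t|?M. indicator {0<..<\<tau>} t * a (\<lambda>i. w t i - u t i) v)"
    if v: "v \<in> V" and \<tau>: "0 < \<tau>" "\<tau> < T" for v \<tau>
  proof -
    define F where "F t = b (Uw t) v - b (Uu t) v" for t
    define g where "g t = a (u t) v - a (w t) v" for t
    have gL: "g \<in> L2_space ?M" unfolding g_def[abs_def] by (intro L2.diff_mem a_L2_space u w v)
    have T0: "0 \<in> {0..T}" using T by simp
    have F0: "F 0 = 0"
      unfolding F_def using H.cauchy_schwarz[OF Uw[OF T0] V_in_H[OF v]] H.cauchy_schwarz[OF Uu[OF T0] V_in_H[OF v]]
      by (simp add: u(7)[simplified] w(7)[simplified])
    have AEF: "AE t in ?M. F t = b (w t) v - b (u t) v"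
      using AEu AEw u(6) w(6) AE_space
    proof eventually_elim
      fix t assume t: "u t \<in> V" "w t \<in> V" "H.nrm (\<lambda>i. Uu t i - u t i) = 0" "H.nrm (\<lambda>i. Uw t i - w t i) = 0" "t \<in> space ?M"
      have tT: "t \<in> {0..T}" using t(5) by simp
      show "F t = b (w t) v - b (u t) v"
        unfolding F_def b_eq_of_nrm_zero[OF Uu[OF tT] V_in_H[OF t(1)] V_in_H[OF v] t(3)]
          b_eq_of_nrm_zero[OF Uw[OF tT] V_in_H[OF t(2)] V_in_H[OF v] t(4)] ..
    qed
    have AEg: "AE t in ?M. w' t v - u' t v = g t"
      using u(4)[OF v] w(4)[OF v] by eventually_elim (simp add: g_def)
    have weak: "(LINT t|?M. deriv \<phi> t * F t) = - (LINT t|?M. \<phi> t * g t)" if \<phi>: "test_function T \<phi>" for \<phi>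
    proof -
      note tf = test_function_facts[OF \<phi> T]
      have c1: "deriv \<phi> \<in> L2_space ?M" "\<phi> \<in> L2_space ?M" by (intro continuous_L2_space tf)+
      have FL: "F \<in> L2_space ?M" unfolding F_def[abs_def] by (rule continuous_L2_space[OF cF[OF v]])
      have iw: "integrable ?M (\<lambda>t. deriv \<phi> t * b (w t) v)" "integrable ?M (\<lambda>t. \<phi> t * w' t v)"
        and iu: "integrable ?M (\<lambda>t. deriv \<phi> t * b (u t) v)" "integrable ?M (\<lambda>t. \<phi> t * u' t v)"
        by (intro L2_space_mult_integrable c1 b_L2_space dual_L2_space u w v)+
      have "(LINT t|?M. deriv \<phi> t * F t) = (LINT t|?M. deriv \<phi> t * b (w t) v - deriv \<phi> t * b (u t) v)"
      proof (rule integral_cong_AE)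
        show "AE t in ?M. deriv \<phi> t * F t = deriv \<phi> t * b (w t) v - deriv \<phi> t * b (u t) v"
          using AEF by eventually_elim (simp add: right_diff_distrib)
      qed (intro borel_measurable_integrable L2_space_mult_integrable c1 FL Bochner_Integration.integrable_diff iw iu)+
      also have "\<dots> = (LINT t|?M. deriv \<phi> t * b (w t) v) - (LINT t|?M. deriv \<phi> t * b (u t) v)"
        by (rule Bochner_Integration.integral_diff[OF iw(1) iu(1)])
      also have "(LINT t|?M. deriv \<phi> t * b (w t) v) = - (LINT t|?M. \<phi> t * w' t v)"
        using w(3) \<phi> v unfolding has_weak_time_derivative_def by blast
      also have "(LINT t|?M. deriv \<phi> t * b (u t) v) = - (LINT t|?M. \<phi> t * u' t v)"
        using u(3) \<phi> v unfolding has_weak_time_derivative_def by blast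
      also have "- (LINT t|?M. \<phi> t * w' t v) - - (LINT t|?M. \<phi> t * u' t v)
          = - (LINT t|?M. \<phi> t * w' t v - \<phi> t * u' t v)"
        using Bochner_Integration.integral_diff[OF iw(2) iu(2)] by simp
      also have "(LINT t|?M. \<phi> t * w' t v - \<phi> t * u' t v) = (LINT t|?M. \<phi> t * g t)"
      proof (rule integral_cong_AE)
        show "AE t in ?M. \<phi> t * w' t v - \<phi> t * u' t v = \<phi> t * g t"
          using AEg by eventually_elim (simp add: right_diff_distrib[symmetric])
      qed (intro borel_measurable_integrable L2_space_mult_integrable c1 gL Bochner_Integration.integrable_diff iw iu)+
      finally show ?thesis .
    qed
    have "F \<tau> = (LINT t|?M. indicator {0<..<\<tau>} t * g t)"
      by (rule weak_derivative_primitive[OF _ F0 L2_space_integrable_time[OF gL] weak \<tau>])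
         (unfold F_def[abs_def], rule cF[OF v])
    also have "\<dots> = (LINT t|?M. - (indicator {0<..<\<tau>} t * a (\<lambda>i. w t i - u t i) v))"
    proof (rule integral_cong_AE)
      show "AE t in ?M. indicator {0<..<\<tau>} t * g t = - (indicator {0<..<\<tau>} t * a (\<lambda>i. w t i - u t i) v)"
        using AEu AEw
        by eventually_elim (simp add: g_def A.ip_diff_left v right_diff_distrib)
      show "(\<lambda>t. indicator {0<..<\<tau>} t * g t) \<in> borel_measurable ?M"
        by (intro borel_measurable_integrable integrable_indicator_mult_time L2_space_integrable_time gL)
      show "(\<lambda>t. - (indicator {0<..<\<tau>} t * a (\<lambda>i. w t i - u t i) v)) \<in> borel_measurable ?M"
        by (intro borel_measurable_integrable Bochner_Integration.integrable_minus integrable_indicator_mult_time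
            L2_space_integrable_time a_L2_space V.bochner_L2_diff[OF complete_time_measure w(1) u(1)] v)
    qed
    also have "\<dots> = - (LINT t|?M. indicator {0<..<\<tau>} t * a (\<lambda>i. w t i - u t i) v)" by (rule Bochner_Integration.integral_minus)
    finally show ?thesis using FU[OF _ v, of \<tau>] \<tau> by (simp add: F_def)
  qed
  show ?thesis using 1 2 3 4 by (intro exI[of _ U] conjI ballI allI impI)
qed

text \<open>For an exponential sum \<open>P\<close> with primitive \<open>Q\<close>, \<open>Q 0 = 0\<close>, the double integral of \<open>a (P t) (P \<tau>)\<close> over
  \<open>t < \<tau>\<close> is half of \<open>a (Q T) (Q T)\<close>.\<close>

lemma exp_sum_primitive:
  assumes L: "exp_list V L" and T: "0 < T"
  shows "\<exists>Q. (\<forall>\<tau>. Q \<tau> \<in> V) \<and> (\<forall>v\<in>V. \<forall>\<tau>. 0 < \<tau> \<longrightarrow> \<tau> < T \<longrightarrow>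
        (LINT t|time_measure T. indicator {0<..<\<tau>} t * a (exp_sum L t) v) = a (Q \<tau>) v) \<and>
      integrable (time_measure T) (\<lambda>\<tau>. a (Q \<tau>) (exp_sum L \<tau>)) \<and>
      0 \<le> (LINT \<tau>|time_measure T. a (Q \<tau>) (exp_sum L \<tau>))"
proof -
  define K where "K = map (\<lambda>(l, x). (l, \<lambda>i. (1 / l) * x i)) L"
  have K: "exp_list V K" and dK: "exp_deriv K = L"
    using L unfolding K_def
    by (induction rule: exp_list_induct) (simp_all add: exp_deriv_simps V.scale_mem[of _ "1 / _", simplified])
  define Q where "Q \<tau> = (\<lambda>i. exp_sum K \<tau> i - exp_sum K 0 i)" for \<tau>
  have mK: "exp_sum K \<tau> \<in> V" for \<tau> by (rule V.exp_sum_mem[OF K])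
  have mL: "exp_sum L \<tau> \<in> V" for \<tau> by (rule V.exp_sum_mem[OF L])
  have QV: "Q \<tau> \<in> V" for \<tau> unfolding Q_def by (rule V.diff_mem[OF mK mK])
  have aQ: "a (Q \<tau>) v = a (exp_sum K \<tau>) v - a (exp_sum K 0) v" if "v \<in> V" for v \<tau>
    unfolding Q_def by (rule A.ip_diff_left[OF mK mK that])
  have prim: "(LINT t|time_measure T. indicator {0<..<\<tau>} t * a (exp_sum L t) v) = a (Q \<tau>) v"
    if v: "v \<in> V" and \<tau>: "0 < \<tau>" "\<tau> < T" for v \<tau>
  proof -
    have "(LINT t|time_measure T. indicator {0<..<\<tau>} t * a (exp_sum L t) v) = (LINT t|time_measure \<tau>. a (exp_sum L t) v)"
      using \<tau> by (intro LINT_indicator_time) simp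
    also have "\<dots> = integral {0..\<tau>} (\<lambda>t. a (exp_sum L t) v)"
      by (rule LINT_time_eq_integral[OF A.ip_exp_sum_continuous[OF L v]])
    also have "((\<lambda>t. a (exp_sum L t) v) has_integral (a (exp_sum K \<tau>) v - a (exp_sum K 0) v)) {0..\<tau>}"
    proof (rule fundamental_theorem_of_calculus)
      fix t
      show "((\<lambda>t. a (exp_sum K t) v) has_vector_derivative a (exp_sum L t) v) (at t within {0..\<tau>})"
        unfolding has_real_derivative_iff_has_vector_derivative[symmetric]
        using has_field_derivative_at_within[OF A.ip_exp_sum_deriv[OF K v, of t]] unfolding dK .
    qed (use \<tau> in simp)
    then have "integral {0..\<tau>} (\<lambda>t. a (exp_sum L t) v) = a (Q \<tau>) v" unfolding aQ[OF v] by (rule integral_unique)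
    finally show ?thesis .
  qed
  have aQL: "a (Q \<tau>) (exp_sum L \<tau>) = a (exp_sum K \<tau>) (exp_sum L \<tau>) - a (exp_sum L \<tau>) (exp_sum K 0)" for \<tau>
    unfolding aQ[OF mL] A.ip_sym[OF mK[of 0] mL] ..
  have c: "continuous_on {0..T} (\<lambda>\<tau>. a (Q \<tau>) (exp_sum L \<tau>))"
    unfolding aQL by (intro continuous_on_diff A.ip_exp_sum_exp_sum_continuous A.ip_exp_sum_continuous K L mK)
  have "((\<lambda>\<tau>. a (Q \<tau>) (exp_sum L \<tau>)) has_integral (a (Q T) (Q T) / 2 - a (Q 0) (Q 0) / 2)) {0..T}"
  proof (rule fundamental_theorem_of_calculus)
    fix t
    have q: "a (Q \<tau>) (Q \<tau>) = a (exp_sum K \<tau>) (exp_sum K \<tau>) - 2 * a (exp_sum K \<tau>) (exp_sum K 0) + a (exp_sum K 0) (exp_sum K 0)" for \<tau>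
      using A.ip_lin_square[OF mK mK, of 1 \<tau> "- 1" 0] by (simp add: Q_def)
    have "((\<lambda>\<tau>. (a (exp_sum K \<tau>) (exp_sum K \<tau>) - 2 * a (exp_sum K \<tau>) (exp_sum K 0) + a (exp_sum K 0) (exp_sum K 0)) / 2)
        has_real_derivative (2 * a (exp_sum L t) (exp_sum K t) - 2 * a (exp_sum L t) (exp_sum K 0) + 0) / 2) (at t)"
      using A.ip_exp_sum_square_deriv[OF K, of t] A.ip_exp_sum_deriv[OF K mK[of 0], of t] unfolding dK
      by (intro DERIV_cdivide DERIV_add DERIV_diff DERIV_const DERIV_cmult)
    moreover have "(2 * a (exp_sum L t) (exp_sum K t) - 2 * a (exp_sum L t) (exp_sum K 0) + 0) / 2 = a (Q t) (exp_sum L t)"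
      unfolding aQL A.ip_sym[OF mK[of t] mL] by simp
    ultimately show "((\<lambda>\<tau>. a (Q \<tau>) (Q \<tau>) / 2) has_vector_derivative a (Q t) (exp_sum L t)) (at t within {0..T})"
      unfolding has_real_derivative_iff_has_vector_derivative[symmetric] q by (simp only: has_field_derivative_at_within)
  qed (use T in simp)
  then have "(LINT \<tau>|time_measure T. a (Q \<tau>) (exp_sum L \<tau>)) = a (Q T) (Q T) / 2 - a (Q 0) (Q 0) / 2"
    unfolding LINT_time_eq_integral[OF c] by (rule integral_unique)
  moreover have "a (Q 0) (Q 0) = 0" unfolding aQ[OF QV] by simp
  ultimately have "0 \<le> (LINT \<tau>|time_measure T. a (Q \<tau>) (exp_sum L \<tau>))" using A.ip_nonneg[OF QV[of T]] by simp
  then show ?thesis using QV prim continuous_integrable_time[OF c] by (intro exI[of _ Q] conjI allI ballI impI)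
qed

lemma small_multiples_nonpos:
  fixes x M :: real
  assumes M: "0 \<le> M" and le: "\<And>\<epsilon>. 0 < \<epsilon> \<Longrightarrow> \<epsilon> \<le> 1 \<Longrightarrow> x \<le> \<epsilon> * M"
  shows "x \<le> 0"
proof (rule ccontr)
  assume "\<not> x \<le> 0"
  then have x: "0 < x" by simp
  define \<epsilon> where "\<epsilon> = min 1 (x / (2 * (M + 1)))"
  have "0 < \<epsilon>" "\<epsilon> \<le> 1" using x M by (simp_all add: \<epsilon>_def)
  then have "x \<le> \<epsilon> * M" by (rule le)
  also have "\<dots> \<le> \<epsilon> * (M + 1)" using \<open>0 < \<epsilon>\<close> by simp
  also have "\<dots> \<le> x / (2 * (M + 1)) * (M + 1)" using M by (intro mult_right_mono) (simp_all add: \<epsilon>_def)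
  also have "\<dots> = x / 2"
  proof -
    have "x / (2 * D) * D = x / 2" if "0 < D" for D :: real using that by simp
    then show ?thesis using M by (meson add_nonneg_pos zero_less_one)
  qed
  finally show False using x by simp
qed

lemma exp_sum_L2_approximation:
  assumes T: "0 < T" and d: "d \<in> bochner_L2 (time_measure T) V V.nrm" and \<epsilon>: "0 < \<epsilon>"
  shows "\<exists>L. exp_list V L \<and> L2_norm (time_measure T) (\<lambda>t. V.nrm (\<lambda>i. d t i - exp_sum L t i)) \<le> \<epsilon>"
proof -
  have "0 < \<epsilon>\<^sup>2" using \<epsilon> by simp
  from V.exp_sums_dense[OF T d, unfolded V.exp_approximable_def, rule_format, OF this]
  obtain L where L: "exp_list V L" "(LINT t|time_measure T. (V.nrm (\<lambda>i. d t i - exp_sum L t i))\<^sup>2) \<le> \<epsilon>\<^sup>2" by blast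
  have "L2_norm (time_measure T) (\<lambda>t. V.nrm (\<lambda>i. d t i - exp_sum L t i)) \<le> \<epsilon>"
    unfolding L2_norm_def by (rule real_le_lsqrt) (use L(2) \<epsilon> in simp_all)
  then show ?thesis using L(1) by blast
qed

text \<open>Both halves follow the same pattern. A quadratic integral of \<open>d\<close> is compared with the integral in which
  one factor is replaced by an exponential sum at distance \<open>\<epsilon>\<close>; the latter is at most a multiple of
  \<open>\<epsilon>\<close>, by \<open>exp_sum_primitive\<close> for \<open>b d d\<close> and by \<open>zero_primitive_orthogonal\<close> for \<open>a d d\<close>.\<close>

theorem solution_unique:
  assumes T: "0 < T" and u: "solves T z u" and w: "solves T z w"
  shows "AE t in time_measure T. V.nrm (\<lambda>i. w t i - u t i) = 0"
proof -
  let ?M = "time_measure T"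
  define d where "d t = (\<lambda>i. w t i - u t i)" for t
  have d: "d \<in> bochner_L2 ?M V V.nrm"
    unfolding d_def[abs_def]
    by (rule V.bochner_L2_diff[OF complete_time_measure]) (use u w in \<open>simp_all add: solves_def\<close>)
  have AEd: "AE t in ?M. d t \<in> V" by (rule V.bochner_L2_AE_mem[OF d])
  obtain U where U: "AE t in ?M. H.nrm (\<lambda>i. U t i - d t i) = 0" "\<And>t. t \<in> {0..T} \<Longrightarrow> U t \<in> H"
    "\<And>v. v \<in> V \<Longrightarrow> continuous_on {0..T} (\<lambda>t. b (U t) v)"
    "\<And>v \<tau>. v \<in> V \<Longrightarrow> 0 < \<tau> \<Longrightarrow> \<tau> < T \<Longrightarrow> b (U \<tau>) v = - (LINT t|?M. indicator {0<..<\<tau>} t * a (d t) v)"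
    using difference_equation[OF T u w] unfolding d_def by blast
  define D where "D = L2_norm ?M (\<lambda>t. V.nrm (d t))"
  have D: "0 \<le> D" by (simp add: D_def L2_norm_nonneg)
  have dL: "(\<lambda>t. V.nrm (d t)) \<in> L2_space ?M" by (rule V.nrm_L2_space[OF d])
  have sqi: "integrable ?M (\<lambda>t. (n (d t))\<^sup>2)"
    if "\<And>x y. x \<in> V \<Longrightarrow> y \<in> V \<Longrightarrow> \<bar>n x - n y\<bar> \<le> C * V.nrm (\<lambda>i. x i - y i)" "\<And>x. x \<in> V \<Longrightarrow> \<bar>n x\<bar> \<le> C * V.nrm x"
    for n :: "('i \<Rightarrow> real) \<Rightarrow> real" and C
    by (rule L2_spaceD(2)[OF V.functional_L2_space[OF d that]])
  have Ble: "B.nrm x \<le> 1 * V.nrm x" if "x \<in> V" for x using nrm_le_V(1)[OF that] by simp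
  have Ale: "A.nrm x \<le> sqrt (c + 1) * V.nrm x" if "x \<in> V" for x
  proof -
    have "a x x \<le> (c + 1) * ipV x x"
      using a_bounded[OF that that] V.nrm_sq[OF that] by (simp add: power2_eq_square mult.assoc)
    then show ?thesis by (simp only: real_sqrt_mult[symmetric] real_sqrt_le_mono)
  qed
  have ib: "integrable ?M (\<lambda>t. (B.nrm (d t))\<^sup>2)"
  proof (rule sqi)
    show "\<bar>B.nrm x - B.nrm y\<bar> \<le> 1 * V.nrm (\<lambda>i. x i - y i)" if "x \<in> V" "y \<in> V" for x y
      by (rule order_trans[OF B.nrm_reverse_triangle[OF that] Ble[OF V.diff_mem[OF that]]])
    show "\<bar>B.nrm x\<bar> \<le> 1 * V.nrm x" if "x \<in> V" for x using Ble[OF that] B.nrm_nonneg[OF that] by simp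
  qed
  have ia: "integrable ?M (\<lambda>t. (A.nrm (d t))\<^sup>2)"
  proof (rule sqi)
    show "\<bar>A.nrm x - A.nrm y\<bar> \<le> sqrt (c + 1) * V.nrm (\<lambda>i. x i - y i)" if "x \<in> V" "y \<in> V" for x y
      by (rule order_trans[OF A.nrm_reverse_triangle[OF that] Ale[OF V.diff_mem[OF that]]])
    show "\<bar>A.nrm x\<bar> \<le> sqrt (c + 1) * V.nrm x" if "x \<in> V" for x using Ale[OF that] A.nrm_nonneg[OF that] by simp
  qed
  have approx: "\<exists>L. exp_list V L \<and> (\<lambda>t. V.nrm (\<lambda>i. d t i - exp_sum L t i)) \<in> L2_space ?M \<and>
      L2_norm ?M (\<lambda>t. V.nrm (\<lambda>i. d t i - exp_sum L t i)) \<le> \<epsilon> \<and>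
      (LINT t|?M. V.nrm (d t) * V.nrm (\<lambda>i. d t i - exp_sum L t i)) \<le> D * \<epsilon>" if e: "0 < \<epsilon>" for \<epsilon>
  proof -
    obtain L where L: "exp_list V L" "L2_norm ?M (\<lambda>t. V.nrm (\<lambda>i. d t i - exp_sum L t i)) \<le> \<epsilon>"
      using exp_sum_L2_approximation[OF T d e] by blast
    have eL: "(\<lambda>t. V.nrm (\<lambda>i. d t i - exp_sum L t i)) \<in> L2_space ?M"
      by (rule V.nrm_L2_space[OF V.bochner_L2_diff[OF complete_time_measure d V.exp_sum_bochner_L2[OF L(1) T]]])
    have "(LINT t|?M. V.nrm (d t) * V.nrm (\<lambda>i. d t i - exp_sum L t i)) \<le> D * L2_norm ?M (\<lambda>t. V.nrm (\<lambda>i. d t i - exp_sum L t i))"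
      using L2.cauchy_schwarz[OF dL eL] unfolding D_def by (rule order_trans[OF abs_ge_self])
    also have "\<dots> \<le> D * \<epsilon>" by (rule mult_left_mono[OF L(2) D])
    finally show ?thesis using L eL by blast
  qed
  \<comment> \<open>The component in \<open>H\<close> vanishes.\<close>
  have "(LINT t|?M. (B.nrm (d t))\<^sup>2) \<le> 0"
  proof (rule small_multiples_nonpos)
    let ?C = "(c + 1) * (sqrt T * (sqrt T * D + sqrt T)) + D"
    show "0 \<le> ?C" using c D T by simp
    fix \<epsilon> :: real assume e: "0 < \<epsilon>" "\<epsilon> \<le> 1"
    obtain L where L: "exp_list V L" "(\<lambda>t. V.nrm (\<lambda>i. d t i - exp_sum L t i)) \<in> L2_space ?M"
      "L2_norm ?M (\<lambda>t. V.nrm (\<lambda>i. d t i - exp_sum L t i)) \<le> \<epsilon>"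
      "(LINT t|?M. V.nrm (d t) * V.nrm (\<lambda>i. d t i - exp_sum L t i)) \<le> D * \<epsilon>"
      using approx[OF e(1)] by blast
    note PL = V.exp_sum_bochner_L2[OF L(1) T]
    have PV: "exp_sum L t \<in> V" for t by (rule V.exp_sum_mem[OF L(1)])
    obtain Q where Q: "\<And>\<tau>. Q \<tau> \<in> V"
      "\<And>v \<tau>. v \<in> V \<Longrightarrow> 0 < \<tau> \<Longrightarrow> \<tau> < T \<Longrightarrow> (LINT t|?M. indicator {0<..<\<tau>} t * a (exp_sum L t) v) = a (Q \<tau>) v"
      "integrable ?M (\<lambda>\<tau>. a (Q \<tau>) (exp_sum L \<tau>))" "0 \<le> (LINT \<tau>|?M. a (Q \<tau>) (exp_sum L \<tau>))"
      using exp_sum_primitive[OF L(1) T] by blast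
    define \<delta> where "\<delta> = (LINT t|?M. V.nrm (\<lambda>i. d t i - exp_sum L t i))"
    have ie: "integrable ?M (\<lambda>t. V.nrm (\<lambda>i. d t i - exp_sum L t i))" by (rule L2_space_integrable_time[OF L(2)])
    have AEe: "AE t in ?M. 0 \<le> V.nrm (\<lambda>i. d t i - exp_sum L t i)"
      using AEd by eventually_elim (intro V.nrm_nonneg V.diff_mem PV)
    have \<delta>0: "0 \<le> \<delta>" unfolding \<delta>_def by (rule integral_nonneg_AE[OF AEe])
    have \<delta>: "\<delta> \<le> sqrt T * \<epsilon>"
      unfolding \<delta>_def by (rule order_trans[OF LINT_le_L2_norm[OF T L(2)]]) (intro mult_left_mono L(3), use T in simp)
    have key: "- (LINT t|?M. indicator {0<..<\<tau>} t * a (d t) v) \<le> - a (Q \<tau>) v + (c + 1) * \<delta> * V.nrm v"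
      if v: "v \<in> V" and \<tau>: "0 < \<tau>" "\<tau> < T" for v \<tau>
    proof -
      have i: "integrable ?M (\<lambda>t. indicator {0<..<\<tau>} t * a (d t) v)" "integrable ?M (\<lambda>t. indicator {0<..<\<tau>} t * a (exp_sum L t) v)"
        by (intro integrable_indicator_mult_time L2_space_integrable_time a_L2_space d PL v)+
      have "a (Q \<tau>) v - (LINT t|?M. indicator {0<..<\<tau>} t * a (d t) v)
          = (LINT t|?M. indicator {0<..<\<tau>} t * a (exp_sum L t) v - indicator {0<..<\<tau>} t * a (d t) v)"
        unfolding Q(2)[OF v \<tau>, symmetric] using i by simp
      also have "\<dots> \<le> (LINT t|?M. ((c + 1) * V.nrm v) * V.nrm (\<lambda>i. d t i - exp_sum L t i))"
      proof (rule integral_mono_AE)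
        show "AE t in ?M. indicator {0<..<\<tau>} t * a (exp_sum L t) v - indicator {0<..<\<tau>} t * a (d t) v
            \<le> ((c + 1) * V.nrm v) * V.nrm (\<lambda>i. d t i - exp_sum L t i)"
          using AEd
        proof eventually_elim
          fix t assume dt: "d t \<in> V"
          have "\<bar>a (\<lambda>i. d t i - exp_sum L t i) v\<bar> \<le> (c + 1) * V.nrm (\<lambda>i. d t i - exp_sum L t i) * V.nrm v"
            by (rule a_bounded[OF V.diff_mem[OF dt PV] v])
          then have "\<bar>a (d t) v - a (exp_sum L t) v\<bar> \<le> ((c + 1) * V.nrm v) * V.nrm (\<lambda>i. d t i - exp_sum L t i)"
            unfolding A.ip_diff_left[OF dt PV v] by (simp only: mult_ac)
          then show "indicator {0<..<\<tau>} t * a (exp_sum L t) v - indicator {0<..<\<tau>} t * a (d t) v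
            \<le> ((c + 1) * V.nrm v) * V.nrm (\<lambda>i. d t i - exp_sum L t i)"
            by (cases "t \<in> {0<..<\<tau>}") simp_all
        qed
      qed (intro Bochner_Integration.integrable_diff i integrable_mult_right ie)+
      also have "\<dots> = (c + 1) * \<delta> * V.nrm v" unfolding \<delta>_def by simp
      finally show ?thesis by simp
    qed
    have "(LINT t|?M. (B.nrm (d t))\<^sup>2)
       \<le> (LINT t|?M. (- a (Q t) (exp_sum L t) + (c + 1) * \<delta> * V.nrm (exp_sum L t)) + V.nrm (d t) * V.nrm (\<lambda>i. d t i - exp_sum L t i))"
    proof (rule integral_mono_AE[OF ib])
      show "AE t in ?M. (B.nrm (d t))\<^sup>2 \<le> (- a (Q t) (exp_sum L t) + (c + 1) * \<delta> * V.nrm (exp_sum L t))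
            + V.nrm (d t) * V.nrm (\<lambda>i. d t i - exp_sum L t i)"
        using AEd U(1) AE_space
      proof eventually_elim
        fix t assume t: "d t \<in> V" "H.nrm (\<lambda>i. U t i - d t i) = 0" "t \<in> space ?M"
        then have tT: "0 < t" "t < T" by simp_all
        have UH: "U t \<in> H" using tT by (intro U(2)) simp
        have "b (d t) (exp_sum L t) = b (U t) (exp_sum L t)"
          by (rule b_eq_of_nrm_zero[OF UH V_in_H[OF t(1)] V_in_H[OF PV] t(2), symmetric])
        also have "\<dots> \<le> - a (Q t) (exp_sum L t) + (c + 1) * \<delta> * V.nrm (exp_sum L t)"
          unfolding U(4)[OF PV tT] by (rule key[OF PV tT])
        finally have 1: "b (d t) (exp_sum L t) \<le> \<dots>" .
        have "b (d t) (\<lambda>i. d t i - exp_sum L t i) \<le> V.nrm (d t) * V.nrm (\<lambda>i. d t i - exp_sum L t i)"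
          by (rule order_trans[OF abs_ge_self b_bounded[OF t(1) V.diff_mem[OF t(1) PV]]])
        moreover have "b (d t) (\<lambda>i. d t i - exp_sum L t i) = b (d t) (d t) - b (d t) (exp_sum L t)"
          using B.ip_lin_right[OF t(1) PV t(1), of 1 "- 1"] by simp
        ultimately show "(B.nrm (d t))\<^sup>2 \<le> (- a (Q t) (exp_sum L t) + (c + 1) * \<delta> * V.nrm (exp_sum L t))
            + V.nrm (d t) * V.nrm (\<lambda>i. d t i - exp_sum L t i)"
          unfolding B.nrm_sq[OF t(1)] using 1 by linarith
      qed
      show "integrable ?M (\<lambda>t. (- a (Q t) (exp_sum L t) + (c + 1) * \<delta> * V.nrm (exp_sum L t)) + V.nrm (d t) * V.nrm (\<lambda>i. d t i - exp_sum L t i))"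
        by (intro Bochner_Integration.integrable_add Bochner_Integration.integrable_minus Q(3) integrable_mult_right
            L2_space_integrable_time V.nrm_L2_space[OF PL] L2_space_mult_integrable dL L(2))
    qed
    also have "\<dots> = (- (LINT t|?M. a (Q t) (exp_sum L t)) + (c + 1) * \<delta> * (LINT t|?M. V.nrm (exp_sum L t)))
        + (LINT t|?M. V.nrm (d t) * V.nrm (\<lambda>i. d t i - exp_sum L t i))"
      using Q(3) L2_space_integrable_time[OF V.nrm_L2_space[OF PL]] L2_space_mult_integrable[OF dL L(2)] by simp
    also have "\<dots> \<le> (0 + (c + 1) * (sqrt T * \<epsilon>) * (sqrt T * D + sqrt T)) + D * \<epsilon>"
    proof (intro add_mono L(4) mult_mono)
      have "(LINT t|?M. V.nrm (exp_sum L t)) \<le> (LINT t|?M. V.nrm (d t) + V.nrm (\<lambda>i. d t i - exp_sum L t i))"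
      proof (rule integral_mono_AE)
        show "AE t in ?M. V.nrm (exp_sum L t) \<le> V.nrm (d t) + V.nrm (\<lambda>i. d t i - exp_sum L t i)"
          using AEd
        proof eventually_elim
          fix t assume dt: "d t \<in> V"
          show "V.nrm (exp_sum L t) \<le> V.nrm (d t) + V.nrm (\<lambda>i. d t i - exp_sum L t i)"
            using V.nrm_le_diff[OF PV dt] V.nrm_diff_commute[OF PV dt] by simp
        qed
      qed (intro L2_space_integrable_time V.nrm_L2_space[OF PL] Bochner_Integration.integrable_add dL L(2))+
      also have "\<dots> = (LINT t|?M. V.nrm (d t)) + \<delta>"
        unfolding \<delta>_def by (rule Bochner_Integration.integral_add[OF L2_space_integrable_time[OF dL] ie])
      also have "\<dots> \<le> sqrt T * D + sqrt T * \<epsilon>"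
        unfolding D_def by (intro add_mono LINT_le_L2_norm[OF T dL] \<delta>)
      also have "\<dots> \<le> sqrt T * D + sqrt T" using e T by (simp add: mult_left_le)
      finally show "(LINT t|?M. V.nrm (exp_sum L t)) \<le> sqrt T * D + sqrt T" .
      show "0 \<le> (LINT t|?M. V.nrm (exp_sum L t))" by (intro integral_nonneg_AE AE_I2 V.nrm_nonneg PV)
    qed (use Q(4) \<delta> \<delta>0 c T e in simp_all)
    also have "\<dots> = \<epsilon> * ?C" by (simp add: algebra_simps)
    finally show "(LINT t|?M. (B.nrm (d t))\<^sup>2) \<le> \<epsilon> * ?C" .
  qed
  then have "(LINT t|?M. (B.nrm (d t))\<^sup>2) = 0" by (intro antisym) (simp_all add: integral_nonneg)
  then have Bd: "AE t in ?M. (B.nrm (d t))\<^sup>2 = 0"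
    by (subst (asm) integral_nonneg_eq_0_iff_AE[OF ib]) simp_all
  have Uzero: "b (U \<tau>) v = 0" if v: "v \<in> V" and \<tau>: "0 < \<tau>" "\<tau> < T" for v \<tau>
  proof -
    have c2: "continuous_on {0..T} (\<lambda>t. (b (U t) v)\<^sup>2)" by (rule continuous_on_power[OF U(3)[OF v]])
    have "AE t in ?M. (b (U t) v)\<^sup>2 = 0"
      using Bd U(1) AEd AE_space
    proof eventually_elim
      fix t assume t: "(B.nrm (d t))\<^sup>2 = 0" "H.nrm (\<lambda>i. U t i - d t i) = 0" "d t \<in> V" "t \<in> space ?M"
      have UH: "U t \<in> H" using t(4) by (intro U(2)) simp
      have "b (U t) v = b (d t) v" by (rule b_eq_of_nrm_zero[OF UH V_in_H[OF t(3)] V_in_H[OF v] t(2)])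
      moreover have "\<bar>b (d t) v\<bar> \<le> B.nrm (d t) * B.nrm v" by (rule B.cauchy_schwarz[OF t(3) v])
      ultimately show "(b (U t) v)\<^sup>2 = 0" using t(1) by simp
    qed
    then have "(LINT t|?M. (b (U t) v)\<^sup>2) = 0" by (rule integral_eq_zero_AE)
    then have "((\<lambda>t. (b (U t) v)\<^sup>2) has_integral 0) {0..T}"
      unfolding LINT_time_eq_integral[OF c2] using integrable_integral[OF integrable_continuous_real[OF c2]] by simp
    then have "(b (U \<tau>) v)\<^sup>2 = 0"
      using has_integral_0_cbox_imp_0[of 0 T "\<lambda>t. (b (U t) v)\<^sup>2" \<tau>] c2 T \<tau> by simp
    then show ?thesis by simp
  qed
  \<comment> \<open>The remaining stationary equation \<open>a (d t) v = 0\<close> is tested with approximations of \<open>d\<close>.\<close>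
  have orth: "(LINT t|?M. exp (l * t) * a (d t) v) = 0" if v: "v \<in> V" for l v
  proof (rule zero_primitive_orthogonal[OF T L2_space_integrable_time[OF a_L2_space[OF d v]]])
    show "(LINT t|?M. indicator {0<..<\<tau>} t * a (d t) v) = 0" if "0 < \<tau>" "\<tau> < T" for \<tau>
      using U(4)[OF v that] Uzero[OF v that] by simp
    show "continuous_on {0..T} (\<lambda>t. exp (l * t))" by (intro continuous_intros)
  qed
  have "(LINT t|?M. (A.nrm (d t))\<^sup>2) \<le> 0"
  proof (rule small_multiples_nonpos)
    show "0 \<le> (c + 1) * D" using c D by simp
    fix \<epsilon> :: real assume e: "0 < \<epsilon>" "\<epsilon> \<le> 1"
    obtain L where L: "exp_list V L" "(\<lambda>t. V.nrm (\<lambda>i. d t i - exp_sum L t i)) \<in> L2_space ?M"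
      "(LINT t|?M. V.nrm (d t) * V.nrm (\<lambda>i. d t i - exp_sum L t i)) \<le> D * \<epsilon>"
      using approx[OF e(1)] by blast
    have PV: "exp_sum L t \<in> V" for t by (rule V.exp_sum_mem[OF L(1)])
    have "\<exists>R. integrable ?M R \<and> (LINT t|?M. R t) = 0 \<and> (\<forall>t. d t \<in> V \<longrightarrow> R t = a (exp_sum L t) (d t))"
      using L(1)
    proof (induction rule: exp_list_induct)
      case Nil
      show ?case by (intro exI[of _ "\<lambda>t. 0"]) (simp add: exp_sum_Nil A.ip_zero_left)
    next
      case (Cons l x L)
      then obtain R where R: "integrable ?M R" "(LINT t|?M. R t) = 0" "\<And>t. d t \<in> V \<Longrightarrow> R t = a (exp_sum L t) (d t)"
        by blast
      have i: "integrable ?M (\<lambda>t. exp (l * t) * a (d t) x)"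
        by (intro L2_space_mult_integrable continuous_L2_space a_L2_space d Cons continuous_intros)
      have "exp (l * t) * a (d t) x + R t = a (exp_sum ((l, x) # L) t) (d t)" if "d t \<in> V" for t
        unfolding A.ip_exp_sum_Cons[OF Cons(2,3) that] R(3)[OF that] A.ip_sym[OF that Cons(2)] ..
      moreover have "(LINT t|?M. exp (l * t) * a (d t) x + R t) = 0"
        using i R(1,2) orth[OF Cons(2)] by simp
      ultimately show ?case using Bochner_Integration.integrable_add[OF i R(1)]
        by (intro exI[of _ "\<lambda>t. exp (l * t) * a (d t) x + R t"] conjI allI impI)
    qed
    then obtain R where R: "integrable ?M R" "(LINT t|?M. R t) = 0" "\<And>t. d t \<in> V \<Longrightarrow> R t = a (exp_sum L t) (d t)"
      by blast
    have i2: "integrable ?M (\<lambda>t. V.nrm (d t) * V.nrm (\<lambda>i. d t i - exp_sum L t i))"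
      by (rule L2_space_mult_integrable[OF dL L(2)])
    have "(LINT t|?M. (A.nrm (d t))\<^sup>2) \<le> (LINT t|?M. R t + (c + 1) * (V.nrm (d t) * V.nrm (\<lambda>i. d t i - exp_sum L t i)))"
    proof (rule integral_mono_AE[OF ia])
      show "AE t in ?M. (A.nrm (d t))\<^sup>2 \<le> R t + (c + 1) * (V.nrm (d t) * V.nrm (\<lambda>i. d t i - exp_sum L t i))"
        using AEd
      proof eventually_elim
        fix t assume dt: "d t \<in> V"
        have "a (\<lambda>i. d t i - exp_sum L t i) (d t) \<le> (c + 1) * V.nrm (\<lambda>i. d t i - exp_sum L t i) * V.nrm (d t)"
          by (rule order_trans[OF abs_ge_self a_bounded[OF V.diff_mem[OF dt PV] dt]])
        then have "a (d t) (d t) - a (exp_sum L t) (d t) \<le> (c + 1) * (V.nrm (d t) * V.nrm (\<lambda>i. d t i - exp_sum L t i))"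
          unfolding A.ip_diff_left[OF dt PV dt] by (simp only: mult_ac)
        then show "(A.nrm (d t))\<^sup>2 \<le> R t + (c + 1) * (V.nrm (d t) * V.nrm (\<lambda>i. d t i - exp_sum L t i))"
          unfolding A.nrm_sq[OF dt] R(3)[OF dt] by linarith
      qed
      show "integrable ?M (\<lambda>t. R t + (c + 1) * (V.nrm (d t) * V.nrm (\<lambda>i. d t i - exp_sum L t i)))"
        by (intro Bochner_Integration.integrable_add R(1) integrable_mult_right i2)
    qed
    also have "\<dots> = (c + 1) * (LINT t|?M. V.nrm (d t) * V.nrm (\<lambda>i. d t i - exp_sum L t i))"
      using R(1,2) i2 by simp
    also have "\<dots> \<le> (c + 1) * (D * \<epsilon>)" using c by (intro mult_left_mono L(3)) simp
    finally show "(LINT t|?M. (A.nrm (d t))\<^sup>2) \<le> \<epsilon> * ((c + 1) * D)" by (simp add: mult_ac)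
  qed
  then have "(LINT t|?M. (A.nrm (d t))\<^sup>2) = 0" by (intro antisym) (simp_all add: integral_nonneg)
  then have Ad: "AE t in ?M. (A.nrm (d t))\<^sup>2 = 0"
    by (subst (asm) integral_nonneg_eq_0_iff_AE[OF ia]) simp_all
  show ?thesis
    unfolding d_def[symmetric] using Ad Bd AEd
  proof eventually_elim
    fix t assume t: "(A.nrm (d t))\<^sup>2 = 0" "(B.nrm (d t))\<^sup>2 = 0" "d t \<in> V"
    then have "a (d t) (d t) = 0" "b (d t) (d t) = 0" by simp_all
    then have "ipV (d t) (d t) \<le> 0" using coercive[OF t(3)] by simp
    then show "V.nrm (d t) = 0" using V.ip_nonneg[OF t(3)] by simp
  qed
qed

end

section \<open>The fractional Robin space\<close>

lemma semi_inner_space_pullback: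
  assumes f: "semi_inner_space Y f" and zero: "(\<lambda>i. 0) \<in> X"
    and lin: "\<And>v w a b. v \<in> X \<Longrightarrow> w \<in> X \<Longrightarrow> (\<lambda>i. a * v i + b * w i) \<in> X"
    and \<Phi>: "\<And>v. v \<in> X \<Longrightarrow> \<Phi> v \<in> Y"
    and \<Phi>lin: "\<And>v w a b. \<Phi> (\<lambda>i. a * v i + b * w i) = (\<lambda>j. a * \<Phi> v j + b * \<Phi> w j)"
  shows "semi_inner_space X (\<lambda>v w. f (\<Phi> v) (\<Phi> w))"
proof -
  interpret f: semi_inner_space Y f by fact
  show ?thesis
  proof
    show "f (\<Phi> (\<lambda>i. a * v i + b * w i)) (\<Phi> y) = a * f (\<Phi> v) (\<Phi> y) + b * f (\<Phi> w) (\<Phi> y)"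
      if "v \<in> X" "w \<in> X" "y \<in> X" for v w y a b
      unfolding \<Phi>lin by (rule f.ip_lin[OF \<Phi>[OF that(1)] \<Phi>[OF that(2)] \<Phi>[OF that(3)]])
    show "f (\<Phi> v) (\<Phi> w) = f (\<Phi> w) (\<Phi> v)" if "v \<in> X" "w \<in> X" for v w
      by (rule f.ip_sym[OF \<Phi>[OF that(1)] \<Phi>[OF that(2)]])
    show "0 \<le> f (\<Phi> v) (\<Phi> v)" if "v \<in> X" for v by (rule f.ip_nonneg[OF \<Phi>[OF that]])
  qed (rule zero, rule lin)
qed

lemma L2_norm_zero_AE:
  assumes "f \<in> L2_space M" "L2_norm M f = 0" shows "AE x in M. f x = 0"
proof -
  have "(LINT x|M. (f x)\<^sup>2) = 0" using L2_norm_sq[of M f] assms(2) by simp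
  then have "AE x in M. (f x)\<^sup>2 = 0"
    by (subst (asm) integral_nonneg_eq_0_iff_AE[OF L2_spaceD(2)[OF assms(1)]]) simp_all
  then show ?thesis by eventually_elim simp
qed

lemma L2_norm_eq_0_AE:
  assumes "AE x in M. f x = 0" shows "L2_norm M f = 0"
proof -
  have "AE x in M. (f x)\<^sup>2 = 0" using assms by eventually_elim simp
  then show ?thesis unfolding L2_norm_def by (simp add: integral_eq_zero_AE)
qed

lemma L2_norm_zero_iff:
  assumes "f \<in> L2_space M" shows "L2_norm M f = 0 \<longleftrightarrow> (AE x in M. f x = 0)"
  by (rule iffI, erule L2_norm_zero_AE[OF assms], erule L2_norm_eq_0_AE)

lemma sigma_finite_lebesgue: "sigma_finite_measure (lebesgue :: 'a::euclidean_space measure)"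
proof
  show "\<exists>A::'a set set. countable A \<and> A \<subseteq> sets lebesgue \<and> \<Union> A = space lebesgue \<and> (\<forall>a\<in>A. emeasure lebesgue a \<noteq> \<infinity>)"
  proof (intro exI[of _ "range (\<lambda>n. cball 0 (real n))"] conjI ballI)
    show "\<Union> (range (\<lambda>n. cball (0::'a) (real n))) = space lebesgue"
      using real_arch_simple by auto
    show "emeasure lebesgue a \<noteq> \<infinity>" if a: "a \<in> range (\<lambda>n. cball (0::'a) (real n))" for a
    proof -
      obtain n where "a = cball 0 (real n)" using a by blast
      then show ?thesis using emeasure_bounded_finite[of "cball (0::'a) (real n)"] by simp
    qed
  qed auto
qed

interpretation lebesgue_pair: pair_sigma_finite "lebesgue :: 'a::euclidean_space measure" "lebesgue :: 'a measure"
  by (intro pair_sigma_finite.intro sigma_finite_lebesgue)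

abbreviation plane :: "('a::euclidean_space \<times> 'a) measure" where
  "plane \<equiv> lebesgue \<Otimes>\<^sub>M lebesgue"

text \<open>A property of almost every point of \<open>\<Omega>\<close> passes to almost every point of the space along
  almost every pair of the cross region, because \<open>\<Omega>\<close> is not negligible.\<close>

lemma AE_from_domain:
  fixes \<Omega> :: "'a::euclidean_space set"
  assumes \<Omega>: "open \<Omega>" "\<Omega> \<noteq> {}"
    and A: "AE x in lebesgue_on \<Omega>. A x" and B: "AE p in plane. B p"
    and AB: "\<And>x y. x \<notin> \<Omega> \<Longrightarrow> y \<in> \<Omega> \<Longrightarrow> A y \<Longrightarrow> B (x, y) \<Longrightarrow> A x"
  shows "AE x in lebesgue. A x"
proof -
  have \<Omega>m: "\<Omega> \<in> sets lebesgue" using \<Omega>(1) by simp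
  have A': "AE x in lebesgue. x \<in> \<Omega> \<longrightarrow> A x" using A \<Omega>m by (simp add: AE_restrict_space_iff)
  have "AE x in lebesgue. AE y in lebesgue. B (x, y)" by (rule lebesgue_pair.AE_pair[OF B])
  with A' show ?thesis
  proof eventually_elim
    fix x assume x: "x \<in> \<Omega> \<longrightarrow> A x" and y: "AE y in lebesgue. B (x, y)"
    show "A x"
    proof (rule ccontr)
      assume n: "\<not> A x"
      have "AE y in lebesgue. y \<notin> \<Omega>"
        using A' y
      proof eventually_elim
        fix y assume "y \<in> \<Omega> \<longrightarrow> A y" "B (x, y)"
        then show "y \<notin> \<Omega>" using AB[of x y] x n by blast
      qed
      then have "\<Omega> \<in> null_sets lebesgue" using \<Omega>m by (simp add: AE_iff_null_sets)
      then have "negligible \<Omega>" by (simp add: negligible_iff_null_sets)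
      then show False using open_not_negligible[OF \<Omega>] by blast
    qed
  qed
qed

lemma AE_plane_of_AE:
  assumes "AE x in (lebesgue :: 'a::euclidean_space measure). A x"
  shows "AE p in plane. A (fst p) \<and> A (snd p)"
proof -
  obtain N where N: "{x \<in> space lebesgue. \<not> A x} \<subseteq> N" "N \<in> null_sets lebesgue"
    using assms unfolding eventually_ae_filter by blast
  have Nn: "N \<times> space (lebesgue :: 'a measure) \<union> space (lebesgue :: 'a measure) \<times> N \<in> null_sets plane"
    by (intro null_sets.Un sigma_finite_measure.times_in_null_sets1[OF sigma_finite_lebesgue]
        sigma_finite_measure.times_in_null_sets2[OF sigma_finite_lebesgue] N sets.top)
  show ?thesis
    by (rule AE_I'[OF Nn]) (use N(1) in auto)
qed

text \<open>The square root of the Gagliardo integrand, with the sign of \<open>u x - u y\<close>: it is linear in \<open>u\<close> and turns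
  the Gagliardo form into an inner product of \<open>L\<^sup>2\<close>.\<close>

definition difference_quotient :: "'a::euclidean_space set \<Rightarrow> real \<Rightarrow> ('a \<Rightarrow> real) \<Rightarrow> 'a \<times> 'a \<Rightarrow> real" where
  "difference_quotient \<Omega> s u p = indicator (cross_region \<Omega>) p *
     ((u (fst p) - u (snd p)) / norm (fst p - snd p) powr ((real DIM('a) + 2 * s) / 2))"

lemma difference_quotient_lin:
  "difference_quotient \<Omega> s (\<lambda>i. a * v i + b * w i) =
     (\<lambda>p. a * difference_quotient \<Omega> s v p + b * difference_quotient \<Omega> s w p)"
  by (simp add: difference_quotient_def fun_eq_iff diff_divide_distrib add_divide_distrib algebra_simps)

lemma difference_quotient_mult:
  "difference_quotient \<Omega> s u p * difference_quotient \<Omega> s v p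
     = indicator (cross_region \<Omega>) p *\<^sub>R gagliardo_integrand s u v p"
proof -
  obtain x y where p: "p = (x, y)" by (cases p)
  have "r powr (q / 2) * r powr (q / 2) = r powr q" for r q :: real
    by (simp add: powr_add[symmetric])
  then show ?thesis unfolding p difference_quotient_def gagliardo_integrand_def
    by (simp add: indicator_def)
qed

lemma gagliardo_form_eq:
  "gagliardo_form \<Omega> s u v = (LINT p|plane. difference_quotient \<Omega> s u p * difference_quotient \<Omega> s v p)"
  unfolding gagliardo_form_def set_lebesgue_integral_def difference_quotient_mult ..

lemma difference_quotient_measurable:
  fixes \<Omega> :: "'a::euclidean_space set"
  assumes "open \<Omega>" and u: "u \<in> borel_measurable lebesgue"
  shows "difference_quotient \<Omega> s u \<in> borel_measurable plane"
proof -
  have O: "\<Omega> \<in> sets lebesgue" "- \<Omega> \<in> sets lebesgue" using assms(1) by (simp_all add: Compl_in_sets_lebesgue)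
  have cr: "cross_region \<Omega> \<in> sets plane"
    unfolding cross_region_def by (intro sets.Un pair_measureI O)
  have uf: "(\<lambda>p. u (fst p)) \<in> borel_measurable plane" and us: "(\<lambda>p. u (snd p)) \<in> borel_measurable plane"
    by (rule measurable_compose[OF measurable_fst u], rule measurable_compose[OF measurable_snd u])
  have id: "(\<lambda>x::'a. x) \<in> borel_measurable lebesgue" by (simp add: measurable_completion)
  have f: "(\<lambda>p. fst p) \<in> borel_measurable (plane :: ('a \<times> 'a) measure)" and g: "(\<lambda>p. snd p) \<in> borel_measurable (plane :: ('a \<times> 'a) measure)"
    by (rule measurable_compose[OF measurable_fst id], rule measurable_compose[OF measurable_snd id])
  have n: "(\<lambda>p. norm (fst p - snd p)) \<in> borel_measurable (plane :: ('a \<times> 'a) measure)"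
    by (rule measurable_compose[OF borel_measurable_diff[OF f g] borel_measurable_norm])
  have "(\<lambda>p. indicator (cross_region \<Omega>) p *
     ((u (fst p) - u (snd p)) / norm (fst p - snd p) powr ((real DIM('a) + 2 * s) / 2))) \<in> borel_measurable plane"
    by (intro borel_measurable_times borel_measurable_indicator cr borel_measurable_divide borel_measurable_diff uf us
        powr_real_measurable n borel_measurable_const)
  then show ?thesis unfolding difference_quotient_def[abs_def] .
qed

locale robin_data =
  fixes \<Omega> :: "'a::euclidean_space set" and s :: real and \<kappa> :: "'a \<Rightarrow> real"
  assumes s: "0 < s" "s < 1" and \<Omega>: "open \<Omega>" "\<Omega> \<noteq> {}"
    and \<kappa>: "integrable (lebesgue_on (- \<Omega>)) \<kappa>" "AE x in lebesgue_on (- \<Omega>). 0 \<le> \<kappa> x"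
begin

abbreviation "D \<equiv> difference_quotient \<Omega> s"
abbreviation "bf u v \<equiv> LINT x|lebesgue_on \<Omega>. u x * v x"
abbreviation "kf u v \<equiv> LINT x|robin_measure \<Omega> \<kappa>. u x * v x"

lemma sets_\<Omega>: "\<Omega> \<in> sets lebesgue" "- \<Omega> \<in> sets lebesgue"
  using \<Omega>(1) by (simp_all add: Compl_in_sets_lebesgue)

lemma measurable_robin: "borel_measurable (robin_measure \<Omega> \<kappa>) = borel_measurable (lebesgue_on (- \<Omega>))"
  by (rule measurable_cong_sets) (simp_all add: robin_measure_def)

lemma robin_space_iff:
  "u \<in> robin_space \<Omega> s \<kappa> \<longleftrightarrow> u \<in> borel_measurable lebesgue \<and> u \<in> L2_space (lebesgue_on \<Omega>) \<and>
     u \<in> L2_space (robin_measure \<Omega> \<kappa>) \<and> D u \<in> L2_space plane"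
proof -
  have sq: "(\<lambda>p. (D u p)\<^sup>2) = (\<lambda>p. indicator (cross_region \<Omega>) p *\<^sub>R gagliardo_integrand s u u p)"
    by (simp only: power2_eq_square difference_quotient_mult)
  have "u \<in> borel_measurable (lebesgue_on S)" if "u \<in> borel_measurable lebesgue" for S
    using that by (rule measurable_restrict_space1)
  moreover have "D u \<in> borel_measurable plane" if "u \<in> borel_measurable lebesgue"
    by (rule difference_quotient_measurable[OF \<Omega>(1) that])
  ultimately show ?thesis
    unfolding robin_space_def L2_space_def set_integrable_def sq measurable_robin mem_Collect_eq by blast
qed

lemma robin_space_lin:
  assumes "v \<in> robin_space \<Omega> s \<kappa>" "w \<in> robin_space \<Omega> s \<kappa>"
  shows "(\<lambda>i. a * v i + b * w i) \<in> robin_space \<Omega> s \<kappa>"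
proof -
  have "(\<lambda>i. a * v i + b * w i) \<in> borel_measurable lebesgue"
    using assms unfolding robin_space_iff
    by (intro borel_measurable_add borel_measurable_times borel_measurable_const) blast+
  then show ?thesis
    using assms unfolding robin_space_iff difference_quotient_lin by (intro conjI L2_space_lin) blast+
qed

lemma robin_space_zero: "(\<lambda>i. 0) \<in> robin_space \<Omega> s \<kappa>"
proof -
  have "D (\<lambda>i. 0) = (\<lambda>p. 0)" by (simp add: difference_quotient_def fun_eq_iff)
  then show ?thesis unfolding robin_space_iff by (simp add: L2_space_def)
qed

lemma robin_spaceD:
  assumes "u \<in> robin_space \<Omega> s \<kappa>"
  shows "u \<in> L2_space (lebesgue_on \<Omega>)" "u \<in> L2_space (robin_measure \<Omega> \<kappa>)" "D u \<in> L2_space plane"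
  using assms unfolding robin_space_iff by blast+

lemma gagliardo_semi_inner: "semi_inner_space (robin_space \<Omega> s \<kappa>) (gagliardo_form \<Omega> s)"
proof -
  have "semi_inner_space (robin_space \<Omega> s \<kappa>) (\<lambda>u v. LINT p|plane. D u p * D v p)"
    by (rule semi_inner_space_pullback[OF L2_space_semi_inner robin_space_zero robin_space_lin robin_spaceD(3) difference_quotient_lin])
  then show ?thesis by (simp only: gagliardo_form_eq[abs_def])
qed

lemma norm_squares:
  "L2_norm (lebesgue_on \<Omega>) u = sqrt (bf u u)" "L2_norm (robin_measure \<Omega> \<kappa>) u = sqrt (kf u u)"
  "L2_norm plane (D u) = sqrt (gagliardo_form \<Omega> s u u)"
  by (simp_all add: L2_norm_eq gagliardo_form_eq)

lemma form_squares:
  "bf u u = (L2_norm (lebesgue_on \<Omega>) u)\<^sup>2" "kf u u = (L2_norm (robin_measure \<Omega> \<kappa>) u)\<^sup>2"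
  "gagliardo_form \<Omega> s u u = (L2_norm plane (D u))\<^sup>2"
  by (simp_all add: L2_norm_sq gagliardo_form_eq power2_eq_square[symmetric])

lemma robin_norm_eq: "robin_norm \<Omega> s \<kappa> u = sqrt (bf u u + kf u u + gagliardo_form \<Omega> s u u)"
  unfolding robin_norm_def form_squares ..

text \<open>An absolutely summable series converges almost everywhere in \<open>\<Omega>\<close>, and its difference quotients converge
  for almost every pair. The values outside \<open>\<Omega>\<close> therefore converge as well, and the pointwise sum is
  the limit for each of the three parts of the norm.\<close>

lemma robin_space_complete: "abs_complete (robin_space \<Omega> s \<kappa>) (\<lambda>u. sqrt (bf u u + kf u u + gagliardo_form \<Omega> s u u))"
  unfolding abs_complete_def
proof (intro allI impI, elim conjE)
  let ?V = "robin_space \<Omega> s \<kappa>" and ?N = "\<lambda>u. sqrt (bf u u + kf u u + gagliardo_form \<Omega> s u u)"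
  fix d :: "nat \<Rightarrow> 'a \<Rightarrow> real"
  assume "\<forall>n. d n \<in> ?V" and sN: "summable (\<lambda>n. ?N (d n))"
  then have d: "d n \<in> borel_measurable lebesgue" "d n \<in> L2_space (lebesgue_on \<Omega>)"
    "d n \<in> L2_space (robin_measure \<Omega> \<kappa>)" "D (d n) \<in> L2_space plane" for n
    unfolding robin_space_iff by blast+
  have le: "L2_norm (lebesgue_on \<Omega>) u \<le> ?N u" "L2_norm (robin_measure \<Omega> \<kappa>) u \<le> ?N u" "L2_norm plane (D u) \<le> ?N u" for u
    unfolding form_squares by (intro real_le_rsqrt, simp)+
  have sB: "summable (\<lambda>n. L2_norm (lebesgue_on \<Omega>) (d n))" and sK: "summable (\<lambda>n. L2_norm (robin_measure \<Omega> \<kappa>) (d n))"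
    and sD: "summable (\<lambda>n. L2_norm plane (D (d n)))"
    by (rule summable_comparison_test'[OF sN, of 0], simp only: real_norm_def abs_of_nonneg[OF L2_norm_nonneg] le)+
  define u where "u x = (\<Sum>n. d n x)" for x
  have AEs: "AE x in lebesgue. summable (\<lambda>n. \<bar>d n x\<bar>)"
  proof (rule AE_from_domain[OF \<Omega> L2_space_summable(1)[OF d(2) sB] L2_space_summable(1)[OF d(4) sD]])
    fix x y assume xy: "x \<notin> \<Omega>" "y \<in> \<Omega>" and y: "summable (\<lambda>n. \<bar>d n y\<bar>)" and q: "summable (\<lambda>n. \<bar>D (d n) (x, y)\<bar>)"
    define r where "r = norm (x - y) powr ((real DIM('a) + 2 * s) / 2)"
    have r: "0 < r" using xy by (auto simp: r_def)
    have cr: "(x, y) \<in> cross_region \<Omega>" using xy by (simp add: cross_region_def)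
    have "d n x = r * D (d n) (x, y) + d n y" for n
      using r cr by (simp add: difference_quotient_def r_def[symmetric])
    then have "\<bar>d n x\<bar> \<le> r * \<bar>D (d n) (x, y)\<bar> + \<bar>d n y\<bar>" for n
      using abs_triangle_ineq[of "r * D (d n) (x, y)" "d n y"] r by (simp add: abs_mult)
    then show "summable (\<lambda>n. \<bar>d n x\<bar>)"
      by (intro summable_comparison_test'[OF summable_add[OF summable_mult[OF q, of r] y], of 0]) simp
  qed
  have um: "u \<in> borel_measurable lebesgue" unfolding u_def[abs_def] by (rule borel_measurable_suminf[OF d(1)])
  have uB: "u \<in> L2_space (lebesgue_on \<Omega>)" "(\<lambda>n. L2_norm (lebesgue_on \<Omega>) (\<lambda>x. u x - (\<Sum>j<n. d j x))) \<longlonglongrightarrow> 0"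
    unfolding u_def[abs_def] by (rule L2_space_summable(2)[OF d(2) sB], rule L2_space_summable(3)[OF d(2) sB])
  have uK: "u \<in> L2_space (robin_measure \<Omega> \<kappa>)" "(\<lambda>n. L2_norm (robin_measure \<Omega> \<kappa>) (\<lambda>x. u x - (\<Sum>j<n. d j x))) \<longlonglongrightarrow> 0"
    unfolding u_def[abs_def] by (rule L2_space_summable(2)[OF d(3) sK], rule L2_space_summable(3)[OF d(3) sK])
  define v where "v p = (\<Sum>n. D (d n) p)" for p
  have v: "v \<in> L2_space plane" "(\<lambda>n. L2_norm plane (\<lambda>p. v p - (\<Sum>j<n. D (d j) p))) \<longlonglongrightarrow> 0"
    unfolding v_def[abs_def] by (rule L2_space_summable(2)[OF d(4) sD], rule L2_space_summable(3)[OF d(4) sD])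
  have vu: "AE p in plane. D u p = v p"
    using AE_plane_of_AE[OF AEs]
  proof eventually_elim
    fix p :: "'a \<times> 'a" assume p: "summable (\<lambda>n. \<bar>d n (fst p)\<bar>) \<and> summable (\<lambda>n. \<bar>d n (snd p)\<bar>)"
    note sm = summable_rabs_cancel[OF conjunct1[OF p]] summable_rabs_cancel[OF conjunct2[OF p]]
    define r where "r = norm (fst p - snd p) powr ((real DIM('a) + 2 * s) / 2)"
    have "v p = (\<Sum>n. indicator (cross_region \<Omega>) p / r * (d n (fst p) - d n (snd p)))"
      unfolding v_def difference_quotient_def r_def[symmetric] by simp
    also have "\<dots> = indicator (cross_region \<Omega>) p / r * ((\<Sum>n. d n (fst p)) - (\<Sum>n. d n (snd p)))"
      unfolding suminf_diff[OF sm] by (rule suminf_mult[OF summable_diff[OF sm]])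
    also have "\<dots> = D u p" unfolding difference_quotient_def r_def[symmetric] u_def by simp
    finally show "D u p = v p" by simp
  qed
  have Dum: "D u \<in> borel_measurable plane" by (rule difference_quotient_measurable[OF \<Omega>(1) um])
  have "integrable plane (\<lambda>p. (D u p)\<^sup>2)"
  proof (rule Bochner_Integration.integrable_bound[OF L2_spaceD(2)[OF v(1)]])
    show "AE p in plane. norm ((D u p)\<^sup>2) \<le> norm ((v p)\<^sup>2)" using vu by eventually_elim simp
  qed (rule borel_measurable_power[OF Dum])
  then have DuL: "D u \<in> L2_space plane" using Dum by (simp add: L2_space_def)
  have uV: "u \<in> ?V" unfolding robin_space_iff using um uB(1) uK(1) DuL by blast
  have Dsum: "D (\<lambda>x. u x - (\<Sum>j<n. d j x)) p = D u p - (\<Sum>j<n. D (d j) p)" for n p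
  proof (induction n)
    case (Suc n)
    have "D (\<lambda>x. u x - (\<Sum>j<Suc n. d j x)) = D (\<lambda>x. 1 * (u x - (\<Sum>j<n. d j x)) + (- 1) * d n x)" by (simp add: algebra_simps)
    then show ?case unfolding difference_quotient_lin using Suc by simp
  qed simp
  have uD: "(\<lambda>n. L2_norm plane (D (\<lambda>x. u x - (\<Sum>j<n. d j x)))) \<longlonglongrightarrow> 0"
  proof -
    have Sm: "(\<lambda>p. \<Sum>j<n. D (d j) p) \<in> borel_measurable plane" for n
      by (intro borel_measurable_sum L2_spaceD(1)[OF d(4)])
    have "L2_norm plane (D (\<lambda>x. u x - (\<Sum>j<n. d j x))) = L2_norm plane (\<lambda>p. v p - (\<Sum>j<n. D (d j) p))" for n
      unfolding L2_norm_def Dsum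
    proof (intro arg_cong[where f=sqrt] integral_cong_AE)
      show "AE p in plane. (D u p - (\<Sum>j<n. D (d j) p))\<^sup>2 = (v p - (\<Sum>j<n. D (d j) p))\<^sup>2"
        using vu by eventually_elim simp
    qed (intro borel_measurable_power borel_measurable_diff Sm Dum L2_spaceD(1)[OF v(1)])+
    then show ?thesis using v(2) by simp
  qed
  have "(\<lambda>n. ?N (\<lambda>i. u i - (\<Sum>j<n. d j i))) \<longlonglongrightarrow> sqrt (0\<^sup>2 + 0\<^sup>2 + 0\<^sup>2)"
    unfolding form_squares by (intro tendsto_real_sqrt tendsto_add tendsto_power uB uK uD)
  then show "\<exists>u\<in>?V. (\<lambda>n. ?N (\<lambda>i. u i - (\<Sum>j<n. d j i))) \<longlonglongrightarrow> 0" using uV by (intro bexI[of _ u]) simp_all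
qed

lemma frac_const_pos: "0 < frac_const TYPE('a) s / 2"
proof -
  have "0 < (2 * s + real DIM('a)) / 2" using s by (simp add: add_pos_nonneg)
  then show ?thesis unfolding frac_const_def using s by (simp add: Gamma_real_pos)
qed

sublocale P: degenerate_parabolic "robin_space \<Omega> s \<kappa>" "L2_space (lebesgue_on \<Omega>)" "L2_space (robin_measure \<Omega> \<kappa>)"
  bf kf "gagliardo_form \<Omega> s" "frac_const TYPE('a) s / 2"
proof (rule degenerate_parabolic.intro)
  show "abs_complete (L2_space (lebesgue_on \<Omega>)) (\<lambda>v. sqrt (bf v v))"
    using L2_space_complete[of "lebesgue_on \<Omega>"] unfolding norm_squares(1)[abs_def] .
  show "robin_space \<Omega> s \<kappa> \<subseteq> L2_space (lebesgue_on \<Omega>)" "robin_space \<Omega> s \<kappa> \<subseteq> L2_space (robin_measure \<Omega> \<kappa>)"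
    using robin_spaceD by blast+
qed (rule L2_space_semi_inner gagliardo_semi_inner robin_space_complete frac_const_pos)+

lemma norm_eqs:
  "(\<lambda>v. sqrt (P.ipV v v)) = robin_norm \<Omega> s \<kappa>" "(\<lambda>v. sqrt (bf v v)) = L2_norm (lebesgue_on \<Omega>)"
  "(\<lambda>v. sqrt (kf v v)) = L2_norm (robin_measure \<Omega> \<kappa>)"
  by (simp_all add: fun_eq_iff P.ipV_def robin_norm_eq norm_squares)

lemma robin_integral:
  assumes "f \<in> L2_space (robin_measure \<Omega> \<kappa>)" "g \<in> L2_space (robin_measure \<Omega> \<kappa>)"
  shows "(LINT x|lebesgue_on (- \<Omega>). \<kappa> x * f x * g x) = kf f g"
proof -
  have "f \<in> borel_measurable (lebesgue_on (- \<Omega>))" "g \<in> borel_measurable (lebesgue_on (- \<Omega>))"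
    using L2_spaceD(1)[OF assms(1)] L2_spaceD(1)[OF assms(2)] by (simp_all add: measurable_robin)
  from borel_measurable_times[OF this]
  have "kf f g = (LINT x|lebesgue_on (- \<Omega>). \<kappa> x *\<^sub>R (f x * g x))"
    unfolding robin_measure_def by (rule integral_density[OF _ borel_measurable_integrable[OF \<kappa>(1)] \<kappa>(2)])
  then show ?thesis by (simp add: mult.assoc)
qed

text \<open>The two notions differ in the integrals with density \<open>\<kappa>\<close>, which agree at the times where \<open>u t\<close> and \<open>z t\<close> are in
  their spaces, and in equality almost everywhere, which is distance 0 in \<open>L\<^sup>2(\<Omega>)\<close>.\<close>

lemma weak_solution_iff:
  assumes T: "0 < T"
    and z: "z \<in> bochner_L2 (time_measure T) (L2_space (robin_measure \<Omega> \<kappa>)) (L2_norm (robin_measure \<Omega> \<kappa>))"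
  shows "weak_solution \<Omega> s T \<kappa> z u \<longleftrightarrow> P.solves T z u"
proof (cases "u \<in> bochner_L2 (time_measure T) (robin_space \<Omega> s \<kappa>) (robin_norm \<Omega> s \<kappa>)")
  case False
  then show ?thesis by (simp only: weak_solution_def P.solves_def norm_eqs simp_thms)
next
  case True
  have AEu: "AE t in time_measure T. u t \<in> robin_space \<Omega> s \<kappa>"
    using P.V.bochner_L2_AE_mem[of u "time_measure T"] True unfolding norm_eqs by blast
  have AEz: "AE t in time_measure T. z t \<in> L2_space (robin_measure \<Omega> \<kappa>)" by (rule L2.bochner_L2_AE_mem[OF z])
  have td: "to_dual \<Omega> f = (\<lambda>v. bf f v)" for f by (simp add: to_dual_def)
  have eq: "(AE t in time_measure T. u' t v + frac_const TYPE('a) s / 2 * gagliardo_form \<Omega> s (u t) v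
             + (LINT x|lebesgue_on (- \<Omega>). \<kappa> x * u t x * v x) = (LINT x|lebesgue_on (- \<Omega>). \<kappa> x * z t x * v x))
       \<longleftrightarrow> (AE t in time_measure T. u' t v + P.a (u t) v = kf (z t) v)" if v: "v \<in> robin_space \<Omega> s \<kappa>" for u' v
  proof (rule eventually_cong)
    note vZ = robin_spaceD(2)[OF v]
    show "AE t in time_measure T. (u' t v + frac_const TYPE('a) s / 2 * gagliardo_form \<Omega> s (u t) v
             + (LINT x|lebesgue_on (- \<Omega>). \<kappa> x * u t x * v x) = (LINT x|lebesgue_on (- \<Omega>). \<kappa> x * z t x * v x))
       \<longleftrightarrow> (u' t v + P.a (u t) v = kf (z t) v)"
      using AEu AEz
    proof eventually_elim
      fix t assume t: "u t \<in> robin_space \<Omega> s \<kappa>" "z t \<in> L2_space (robin_measure \<Omega> \<kappa>)"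
      note uZ = robin_spaceD(2)[OF t(1)]
      show "(u' t v + frac_const TYPE('a) s / 2 * gagliardo_form \<Omega> s (u t) v
             + (LINT x|lebesgue_on (- \<Omega>). \<kappa> x * u t x * v x) = (LINT x|lebesgue_on (- \<Omega>). \<kappa> x * z t x * v x))
       \<longleftrightarrow> (u' t v + P.a (u t) v = kf (z t) v)"
        unfolding robin_integral[OF uZ vZ] robin_integral[OF t(2) vZ] P.a_def by (simp add: add.assoc)
    qed
  qed
  have van: "vanishes_initially \<Omega> T u \<longleftrightarrow>
     (\<exists>U. continuous_into {0..T} (L2_space (lebesgue_on \<Omega>)) (L2_norm (lebesgue_on \<Omega>)) U \<and>
        (AE t in time_measure T. L2_norm (lebesgue_on \<Omega>) (\<lambda>i. U t i - u t i) = 0) \<and> L2_norm (lebesgue_on \<Omega>) (U 0) = 0)"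
    unfolding vanishes_initially_def
  proof (intro ex_cong1 conj_cong refl)
    fix U assume U: "continuous_into {0..T} (L2_space (lebesgue_on \<Omega>)) (L2_norm (lebesgue_on \<Omega>)) U"
    have UL: "U t \<in> L2_space (lebesgue_on \<Omega>)" if "t \<in> {0..T}" for t using U that unfolding continuous_into_def by blast
    have "0 \<in> {0..T}" using T by simp
    from UL[OF this]
    show "(AE x in lebesgue_on \<Omega>. U 0 x = 0) \<longleftrightarrow> L2_norm (lebesgue_on \<Omega>) (U 0) = 0"
      by (rule L2_norm_zero_iff[symmetric])
    show "(AE t in time_measure T. AE x in lebesgue_on \<Omega>. U t x = u t x) \<longleftrightarrow>
        (AE t in time_measure T. L2_norm (lebesgue_on \<Omega>) (\<lambda>i. U t i - u t i) = 0)"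
    proof (rule eventually_cong)
      show "AE t in time_measure T. (AE x in lebesgue_on \<Omega>. U t x = u t x) \<longleftrightarrow> L2_norm (lebesgue_on \<Omega>) (\<lambda>i. U t i - u t i) = 0"
        using AEu AE_space
      proof eventually_elim
        fix t assume t: "u t \<in> robin_space \<Omega> s \<kappa>" "t \<in> space (time_measure T)"
        have "(\<lambda>i. U t i - u t i) \<in> L2_space (lebesgue_on \<Omega>)"
          using t(2) by (intro L2.diff_mem UL robin_spaceD(1)[OF t(1)]) simp
        then have "L2_norm (lebesgue_on \<Omega>) (\<lambda>i. U t i - u t i) = 0 \<longleftrightarrow> (AE x in lebesgue_on \<Omega>. U t x - u t x = 0)"
          by (rule L2_norm_zero_iff)
        then show "(AE x in lebesgue_on \<Omega>. U t x = u t x) \<longleftrightarrow> L2_norm (lebesgue_on \<Omega>) (\<lambda>i. U t i - u t i) = 0" by simp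
      qed
    qed
  qed
  show ?thesis
    unfolding weak_solution_def P.solves_def norm_eqs td van norm_squares(1)[symmetric] by (simp only: eq cong: conj_cong ball_cong)
qed

lemma nrm_zero_AE:
  assumes f: "f \<in> robin_space \<Omega> s \<kappa>" and z: "robin_norm \<Omega> s \<kappa> f = 0"
  shows "AE x in lebesgue. f x = 0"
proof -
  have "bf f f + kf f f + gagliardo_form \<Omega> s f f = 0" using z by (simp add: robin_norm_eq)
  moreover have "0 \<le> bf f f" "0 \<le> kf f f" "0 \<le> gagliardo_form \<Omega> s f f" unfolding form_squares by simp_all
  ultimately have "bf f f = 0" "gagliardo_form \<Omega> s f f = 0" by linarith+
  then have n: "L2_norm (lebesgue_on \<Omega>) f = 0" "L2_norm plane (D f) = 0" unfolding norm_squares by simp_all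
  have A: "AE x in lebesgue_on \<Omega>. f x = 0" by (rule L2_norm_zero_AE[OF robin_spaceD(1)[OF f] n(1)])
  have B: "AE p in plane. D f p = 0" by (rule L2_norm_zero_AE[OF robin_spaceD(3)[OF f] n(2)])
  show ?thesis
  proof (rule AE_from_domain[OF \<Omega> A B])
    fix x y assume xy: "x \<notin> \<Omega>" "y \<in> \<Omega>" and y: "f y = 0" and q: "D f (x, y) = 0"
    have "(x, y) \<in> cross_region \<Omega>" "x \<noteq> y" using xy by (auto simp: cross_region_def)
    then show "f x = 0" using y q by (simp add: difference_quotient_def)
  qed
qed

end

theorem theorem3p11:
  fixes \<Omega> :: "'a::euclidean_space set" and s T :: real
    and \<kappa> :: "'a \<Rightarrow> real" and z :: "real \<Rightarrow> 'a \<Rightarrow> real"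
  assumes "0 < s" "s < 1" "0 < T"
    and "open \<Omega>" "connected \<Omega>" "\<Omega> \<noteq> {}" "bounded \<Omega>" "lipschitz_boundary \<Omega>"
    and "integrable (lebesgue_on (- \<Omega>)) \<kappa>"
    and "\<exists>C. AE x in lebesgue_on (- \<Omega>). \<bar>\<kappa> x\<bar> \<le> C"
    and "AE x in lebesgue_on (- \<Omega>). 0 \<le> \<kappa> x"
    and "z \<in> bochner_L2 (lebesgue_on {0<..<T})
               (L2_space (robin_measure \<Omega> \<kappa>)) (L2_norm (robin_measure \<Omega> \<kappa>))"
  shows "\<exists>u. weak_solution \<Omega> s T \<kappa> z u \<and>
             (\<forall>w. weak_solution \<Omega> s T \<kappa> z w \<longrightarrow>
                (AE t in lebesgue_on {0<..<T}. AE x in lebesgue. w t x = u t x))"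
proof -
  interpret robin_data \<Omega> s \<kappa> using assms by unfold_locales
  note iff = weak_solution_iff[OF assms(3) assms(12)]
  have "z \<in> bochner_L2 (time_measure T) (L2_space (robin_measure \<Omega> \<kappa>)) (\<lambda>v. sqrt (kf v v))"
    unfolding norm_eqs by (rule assms(12))
  from P.solution_exists[OF assms(3) this] obtain u where u: "P.solves T z u" by blast
  have "AE t in lebesgue_on {0<..<T}. AE x in lebesgue. w t x = u t x" if w: "P.solves T z w" for w
  proof -
    have mem: "AE t in time_measure T. f t \<in> robin_space \<Omega> s \<kappa>" if "P.solves T z f" for f
      using that unfolding P.solves_def by (intro P.V.bochner_L2_AE_mem) blast
    show ?thesis
      using P.solution_unique[OF assms(3) u w] mem[OF u] mem[OF w]
    proof eventually_elim
      fix t assume t: "sqrt (P.ipV (\<lambda>i. w t i - u t i) (\<lambda>i. w t i - u t i)) = 0" "u t \<in> robin_space \<Omega> s \<kappa>" "w t \<in> robin_space \<Omega> s \<kappa>"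
      have "robin_norm \<Omega> s \<kappa> (\<lambda>i. w t i - u t i) = 0" using t(1) unfolding norm_eqs(1)[symmetric] .
      from nrm_zero_AE[OF P.V.diff_mem[OF t(3,2)] this]
      show "AE x in lebesgue. w t x = u t x" by simp
    qed
  qed
  then show ?thesis using u unfolding iff by blast
qed

end
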